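(* Let $n>1$ be an integer, let $q>0$ be a real number which is not an integer, and let $H$ be a continuous, non-negative, even homogeneous function of degree $1$ on $\mathbb{R}^n$. Let $k=(n+[q])/2$ if $n+[q]$ is even, and $k=(n+[q]+1)/2$ if $n+[q]$ is odd, where $[q]$ is the integer part of $q$. Suppose that $\Delta^k H^q$ (differentiation in the sense of distributions, $\Delta$ the Laplace operator) is a function in $\mathbb{R}^n\setminus\{0\}$ such that $(\Delta^k H^q)|_\Omega\in L_1(\Omega)$. Then $H^q$ admits the Blaschke-Levy representation with the exponent $q$: there is an even function $b\in L_1(\Omega)$ such that $$H^q(x)=\int_\Omega |(x,\xi)|^q\, b(\xi)\,d\xi\qquad\text{for every } x\in\mathbb{R}^n,$$ and $b$ is given, for almost every $\xi\in\Omega$, by $$b(\xi)=(-1)^k\,\frac{\pi}{2(2\pi)^{n-1}C_{-n-q+2k}\,C_q}\int_\Omega |(\theta,\xi)|^{-n-q+2k}\,(\Delta^k H^q)(\theta)\,d\theta .$$ Moreover, $$\|b\|_1\le \frac{\pi W_{-n-q+2k}}{2(2\pi)^{n-1}\,|C_{-n-q+2k}\,C_q|}\,\|(\Delta^k H^q)|_\Omega\|_1 ,$$ and if $(\Delta^k H^q)|_\Omega\in L_\infty(\Omega)$ then $b\in L_\infty(\Omega)$ and $$\|b\|_\infty\le \frac{\pi W_{-n-q+2k}}{2(2\pi)^{n-1}\,|C_{-n-q+2k}\,C_q|}\,\|(\Delta^k H^q)|_\Omega\|_\infty .$$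
   Context: $\Omega$ is the Euclidean unit sphere in $\mathbb{R}^n$ with (unnormalized) surface measure $d\xi$; $(x,\xi)$ is the standard scalar product; $\|\cdot\|_1$, $\|\cdot\|_\infty$ are the norms of $L_1(\Omega)$ and $L_\infty(\Omega)$. A function $f$ is even homogeneous of degree $q$ if $f(\alpha x)=|\alpha|^q f(x)$ for all real $\alpha\ne0$. For $q>-1$, $q$ not an even integer, $$C_q=\frac{2^{q+1}\sqrt{\pi}\,\Gamma((q+1)/2)}{\Gamma(-q/2)},$$ and for $q>-1$, $$W_q=\int_\Omega|(x,\theta)|^q\,dx=\frac{2\,\Gamma((q+1)/2)\,\pi^{(n-1)/2}}{\Gamma((n+q)/2)}$$ (independent of $\theta\in\Omega$). *)

theory Defs
  imports "HOL-Probability.Essential_Supremum"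
begin

text \<open>
  The unnormalized surface measure, as the cone measure: the area of \<open>A\<close> is the dimension times
  the volume of the cone \<open>{r *\<^sub>R \<xi> | r \<xi>. 0 < r < 1, \<xi> \<in> A}\<close>
  (see \<open>emeasure_sphere_measure\<close> below). It is a measure on the Borel sets of the sphere.
\<close>

definition sphere_measure :: "'a::euclidean_space measure"
  where "sphere_measure =
    distr (scale_measure (of_nat DIM('a)) (restrict_space lborel (ball 0 1 - {0})))
      (restrict_space borel (sphere 0 1)) (\<lambda>x. x /\<^sub>R norm x)"

lemma space_sphere_measure [simp]: "space sphere_measure = sphere 0 1"
  by (simp add: sphere_measure_def space_restrict_space)

lemma sets_sphere_measure [measurable_cong]:
  "sets sphere_measure = sets (restrict_space borel (sphere 0 1))"
  by (simp add: sphere_measure_def)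

lemma emeasure_sphere_measure:
  fixes A :: "'a::euclidean_space set"
  assumes "A \<in> sets sphere_measure"
  shows "emeasure sphere_measure A =
    of_nat DIM('a) * emeasure lborel {x \<in> ball 0 1 - {0}. x /\<^sub>R norm x \<in> A}"
proof -
  let ?B = "ball 0 1 - {0} :: 'a set"
  let ?S = "restrict_space borel (sphere 0 1) :: 'a measure"
  have meas: "(\<lambda>x::'a. x /\<^sub>R norm x) \<in> restrict_space lborel ?B \<rightarrow>\<^sub>M ?S"
  proof (rule measurable_restrict_space2)
    show "(\<lambda>x::'a. x /\<^sub>R norm x) \<in> space (restrict_space lborel ?B) \<rightarrow> sphere 0 1"
      by (auto simp: space_restrict_space)
    show "(\<lambda>x::'a. x /\<^sub>R norm x) \<in> borel_measurable (restrict_space lborel ?B)"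
      by (intro measurable_restrict_space1) measurable
  qed
  then have "(\<lambda>x::'a. x /\<^sub>R norm x) \<in> scale_measure (of_nat DIM('a)) (restrict_space lborel ?B) \<rightarrow>\<^sub>M ?S"
    by (simp cong: measurable_cong_sets)
  then have "emeasure sphere_measure A = of_nat DIM('a) *
      emeasure (restrict_space lborel ?B) ((\<lambda>x. x /\<^sub>R norm x) -` A \<inter> ?B)"
    using assms unfolding sphere_measure_def
    by (subst emeasure_distr) (auto simp: space_restrict_space space_scale_measure)
  also have "(\<lambda>x. x /\<^sub>R norm x) -` A \<inter> ?B = {x \<in> ?B. x /\<^sub>R norm x \<in> A}"
    by auto
  also have "emeasure (restrict_space lborel ?B) \<dots> = emeasure lborel \<dots>"
    by (rule emeasure_restrict_space) auto
  finally show ?thesis .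
qed

definition sphere_L1_norm :: "('a::euclidean_space \<Rightarrow> real) \<Rightarrow> real"
  where "sphere_L1_norm f = (\<integral>\<xi>. \<bar>f \<xi>\<bar> \<partial>sphere_measure)"

definition sphere_Linf_norm :: "('a::euclidean_space \<Rightarrow> real) \<Rightarrow> ereal"
  where "sphere_Linf_norm f = esssup sphere_measure (\<lambda>\<xi>. ereal \<bar>f \<xi>\<bar>)"

definition sphere_Linf :: "('a::euclidean_space \<Rightarrow> real) set"
  where "sphere_Linf = {f \<in> borel_measurable sphere_measure. sphere_Linf_norm f < \<infinity>}"

definition even_homogeneous_on :: "'a::euclidean_space set \<Rightarrow> real \<Rightarrow> ('a \<Rightarrow> real) \<Rightarrow> bool"
  where "even_homogeneous_on S q f \<longleftrightarrow>
    (\<forall>x\<in>S. \<forall>\<alpha>. \<alpha> \<noteq> 0 \<longrightarrow> f (\<alpha> *\<^sub>R x) = \<bar>\<alpha>\<bar> powr q * f x)"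

definition blaschke_levy_representation ::
  "real \<Rightarrow> ('a::euclidean_space \<Rightarrow> real) \<Rightarrow> ('a \<Rightarrow> real) \<Rightarrow> bool"
  where "blaschke_levy_representation q f b \<longleftrightarrow>
    integrable sphere_measure b \<and> (\<forall>\<xi>\<in>sphere 0 1. b (- \<xi>) = b \<xi>) \<and>
    (\<forall>x. f x = (\<integral>\<xi>. \<bar>x \<bullet> \<xi>\<bar> powr q * b \<xi> \<partial>sphere_measure))"

text \<open>For \<open>q > -1\<close> and \<open>q\<close> not an even integer, so that no Gamma factor is at a pole.\<close>

definition C_const :: "real \<Rightarrow> real"
  where "C_const q = 2 powr (q + 1) * sqrt pi * Gamma ((q + 1) / 2) / Gamma (- q / 2)"

text \<open>
  For \<open>q > -1\<close> this does not depend on the unit vector \<open>\<theta>\<close>, and equals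
  \<open>2 * Gamma ((q + 1) / 2) * pi powr ((n - 1) / 2) / Gamma ((n + q) / 2)\<close> in dimension \<open>n\<close>.
\<close>

definition W_const :: "'a::euclidean_space \<Rightarrow> real \<Rightarrow> real"
  where "W_const \<theta> q = (\<integral>x. \<bar>x \<bullet> \<theta>\<bar> powr q \<partial>sphere_measure)"

definition partial_deriv :: "'a \<Rightarrow> ('a::euclidean_space \<Rightarrow> real) \<Rightarrow> 'a \<Rightarrow> real"
  where "partial_deriv v f x = frechet_derivative f (at x) v"

text \<open>All iterated partial derivatives exist and are differentiable, hence continuous.\<close>

definition smooth :: "('a::euclidean_space \<Rightarrow> real) \<Rightarrow> bool"
  where "smooth f \<longleftrightarrow> (\<forall>vs. set vs \<subseteq> Basis \<longrightarrow> fold partial_deriv vs f differentiable_on UNIV)"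

definition laplacian :: "('a::euclidean_space \<Rightarrow> real) \<Rightarrow> 'a \<Rightarrow> real"
  where "laplacian f x = (\<Sum>v\<in>Basis. partial_deriv v (partial_deriv v f) x)"

definition test_function_on :: "'a::euclidean_space set \<Rightarrow> ('a \<Rightarrow> real) \<Rightarrow> bool"
  where "test_function_on S \<phi> \<longleftrightarrow>
    smooth \<phi> \<and> compact (closure {x. \<phi> x \<noteq> 0}) \<and> closure {x. \<phi> x \<noteq> 0} \<subseteq> S"

definition locally_integrable_on :: "'a::euclidean_space set \<Rightarrow> ('a \<Rightarrow> real) \<Rightarrow> bool"
  where "locally_integrable_on S f \<longleftrightarrow> (\<forall>K. compact K \<and> K \<subseteq> S \<longrightarrow> set_integrable lborel K f)"

text \<open>
  On the open set \<open>S\<close> the distribution \<open>\<Delta>\<^sup>k u\<close> is the function \<open>g\<close>. There is no sign, since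
  the Laplacian is its own formal adjoint.
\<close>

definition distr_laplacian_power_on ::
  "'a::euclidean_space set \<Rightarrow> nat \<Rightarrow> ('a \<Rightarrow> real) \<Rightarrow> ('a \<Rightarrow> real) \<Rightarrow> bool"
  where "distr_laplacian_power_on S k u g \<longleftrightarrow>
    locally_integrable_on S u \<and> locally_integrable_on S g \<and>
    (\<forall>\<phi>. test_function_on S \<phi> \<longrightarrow>
      (\<integral>x. u x * (laplacian ^^ k) \<phi> x \<partial>lborel) = (\<integral>x. g x * \<phi> x \<partial>lborel))"

end

theory Submission
  imports Defs "HOL-Probability.Probability"
begin

text \<open>
  Write \<open>u = H powr q\<close> and test \<open>\<Delta>\<^sup>k u = g\<close> against \<open>h (x \<bullet> x) * (x \<bullet> l) ^ (2 * j)\<close> with \<open>h\<close>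
  a bump supported in \<open>[1, 4]\<close>. By homogeneity all radial integrals coincide, so the equation becomes
  a bidiagonal recursion that carries the moments \<open>\<integral>u (x) (x \<bullet> l) ^ (2 * j)\<close> over the sphere to those of
  \<open>g\<close>. Since \<open>q\<close> is not an integer, its diagonal does not vanish: the moments of \<open>g\<close> determine those of \<open>u\<close>,
  and hence the even continuous function \<open>u\<close> itself.

  It remains to see that the potential of \<open>b\<close> has the same moments, which by Fubini concerns only the
  kernels \<open>\<bar>x \<bullet> \<xi>\<bar> powr q\<close> and \<open>\<bar>\<theta> \<bullet> \<xi>\<bar> powr p\<close>. A Gaussian integral and a linear change of variables give
  the generating function of the moments of \<open>\<bar>x \<bullet> \<xi>\<bar> powr A\<close>,
  namely \<open>(1 - s) powr (- (A + 1) / 2) * (1 - s \<tau>) powr (A / 2)\<close> with \<open>\<tau> = 1 - (\<xi> \<bullet> l)\<^sup>2\<close>. The recursion just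
  lowers \<open>A\<close> by \<open>2\<close> in it; after \<open>k\<close> steps \<open>A = - n - p\<close>, and integrating against \<open>\<bar>\<theta> \<bullet> \<xi>\<bar> powr p\<close> with the
  same formula returns \<open>(\<theta> \<bullet> l) ^ (2 * j)\<close> up to a constant.
\<close>

section \<open>Polar coordinates for the cone measure\<close>

text \<open>The obstacle: after \<open>k\<close> Laplacians the kernel would be
  \<open>\<bar>x \<bullet> \<xi>\<bar> powr A\<close> with
  \<open>A = q - 2 * k = - n - p < -1\<close>. It is not integrable over the sphere, so its moments
  exist only by continuation in \<open>A\<close>. Hence the generating function is treated as a
  formal power series with \<open>A\<close> an arbitrary real number, and honest integrals occur
  only for the exponents \<open>q\<close> and \<open>p\<close>. The return through \<open>p\<close>
  works because \<open>1 - s * \<tau> = (1 - s) * (1 - s' * (\<xi> \<bullet> l)\<^sup>2)\<close>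
  with \<open>s' = - s / (1 - s)\<close>, and \<open>A / 2 = - (n + p) / 2\<close> is exactly the
  exponent for which the Gaussian formula of exponent \<open>p\<close> holds. All factors depending
  on \<open>j\<close> cancel; a quotient of Gamma values remains, the reciprocal of the constant in
  front of \<open>b\<close>. In the classical setting \<open>C_const q\<close> is the factor in the
  Fourier transform of \<open>\<bar>t\<bar> powr q\<close>; here it is met only as such a quotient.
  That moments determine an even continuous function is seen directly:
  \<open>(x \<bullet> l) ^ (2 * j)\<close> concentrates at \<open>l\<close> and
  \<open>- l\<close>.\<close>

lemma measurable_ident_sphere:
  "(\<lambda>x. x) \<in> sphere_measure \<rightarrow>\<^sub>M (borel :: 'a::euclidean_space measure)"
  by (simp add: measurable_cong_sets[OF sets_sphere_measure refl] measurable_restrict_space1)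

lemma borel_measurable_sphere_measureI:
  "f \<in> borel \<rightarrow>\<^sub>M N \<Longrightarrow> f \<in> sphere_measure \<rightarrow>\<^sub>M N"
  using measurable_compose[OF measurable_ident_sphere] by auto

lemma measurable_scaleR_sphere [measurable]:
  "(\<lambda>(\<theta>, r). r *\<^sub>R \<theta>) \<in> sphere_measure \<Otimes>\<^sub>M borel \<rightarrow>\<^sub>M (borel :: 'a::euclidean_space measure)"
proof -
  have "(\<lambda>z. (fst z, snd z)) \<in> sphere_measure \<Otimes>\<^sub>M borel \<rightarrow>\<^sub>M (borel :: 'a measure) \<Otimes>\<^sub>M (borel :: real measure)"
    by (intro measurable_Pair measurable_compose[OF measurable_fst measurable_ident_sphere] measurable_snd)
  then have "(\<lambda>z. (\<lambda>z. snd z *\<^sub>R fst z) (fst z, snd z)) \<in> sphere_measure \<Otimes>\<^sub>M borel \<rightarrow>\<^sub>M (borel :: 'a measure)"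
    by (rule measurable_compose) measurable
  then show ?thesis by (simp add: case_prod_beta')
qed

lemma emeasure_space_sphere_measure_finite:
  "emeasure sphere_measure (sphere 0 1 :: 'a::euclidean_space set) < \<infinity>"
proof -
  have "sphere 0 1 \<in> sets (sphere_measure :: 'a measure)"
    using sets.top[of "sphere_measure :: 'a measure"] by simp
  then have "emeasure sphere_measure (sphere 0 1 :: 'a set) =
    of_nat DIM('a) * emeasure lborel {x \<in> ball 0 1 - {0}. x /\<^sub>R norm x \<in> (sphere 0 1 :: 'a set)}"
    by (rule emeasure_sphere_measure)
  also have "\<dots> \<le> of_nat DIM('a) * emeasure lborel (ball 0 1 :: 'a set)"
    by (intro mult_left_mono emeasure_mono) auto
  also have "\<dots> < \<infinity>"
    by (metis ennreal_mult_less_top emeasure_lborel_ball_finite infinity_ennreal_def of_nat_less_top)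
  finally show ?thesis .
qed

interpretation sphere: finite_measure "sphere_measure :: 'a::euclidean_space measure"
  using emeasure_space_sphere_measure_finite[where 'a='a] by (intro finite_measureI) simp

lemma nn_integral_sphere_measure:
  fixes f :: "'a::euclidean_space \<Rightarrow> ennreal"
  assumes [measurable]: "f \<in> borel_measurable borel"
  shows "(\<integral>\<^sup>+\<xi>. f \<xi> \<partial>sphere_measure) =
    of_nat DIM('a) * (\<integral>\<^sup>+x. f (x /\<^sub>R norm x) * indicator (ball 0 1 - {0}) x \<partial>lborel)"
proof -
  let ?B = "ball 0 1 - {0} :: 'a set"
  let ?S = "restrict_space borel (sphere 0 1) :: 'a measure"
  have meas: "(\<lambda>x::'a. x /\<^sub>R norm x) \<in> restrict_space lborel ?B \<rightarrow>\<^sub>M ?S"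
  proof (rule measurable_restrict_space2)
    show "(\<lambda>x::'a. x /\<^sub>R norm x) \<in> space (restrict_space lborel ?B) \<rightarrow> sphere 0 1"
      by (auto simp: space_restrict_space)
    show "(\<lambda>x::'a. x /\<^sub>R norm x) \<in> borel_measurable (restrict_space lborel ?B)"
      by (intro measurable_restrict_space1) measurable
  qed
  have f: "f \<in> borel_measurable ?S"
    by (intro measurable_restrict_space1) measurable
  have "(\<integral>\<^sup>+\<xi>. f \<xi> \<partial>sphere_measure) = of_nat DIM('a) * (\<integral>\<^sup>+x. f (x /\<^sub>R norm x) \<partial>restrict_space lborel ?B)"
  proof -
    have "(\<lambda>x::'a. x /\<^sub>R norm x) \<in> scale_measure (of_nat DIM('a)) (restrict_space lborel ?B) \<rightarrow>\<^sub>M ?S"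
      using meas by (simp cong: measurable_cong_sets)
    then show ?thesis
      unfolding sphere_measure_def using f measurable_compose[OF meas f]
      by (subst nn_integral_distr) (auto simp: nn_integral_scale_measure)
  qed
  then show ?thesis by (simp add: nn_integral_restrict_space)
qed

lemma nn_integral_scaleR_lborel:
  fixes f :: "'a::euclidean_space \<Rightarrow> ennreal"
  assumes [measurable]: "f \<in> borel_measurable borel" and "c > 0"
  shows "(\<integral>\<^sup>+x. f x \<partial>lborel) = ennreal (c ^ DIM('a)) * (\<integral>\<^sup>+x. f (c *\<^sub>R x) \<partial>lborel)"
  by (subst lborel_affine[of c 0])
     (use assms(2) in \<open>auto simp: nn_integral_density nn_integral_distr nn_integral_cmult\<close>)

definition radial_measure :: "nat \<Rightarrow> real measure"
  where "radial_measure n = density lborel (\<lambda>r. ennreal (indicator {0<..} r * r ^ (n - 1)))"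

lemma sets_radial_measure [measurable_cong, simp]: "sets (radial_measure n) = sets borel"
  and space_radial_measure [simp]: "space (radial_measure n) = UNIV"
  by (simp_all add: radial_measure_def)

lemma sigma_finite_radial_measure: "sigma_finite_measure (radial_measure n)"
  unfolding radial_measure_def
  by (subst sigma_finite_measure.sigma_finite_iff_density_finite[OF sigma_finite_lborel]) auto

lemma nn_integral_radial_measure:
  assumes [measurable]: "f \<in> borel_measurable borel"
  shows "(\<integral>\<^sup>+r. f r \<partial>radial_measure n) = (\<integral>\<^sup>+r. ennreal (indicator {0<..} r * r ^ (n - 1)) * f r \<partial>lborel)"
  unfolding radial_measure_def by (subst nn_integral_density) auto

text \<open>With \<open>a = norm y\<close> this is what \<open>nn_integral_polar\<close> leaves of
  the radial variable for a fixed point \<open>y\<close>; the factor \<open>n\<close> is the one in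
  the definition of the cone measure.\<close>

lemma nn_integral_tail_power:
  assumes "a > 0" "n > (0::nat)"
  shows "(\<integral>\<^sup>+s. ennreal (real n * s powr (- real n - 1)) * indicator {a<..} s \<partial>lborel) = ennreal (a powr (- real n))"
proof -
  have "(\<integral>\<^sup>+s. ennreal (real n * s powr (- real n - 1)) * indicator {a..} s \<partial>lborel) = ennreal (0 - (- (a powr (- real n))))"
  proof (rule nn_integral_FTC_atLeast)
    fix x assume "a \<le> x"
    then show "((\<lambda>s. - (s powr (- real n))) has_real_derivative (real n * x powr (- real n - 1))) (at x)"
      using assms by (auto intro!: derivative_eq_intros)
    show "0 \<le> real n * x powr (- real n - 1)" by simp
  next
    have "((\<lambda>x. x powr (- real n)) \<longlongrightarrow> 0) at_top"
      using assms by (intro tendsto_neg_powr filterlim_ident) auto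
    then show "((\<lambda>x. - (x powr (- real n))) \<longlongrightarrow> 0) at_top" by (auto dest: tendsto_minus)
  qed auto
  moreover have "(\<integral>\<^sup>+s. ennreal (real n * s powr (- real n - 1)) * indicator {a<..} s \<partial>lborel) =
     (\<integral>\<^sup>+s. ennreal (real n * s powr (- real n - 1)) * indicator {a..} s \<partial>lborel)"
  proof (rule nn_integral_cong_AE)
    show "AE s in lborel. ennreal (real n * s powr (- real n - 1)) * indicator {a<..} s = ennreal (real n * s powr (- real n - 1)) * indicator {a..} s"
      using AE_lborel_singleton[of a] by eventually_elim (auto simp: indicator_def)
  qed
  ultimately show ?thesis by simp
qed

text \<open>The cone measure makes the outer integral an integral over directions of points
  \<open>x\<close> of the unit ball. Rescaling \<open>r = norm x * s\<close> removes the
  normalization of \<open>x\<close>, and \<open>y = s *\<^sub>R x\<close> for fixed \<open>s\<close>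
  turns \<open>norm x < 1\<close> into \<open>norm y < s\<close>. For fixed \<open>y\<close> the
  weight left over is \<open>n * norm y ^ n\<close> times the integral of
  \<open>s powr (- n - 1)\<close> over \<open>s > norm y\<close>, which is 1.\<close>

lemma nn_integral_polar:
  fixes f :: "'a::euclidean_space \<Rightarrow> ennreal"
  assumes [measurable]: "f \<in> borel_measurable borel"
  shows "(\<integral>\<^sup>+x. f x \<partial>lborel) =
    (\<integral>\<^sup>+\<theta>. (\<integral>\<^sup>+r. f (r *\<^sub>R \<theta>) \<partial>radial_measure DIM('a)) \<partial>sphere_measure)"
proof -
  let ?n = "DIM('a)"
  define C where "C = {z :: 'a \<times> real. norm (fst z) < snd z}"
  have [measurable]: "C \<in> sets (borel \<Otimes>\<^sub>M borel)" unfolding C_def borel_prod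
    by (intro borel_open open_Collect_less continuous_intros)
  define B where "B = (ball 0 1 - {0} :: 'a set)"
  have [measurable]: "B \<in> sets borel" by (simp add: B_def)
  have n: "real ?n > 0" "?n > 0" by auto
  define w where "w = (\<lambda>r::real. ennreal (indicator {0<..} r * r ^ (?n - 1)))"
  have [measurable]: "w \<in> borel_measurable borel" unfolding w_def by measurable
  let ?L = "\<lambda>x s. w s * ennreal (norm x ^ ?n) * f (s *\<^sub>R x) * indicator B x"
  let ?K = "\<lambda>y s. indicator C (y, s) * ennreal (s powr (- real ?n - 1) * norm y ^ ?n) * f y * indicator (-{0}) y"
  have pair: "pair_sigma_finite (lborel :: 'a measure) (lborel :: real measure)"
    by (simp add: pair_sigma_finite_def sigma_finite_lborel)
  have pair': "pair_sigma_finite (lborel :: real measure) (lborel :: 'a measure)"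
    by (simp add: pair_sigma_finite_def sigma_finite_lborel)
  have "(\<integral>\<^sup>+\<theta>. (\<integral>\<^sup>+r. f (r *\<^sub>R \<theta>) \<partial>radial_measure ?n) \<partial>sphere_measure)
      = (\<integral>\<^sup>+\<theta>. (\<integral>\<^sup>+r. w r * f (r *\<^sub>R \<theta>) \<partial>lborel) \<partial>sphere_measure)"
    by (simp add: nn_integral_radial_measure w_def)
  also have "\<dots> = ?n * (\<integral>\<^sup>+x. (\<integral>\<^sup>+r. w r * f (r *\<^sub>R (x /\<^sub>R norm x)) \<partial>lborel) * indicator B x \<partial>lborel)"
    unfolding B_def by (subst nn_integral_sphere_measure) auto
  also have "\<dots> = ?n * (\<integral>\<^sup>+x. (\<integral>\<^sup>+s. ?L x s \<partial>lborel) \<partial>lborel)"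
  proof (rule arg_cong2[where f="(*)", OF refl nn_integral_cong])
    fix x :: 'a
    show "(\<integral>\<^sup>+r. w r * f (r *\<^sub>R (x /\<^sub>R norm x)) \<partial>lborel) * indicator B x =
      (\<integral>\<^sup>+s. ?L x s \<partial>lborel)"
    proof (cases "x \<in> B")
      case True
      then have x: "norm x > 0" by (auto simp: B_def)
      have "(\<integral>\<^sup>+r. w r * f (r *\<^sub>R (x /\<^sub>R norm x)) \<partial>lborel) =
        ennreal (norm x) * (\<integral>\<^sup>+s. w (norm x * s) * f ((norm x * s) *\<^sub>R (x /\<^sub>R norm x)) \<partial>lborel)"
        using x by (subst nn_integral_real_affine[where c="norm x" and t=0]) auto
      also have "\<dots> = (\<integral>\<^sup>+s. ennreal (norm x) * (w (norm x * s) * f ((norm x * s) *\<^sub>R (x /\<^sub>R norm x))) \<partial>lborel)"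
        by (subst nn_integral_cmult) auto
      also have "\<dots> = (\<integral>\<^sup>+s. w s * ennreal (norm x ^ ?n) * f (s *\<^sub>R x) \<partial>lborel)"
      proof (rule nn_integral_cong)
        fix s :: real
        have "ennreal (norm x) * w (norm x * s) = w s * ennreal (norm x ^ ?n)"
          using x by (auto simp: w_def indicator_def zero_less_mult_iff power_mult_distrib
              ennreal_mult'[symmetric] mult_ac power_eq_if[of _ "DIM('a)"])
        moreover have "(norm x * s) *\<^sub>R (x /\<^sub>R norm x) = s *\<^sub>R x" using x by simp
        ultimately show "ennreal (norm x) * (w (norm x * s) * f ((norm x * s) *\<^sub>R (x /\<^sub>R norm x))) =
          w s * ennreal (norm x ^ ?n) * f (s *\<^sub>R x)" by (metis mult.assoc)
      qed
      finally show ?thesis using True by simp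
    qed simp
  qed
  also have "\<dots> = ?n * (\<integral>\<^sup>+s. (\<integral>\<^sup>+x. ?L x s \<partial>lborel) \<partial>lborel)"
    by (subst pair_sigma_finite.Fubini'[OF pair']) auto
  also have "\<dots> = ?n * (\<integral>\<^sup>+s. (\<integral>\<^sup>+y. ?K y s \<partial>lborel) \<partial>lborel)"
  proof (rule arg_cong2[where f="(*)", OF refl nn_integral_cong])
    fix s :: real
    show "(\<integral>\<^sup>+x. ?L x s \<partial>lborel) =
      (\<integral>\<^sup>+y. ?K y s \<partial>lborel)"
    proof (cases "s > 0")
      case True
      have "(\<integral>\<^sup>+y. ?K y s \<partial>lborel)
       = ennreal (s ^ ?n) * (\<integral>\<^sup>+x. ?K (s *\<^sub>R x) s \<partial>lborel)"
        using True by (subst nn_integral_scaleR_lborel[of _ s]) auto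
      also have "\<dots> = (\<integral>\<^sup>+x. ennreal (s ^ ?n) * (?K (s *\<^sub>R x) s) \<partial>lborel)"
        by (subst nn_integral_cmult) auto
      also have "\<dots> = (\<integral>\<^sup>+x. ?L x s \<partial>lborel)"
      proof (rule nn_integral_cong)
        fix x :: 'a
        \<comment> \<open>The Jacobian \<open>s ^ n\<close> and the factor
          \<open>norm (s *\<^sub>R x) ^ n\<close> against \<open>s powr (- n - 1)\<close> leave the
          radial density \<open>s ^ (n - 1)\<close>.\<close>
        have e: "s ^ ?n * (s powr (- real ?n - 1) * (s ^ ?n)) = s ^ (?n - 1)"
        proof -
          have "s ^ ?n * (s powr (- real ?n - 1) * (s ^ ?n)) = s powr (real ?n + (- real ?n - 1) + real ?n)"
            using True by (simp only: powr_add powr_realpow mult_ac)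
          also have "real ?n + (- real ?n - 1) + real ?n = real (?n - 1)" using n by simp
          finally show ?thesis using True by (simp only: powr_realpow)
        qed
        have e1: "ennreal (s ^ ?n) * (ennreal (s powr (- real ?n - 1) * norm (s *\<^sub>R x) ^ ?n)) = ennreal (s ^ (?n - 1)) * ennreal (norm x ^ ?n)"
        proof -
          have "ennreal (s ^ ?n) * (ennreal (s powr (- real ?n - 1) * norm (s *\<^sub>R x) ^ ?n)) =
              ennreal (s ^ ?n * (s powr (- real ?n - 1) * (s ^ ?n)) * norm x ^ ?n)"
            using True by (simp add: ennreal_mult'[symmetric] power_mult_distrib mult_ac)
          also have "\<dots> = ennreal (s ^ (?n - 1)) * ennreal (norm x ^ ?n)"
            unfolding e using True by (intro ennreal_mult) auto
          finally show ?thesis .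
        qed
        have e2: "(indicator C (s *\<^sub>R x, s) :: ennreal) * indicator (-{0}) (s *\<^sub>R x) = indicator B x"
          using True by (auto simp: indicator_def B_def C_def)
        have e3: "w s = ennreal (s ^ (?n - 1))" using True by (simp add: w_def)
        have "a * (i * b * c * j) = (a * b) * c * (i * j)" for a b c i j :: ennreal
          by (simp add: mult_ac)
        then show "ennreal (s ^ ?n) * (?K (s *\<^sub>R x) s)
         = ?L x s"
          by (simp only: e1 e2 e3)
      qed
      finally show ?thesis by simp
    next
      case False
      then have "\<And>y::'a. \<not> norm y < s" by (meson less_le_trans norm_ge_zero not_le order.trans)
      then show ?thesis using False by (simp add: w_def C_def)
    qed
  qed
  also have "\<dots> = ?n * (\<integral>\<^sup>+y. (\<integral>\<^sup>+s. ?K y s \<partial>lborel) \<partial>lborel)"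
    by (subst pair_sigma_finite.Fubini'[OF pair]) auto
  also have "\<dots> = (\<integral>\<^sup>+y. ?n * (\<integral>\<^sup>+s. ?K y s \<partial>lborel) \<partial>lborel)"
    by (subst nn_integral_cmult) auto
  also have "\<dots> = (\<integral>\<^sup>+y. f y \<partial>lborel)"
  proof (rule nn_integral_cong_AE)
    show "AE y in lborel. ?n * (\<integral>\<^sup>+s. ?K y s \<partial>lborel) = f y"
      using AE_lborel_singleton[of "0::'a"]
    proof eventually_elim
      case (elim y)
      then have y: "norm y > 0" by simp
      have "?n * (\<integral>\<^sup>+s. ?K y s \<partial>lborel)
        = (\<integral>\<^sup>+s. ?n * (?K y s) \<partial>lborel)"
        by (subst nn_integral_cmult) auto
      also have "\<dots> = (\<integral>\<^sup>+s. (ennreal (norm y ^ ?n) * f y) * (ennreal (real ?n * s powr (- real ?n - 1)) * indicator {norm y<..} s) \<partial>lborel)"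
        using elim by (intro nn_integral_cong)
            (simp add: C_def indicator_def ennreal_mult' ennreal_of_nat_eq_real_of_nat mult_ac)
      also have "\<dots> = (ennreal (norm y ^ ?n) * f y) * ennreal (norm y powr (- real ?n))"
        by (subst nn_integral_cmult) (auto simp: nn_integral_tail_power[OF y n(2)])
      also have "\<dots> = ennreal (norm y ^ ?n * norm y powr (- real ?n)) * f y"
        by (simp add: ennreal_mult' mult_ac)
      also have "norm y ^ ?n * norm y powr (- real ?n) = 1"
        using y by (simp add: powr_minus powr_realpow)
      finally show ?case by simp
    qed
  qed
  finally show ?thesis by simp
qed

lemma polar_coordinates:
  "(lborel :: 'a::euclidean_space measure) =
    distr (sphere_measure \<Otimes>\<^sub>M radial_measure DIM('a)) borel (\<lambda>(\<theta>, r). r *\<^sub>R \<theta>)"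
proof (rule measure_eqI)
  fix A :: "'a set" assume "A \<in> sets lborel"
  then have [measurable]: "A \<in> sets borel" by simp
  interpret R: sigma_finite_measure "radial_measure DIM('a)" by (rule sigma_finite_radial_measure)
  have "emeasure lborel A = (\<integral>\<^sup>+x. indicator A x \<partial>lborel)" by simp
  also have "\<dots> = (\<integral>\<^sup>+\<theta>. (\<integral>\<^sup>+r. indicator A (r *\<^sub>R \<theta>) \<partial>radial_measure DIM('a)) \<partial>sphere_measure)"
    by (rule nn_integral_polar) simp
  also have "\<dots> = (\<integral>\<^sup>+z. (\<lambda>(\<theta>, r). indicator A (r *\<^sub>R \<theta>)) z \<partial>(sphere_measure \<Otimes>\<^sub>M radial_measure DIM('a)))"
    by (subst R.nn_integral_fst[symmetric]) auto
  also have "\<dots> = (\<integral>\<^sup>+x. indicator A x \<partial>distr (sphere_measure \<Otimes>\<^sub>M radial_measure DIM('a)) borel (\<lambda>(\<theta>, r). r *\<^sub>R \<theta>))"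
    by (subst nn_integral_distr) (auto intro!: nn_integral_cong)
  also have "\<dots> = emeasure (distr (sphere_measure \<Otimes>\<^sub>M radial_measure DIM('a)) borel (\<lambda>(\<theta>, r). r *\<^sub>R \<theta>)) A"
    by simp
  finally show "emeasure lborel A = \<dots>" .
qed simp

section \<open>Orthogonal invariance\<close>

text \<open>Weil's argument: comparing with Lebesgue measure through Fubini, with a unit ball as gauge.\<close>

lemma lborel_eqI_translation_invariant:
  fixes M :: "'a::euclidean_space measure"
  assumes sets: "sets M = sets borel" and "sigma_finite_measure M"
    and transl: "\<And>c. distr M borel (\<lambda>x. c + x) = M"
    and unit: "emeasure M (ball 0 1) = emeasure lborel (ball 0 1 :: 'a set)"
  shows "M = lborel"
proof (rule measure_eqI)
  fix A assume "A \<in> sets M"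
  then have A [measurable]: "A \<in> sets borel" using sets by simp
  note [measurable_cong] = sets
  interpret M: sigma_finite_measure M by fact
  have pair: "pair_sigma_finite M (lborel :: 'a measure)"
    by (simp add: pair_sigma_finite_def sigma_finite_lborel assms)
  have pair': "pair_sigma_finite (lborel :: 'a measure) M"
    by (simp add: pair_sigma_finite_def sigma_finite_lborel assms)
  have sh: "(\<integral>\<^sup>+x. f (c + x) \<partial>M) = (\<integral>\<^sup>+x. f x \<partial>M)"
    if [measurable]: "f \<in> borel_measurable borel" for f :: "'a \<Rightarrow> ennreal" and c
  proof -
    have "(\<integral>\<^sup>+x. f x \<partial>M) = (\<integral>\<^sup>+x. f x \<partial>distr M borel (\<lambda>x. c + x))" by (simp add: transl)
    also have "\<dots> = (\<integral>\<^sup>+x. f (c + x) \<partial>M)"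
      by (subst nn_integral_distr) (auto simp: measurable_cong_sets[OF sets refl])
    finally show ?thesis by simp
  qed
  have shl: "(\<integral>\<^sup>+x. f (c + x) \<partial>lborel) = (\<integral>\<^sup>+x. f x \<partial>lborel)"
    if [measurable]: "f \<in> borel_measurable borel" for f :: "'a \<Rightarrow> ennreal" and c
  proof -
    have "(\<integral>\<^sup>+x. f x \<partial>lborel) = (\<integral>\<^sup>+x. f x \<partial>distr lborel borel (\<lambda>x. c + x))" by (simp add: lborel_distr_plus)
    also have "\<dots> = (\<integral>\<^sup>+x. f (c + x) \<partial>lborel)" by (subst nn_integral_distr) auto
    finally show ?thesis by simp
  qed
  have neg: "(\<integral>\<^sup>+y. indicator A (x - y) \<partial>lborel) = emeasure lborel A" for x
  proof -
    have "(\<integral>\<^sup>+y. indicator A y \<partial>lborel) = (\<integral>\<^sup>+y. indicator A (x - y) \<partial>lborel)"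
      by (subst lborel_affine[of "-1" x]) (auto simp: nn_integral_density nn_integral_distr)
    then show ?thesis by simp
  qed
  define C where "C = (ball 0 1 :: 'a set)"
  have [measurable]: "C \<in> sets borel" by (simp add: C_def)
  have "emeasure M A * emeasure lborel C = (\<integral>\<^sup>+x. indicator A x * emeasure lborel C \<partial>M)"
    by (subst nn_integral_multc) (auto simp: sets)
  \<comment> \<open>The gauge \<open>C\<close> is spread over its translates, so that its Lebesgue
    measure becomes an inner integral. After the exchange, invariance of \<open>M\<close> moves the
    translation from \<open>C\<close> to \<open>A\<close>, and a second exchange reads off the
    Lebesgue measure of \<open>A\<close>.\<close>
  also have "\<dots> = (\<integral>\<^sup>+x. (\<integral>\<^sup>+y. indicator A x * indicator C (x + y) \<partial>lborel) \<partial>M)"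
    by (intro nn_integral_cong) (auto simp: nn_integral_cmult shl[where f="indicator C"])
  also have "\<dots> = (\<integral>\<^sup>+y. (\<integral>\<^sup>+x. indicator A x * indicator C (x + y) \<partial>M) \<partial>lborel)"
    by (subst pair_sigma_finite.Fubini'[OF pair]) auto
  also have "\<dots> = (\<integral>\<^sup>+y. (\<integral>\<^sup>+x. indicator A (x - y) * indicator C x \<partial>M) \<partial>lborel)"
  proof (rule nn_integral_cong)
    fix y
    show "(\<integral>\<^sup>+x. indicator A x * indicator C (x + y) \<partial>M) = (\<integral>\<^sup>+x. indicator A (x - y) * indicator C x \<partial>M)"
      using sh[of "\<lambda>x. indicator A (x - y) * indicator C x" y] by (simp add: add.commute)
  qed
  also have "\<dots> = (\<integral>\<^sup>+x. (\<integral>\<^sup>+y. indicator A (x - y) * indicator C x \<partial>lborel) \<partial>M)"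
    by (subst pair_sigma_finite.Fubini'[OF pair]) auto
  also have "\<dots> = (\<integral>\<^sup>+x. emeasure lborel A * indicator C x \<partial>M)"
    by (intro nn_integral_cong) (auto simp: nn_integral_multc neg)
  also have "\<dots> = emeasure lborel A * emeasure M C"
    by (subst nn_integral_cmult) (auto simp: sets)
  also have "emeasure M C = emeasure lborel C" by (simp add: C_def unit)
  finally have "emeasure M A * emeasure lborel C = emeasure lborel A * emeasure lborel C" .
  moreover have "emeasure lborel C \<noteq> 0" "emeasure lborel C \<noteq> \<infinity>"
    using emeasure_lborel_ball_finite[of "0::'a" 1] content_ball_pos[of 1 "0::'a"]
    by (auto simp: C_def measure_def)
  ultimately show "emeasure M A = emeasure lborel A"
    by (metis ennreal_mult_divide_eq infinity_ennreal_def)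
qed (simp add: assms)

lemma borel_measurable_orthogonal:
  fixes T :: "'a::euclidean_space \<Rightarrow> 'a"
  assumes "orthogonal_transformation T"
  shows "T \<in> borel \<rightarrow>\<^sub>M borel"
  using orthogonal_transformation_linear[OF assms]
  by (intro borel_measurable_continuous_onI linear_continuous_on linear_conv_bounded_linear[THEN iffD1])

text \<open>No determinant is computed: the image measure is again translation invariant, because
  \<open>c + T x = T (d + x)\<close> for \<open>c = T d\<close>, and \<open>T\<close> preserves the
  unit ball.\<close>

lemma distr_lborel_orthogonal:
  fixes T :: "'a::euclidean_space \<Rightarrow> 'a"
  assumes T: "orthogonal_transformation T"
  shows "distr lborel borel T = lborel"
proof (rule lborel_eqI_translation_invariant)
  have lin: "linear T" using T by (rule orthogonal_transformation_linear)
  have [measurable]: "T \<in> borel \<rightarrow>\<^sub>M borel" using T by (rule borel_measurable_orthogonal)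
  have nT: "norm (T x) = norm x" for x using T by (simp add: orthogonal_transformation)
  have surj: "surj T" using T by (rule orthogonal_transformation_surj)
  show "sigma_finite_measure (distr lborel borel T)"
  proof
    show "\<exists>A. countable A \<and> A \<subseteq> sets (distr lborel borel T) \<and> \<Union> A = space (distr lborel borel T) \<and>
      (\<forall>a\<in>A. emeasure (distr lborel borel T) a \<noteq> \<infinity>)"
    proof (intro exI[of _ "range (\<lambda>n::nat. ball 0 (real n) :: 'a set)"] conjI ballI)
      have "\<exists>n::nat. norm x < real n" for x :: 'a by (rule reals_Archimedean2)
      then show "\<Union> (range (\<lambda>n::nat. ball 0 (real n) :: 'a set)) = space (distr lborel borel T)"
        by auto
      fix a assume "a \<in> range (\<lambda>n::nat. ball 0 (real n) :: 'a set)"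
      then obtain n :: nat where a: "a = ball 0 (real n)" by auto
      have "T -` ball 0 (real n) = ball 0 (real n)" by (auto simp: nT)
      then show "emeasure (distr lborel borel T) a \<noteq> \<infinity>"
        using emeasure_lborel_ball_finite[of "0::'a" "real n"] by (simp add: a emeasure_distr)
    qed auto
  qed
  show "distr (distr lborel borel T) borel (\<lambda>x. c + x) = distr lborel borel T" for c
  proof -
    obtain d where d: "c = T d" using surj by (metis surjD)
    have "distr (distr lborel borel T) borel (\<lambda>x. c + x) = distr lborel borel (\<lambda>x. c + T x)"
      by (subst distr_distr) (auto simp: comp_def)
    also have "\<dots> = distr lborel borel (\<lambda>x. T (d + x))"
      using lin by (simp add: d linear_add)
    also have "\<dots> = distr (distr lborel borel (\<lambda>x. d + x)) borel T"
      by (subst distr_distr) (auto simp: comp_def)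
    also have "\<dots> = distr lborel borel T" by (simp add: lborel_distr_plus)
    finally show ?thesis .
  qed
  have "T -` ball 0 1 = ball 0 1" by (auto simp: nT)
  then show "emeasure (distr lborel borel T) (ball 0 1) = emeasure lborel (ball 0 1 :: 'a set)"
    by (simp add: emeasure_distr)
qed simp

text \<open>The radial projection commutes with \<open>T\<close>, so the cone description carries
  the invariance over from Lebesgue measure.\<close>

lemma nn_integral_sphere_orthogonal:
  fixes T :: "'a::euclidean_space \<Rightarrow> 'a" and f :: "'a \<Rightarrow> ennreal"
  assumes T: "orthogonal_transformation T" and [measurable]: "f \<in> borel_measurable borel"
  shows "(\<integral>\<^sup>+x. f (T x) \<partial>sphere_measure) = (\<integral>\<^sup>+x. f x \<partial>sphere_measure)"
proof -
  have lin: "linear T" using T by (rule orthogonal_transformation_linear)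
  have [measurable]: "T \<in> borel \<rightarrow>\<^sub>M borel" using T by (rule borel_measurable_orthogonal)
  have nT: "norm (T x) = norm x" for x using T by (simp add: orthogonal_transformation)
  define B where "B = (ball 0 1 - {0} :: 'a set)"
  have [measurable]: "B \<in> sets borel" by (simp add: B_def)
  have "(\<integral>\<^sup>+x. f (T x) \<partial>sphere_measure) = of_nat DIM('a) * (\<integral>\<^sup>+x. f (T (x /\<^sub>R norm x)) * indicator B x \<partial>lborel)"
    unfolding B_def by (rule nn_integral_sphere_measure) simp
  also have "(\<integral>\<^sup>+x. f (T (x /\<^sub>R norm x)) * indicator B x \<partial>lborel) =
     (\<integral>\<^sup>+x. f (T x /\<^sub>R norm (T x)) * indicator B (T x) \<partial>lborel)"
  proof (rule nn_integral_cong)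
    fix x :: 'a
    have "T x = 0 \<longleftrightarrow> x = 0" using nT[of x] by (metis norm_eq_zero)
    then show "f (T (x /\<^sub>R norm x)) * indicator B x = f (T x /\<^sub>R norm (T x)) * indicator B (T x)"
      using linear_scale[OF lin, of "inverse (norm x)" x] by (auto simp: indicator_def nT B_def)
  qed
  also have "\<dots> = (\<integral>\<^sup>+x. f (x /\<^sub>R norm x) * indicator B x \<partial>distr lborel borel T)"
    by (subst nn_integral_distr) auto
  also have "\<dots> = (\<integral>\<^sup>+x. f (x /\<^sub>R norm x) * indicator B x \<partial>lborel)"
    by (simp add: distr_lborel_orthogonal[OF T])
  also have "of_nat DIM('a) * \<dots> = (\<integral>\<^sup>+x. f x \<partial>sphere_measure)"
    unfolding B_def by (rule nn_integral_sphere_measure[symmetric]) simp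
  finally show ?thesis .
qed

text \<open>Polar coordinates need a Borel function on the whole space, while the hypothesis speaks
  of the sphere, a null set. Off the origin the function is \<open>norm x powr a\<close> times its
  value at \<open>x /\<^sub>R norm x\<close>, and its value at the single point 0 is
  arbitrary.\<close>

lemma homogeneous_borel_measurable:
  fixes f :: "'a::euclidean_space \<Rightarrow> real"
  assumes hom: "\<And>x r. r > 0 \<Longrightarrow> norm x = 1 \<Longrightarrow> f (r *\<^sub>R x) = r powr a * f x"
    and f: "f \<in> borel_measurable sphere_measure"
  shows "f \<in> borel_measurable borel"
proof -
  have "(\<lambda>x::'a. x /\<^sub>R norm x) \<in> restrict_space borel (-{0}) \<rightarrow>\<^sub>M restrict_space borel (sphere 0 1)"
  proof (rule measurable_restrict_space2)
    show "(\<lambda>x::'a. x /\<^sub>R norm x) \<in> borel_measurable (restrict_space borel (-{0}))"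
      by (intro borel_measurable_continuous_on_restrict continuous_intros) auto
  qed (auto simp: space_restrict_space)
  then have [measurable]: "(\<lambda>x. f (x /\<^sub>R norm x)) \<in> borel_measurable (restrict_space borel (-{0}))"
    using f by (auto intro: measurable_compose cong: measurable_cong_sets[OF sets_sphere_measure refl])
  have "(\<lambda>x. norm x powr a * f (x /\<^sub>R norm x)) \<in> borel_measurable (restrict_space borel (-{0::'a}))"
    by (intro borel_measurable_times) (auto intro: measurable_restrict_space1)
  then have "f \<in> borel_measurable (restrict_space borel (-{0::'a}))"
  proof (rule measurable_cong[THEN iffD1, rotated])
    fix w assume "w \<in> space (restrict_space borel (- {0::'a}))"
    then have "w \<noteq> 0" by (auto simp: space_restrict_space)
    then show "norm w powr a * f (w /\<^sub>R norm w) = f w"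
      using hom[of "norm w" "w /\<^sub>R norm w"] by simp
  qed
  moreover have "{x::'a. x \<in> -{0}} = -{0}" by auto
  ultimately have "(\<lambda>x. if x \<in> -{0} then f x else f 0) \<in> borel_measurable borel"
    by (subst measurable_If_restrict_space_iff) (auto simp del: Compl_iff intro: measurable_restrict_space1)
  also have "(\<lambda>x. if x \<in> -{0} then f x else f 0) = f" by auto
  finally show ?thesis .
qed

lemma has_bochner_integral_pair_times:
  fixes f :: "'a \<Rightarrow> real" and g :: "'b \<Rightarrow> real"
  assumes "sigma_finite_measure M" "sigma_finite_measure N"
    and f: "integrable M f" and g: "integrable N g"
  shows "has_bochner_integral (M \<Otimes>\<^sub>M N) (\<lambda>(x, y). f x * g y) (integral\<^sup>L M f * integral\<^sup>L N g)"
proof -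
  interpret pair_sigma_finite M N using assms by (simp add: pair_sigma_finite_def)
  have [measurable]: "f \<in> borel_measurable M" "g \<in> borel_measurable N" using f g by auto
  have i: "integrable (M \<Otimes>\<^sub>M N) (\<lambda>(x, y). f x * g y)"
  proof (rule Fubini_integrable)
    have "integrable M (\<lambda>x. norm (f x) * (\<integral>y. norm (g y) \<partial>N))"
      using f by (intro integrable_mult_left integrable_norm)
    then show "integrable M (\<lambda>x. \<integral>y. norm (case (x, y) of (x, y) \<Rightarrow> f x * g y) \<partial>N)"
      by (simp add: abs_mult)
  qed (use g in auto)
  have "integral\<^sup>L (M \<Otimes>\<^sub>M N) (\<lambda>(x, y). f x * g y) = (\<integral>x. (\<integral>y. f x * g y \<partial>N) \<partial>M)"
    using integral_fst[OF i] by simp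
  then show ?thesis using i by (simp add: has_bochner_integral_iff)
qed

lemma power_DIM_times_powr:
  assumes "r > 0"
  shows "r ^ (DIM('a::euclidean_space) - 1) * r powr a = r powr (a + real DIM('a) - 1)"
proof -
  have "r ^ (DIM('a) - 1) = r powr (real (DIM('a) - 1))" using assms by (simp only: powr_realpow)
  also have "real (DIM('a) - 1) = real DIM('a) - 1" by (simp add: of_nat_diff Suc_leI)
  finally show ?thesis by (simp flip: powr_add) (simp add: algebra_simps)
qed

text \<open>On the product of sphere and half-line the integrand splits into
  \<open>f \<theta>\<close> times a function of \<open>r\<close>. Using
  \<open>polar_coordinates\<close> as an identity of measures gives integrability and value
  together.\<close>

lemma has_bochner_integral_homogeneous_radial:
  fixes f :: "'a::euclidean_space \<Rightarrow> real"
  assumes hom: "\<And>x r. r > 0 \<Longrightarrow> norm x = 1 \<Longrightarrow> f (r *\<^sub>R x) = r powr a * f x"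
    and f: "integrable sphere_measure f"
    and [measurable]: "h \<in> borel_measurable borel"
    and h: "integrable lborel (\<lambda>r. indicator {0<..} r * (r powr (a + real DIM('a) - 1) * h r))"
  shows "has_bochner_integral lborel (\<lambda>x. f x * h (norm x))
    (integral\<^sup>L sphere_measure f * (\<integral>r. indicator {0<..} r * (r powr (a + real DIM('a) - 1) * h r) \<partial>lborel))"
proof -
  let ?n = "DIM('a)"
  let ?c = "integral\<^sup>L sphere_measure f * integral\<^sup>L (radial_measure ?n) (\<lambda>r. r powr a * h r)"
  let ?P = "(sphere_measure :: 'a measure) \<Otimes>\<^sub>M radial_measure ?n"
  have fB: "f \<in> borel_measurable borel"
    using homogeneous_borel_measurable[OF hom] f by auto
  have [measurable]: "f \<in> borel_measurable sphere_measure" using f by auto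
  have sc: "(\<lambda>(\<theta>, r). r *\<^sub>R \<theta>) \<in> ?P \<rightarrow>\<^sub>M borel"
    using measurable_scaleR_sphere by (simp cong: measurable_cong_sets)
  have fh: "(\<lambda>x. f x * h (norm x)) \<in> borel_measurable borel"
    using fB by measurable
  define w where "w = (\<lambda>r::real. indicator {0<..} r * r ^ (?n - 1))"
  have [measurable]: "w \<in> borel_measurable borel" unfolding w_def by measurable
  have w0: "AE r in lborel. 0 \<le> w r" by (auto simp: w_def indicator_def)
  have rm: "radial_measure ?n = density lborel (\<lambda>r. ennreal (w r))"
    by (simp add: radial_measure_def w_def)
  have e: "w r * (r powr a * h r) =
    indicator {0<..} r * (r powr (a + real ?n - 1) * h r)" for r :: real
  proof (cases "r > 0")
    case True
    show ?thesis using True power_DIM_times_powr[OF True, of a, where 'a='a]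
      by (simp add: w_def mult.assoc[symmetric])
  qed (simp add: w_def)
  have ih: "integrable (radial_measure ?n) (\<lambda>r. r powr a * h r)"
    unfolding rm using h w0 by (subst integrable_density) (auto simp: e)
  have ihe: "integral\<^sup>L (radial_measure ?n) (\<lambda>r. r powr a * h r) =
     (\<integral>r. indicator {0<..} r * (r powr (a + real ?n - 1) * h r) \<partial>lborel)"
    unfolding rm using w0 by (subst integral_density) (auto simp: e)
  have "has_bochner_integral ?P (\<lambda>(\<theta>, r). f \<theta> * (r powr a * h r)) ?c"
    by (intro has_bochner_integral_pair_times f ih sigma_finite_radial_measure sphere.sigma_finite_measure_axioms)
  also have "?this \<longleftrightarrow> has_bochner_integral ?P (\<lambda>z. (\<lambda>x. f x * h (norm x)) ((\<lambda>(\<theta>, r). r *\<^sub>R \<theta>) z)) ?c"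
  proof (rule has_bochner_integral_cong_AE)
    \<comment> \<open>Homogeneity is available for positive \<open>r\<close> only; the rest is null
      for the radial measure.\<close>
    have pos: "AE r in radial_measure ?n. r > 0"
      unfolding rm by (subst AE_density) (auto simp: w_def indicator_def)
    have "AE z in ?P. snd z > 0"
    proof (rule pair_sigma_finite.AE_pair_measure)
      show "{z \<in> space (?P). 0 < snd z}
          \<in> sets ?P"
        by measurable
      show "pair_sigma_finite (sphere_measure :: 'a measure) (radial_measure ?n)"
        by (simp add: pair_sigma_finite_def sigma_finite_radial_measure sphere.sigma_finite_measure_axioms)
    qed (use pos in auto)
    then show "AE z in ?P. (case z of (\<theta>, r) \<Rightarrow> f \<theta> * (r powr a * h r)) =
      f (case z of (\<theta>, r) \<Rightarrow> r *\<^sub>R \<theta>) * h (norm (case z of (\<theta>, r) \<Rightarrow> r *\<^sub>R (\<theta>::'a)))"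
      using AE_space
    proof eventually_elim
      case (elim z)
      obtain x r where z: "z = (x, r)" by (cases z)
      show ?case using elim hom[of r x] by (simp add: z space_pair_measure)
    qed
    show "(\<lambda>(\<theta>, r). f \<theta> * (r powr a * h r)) \<in> borel_measurable ?P"
      by measurable
    show "(\<lambda>z. f (case z of (\<theta>, r) \<Rightarrow> r *\<^sub>R \<theta>) * h (norm (case z of (\<theta>, r) \<Rightarrow> r *\<^sub>R \<theta>))) \<in> borel_measurable ?P"
      by (rule measurable_compose[OF sc fh])
  qed
  also have "\<dots> \<longleftrightarrow> has_bochner_integral (distr ?P borel (\<lambda>(\<theta>, r). r *\<^sub>R \<theta>)) (\<lambda>x. f x * h (norm x)) ?c"
    using sc fh by (simp add: has_bochner_integral_iff integrable_distr_eq integral_distr)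
  finally show ?thesis unfolding ihe polar_coordinates[symmetric] .
qed

section \<open>Gaussian integrals on the sphere\<close>

text \<open>The substitution \<open>r = sqrt (t / c)\<close> reduces this to the integral of
  \<open>Gamma (a / 2)\<close>; the power of \<open>c\<close> comes out by scaling.\<close>

lemma nn_integral_gaussian_radial:
  fixes a c :: real
  assumes a: "a > 0" and c: "c > 0"
  shows "(\<integral>\<^sup>+r. ennreal (indicator {0<..} r * (r powr (a - 1) * exp (- (c * r\<^sup>2)))) \<partial>lborel) =
    ennreal (Gamma (a / 2) / 2 * c powr (- a / 2))"
proof -
  define F where "F = (\<lambda>t::real. indicator {0<..} t * (t powr (a / 2 - 1) * exp (- t)))"
  have FG: "ennreal (Gamma (a / 2)) = (\<integral>\<^sup>+t. ennreal (F t) \<partial>lborel)"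
  proof -
    have "(\<integral>\<^sup>+t. ennreal (F t) \<partial>lborel) = (\<integral>\<^sup>+t. ennreal (indicator {0..} t * t powr (a / 2 - 1) / exp t) \<partial>lborel)"
    proof (rule nn_integral_cong_AE)
      show "AE t in lborel. ennreal (F t) = ennreal (indicator {0..} t * t powr (a / 2 - 1) / exp t)"
        using AE_lborel_singleton[of "0::real"]
        by eventually_elim (auto simp: F_def indicator_def exp_minus field_simps)
    qed
    then show ?thesis using Gamma_conv_nn_integral_real[of "a / 2"] a by simp
  qed
  have F0: "F t \<ge> 0" for t by (simp add: F_def)
  have [measurable]: "F \<in> borel_measurable borel" unfolding F_def by measurable
  have G0: "Gamma (a / 2) > 0" using a by (intro Gamma_real_pos) auto
  have hF: "has_bochner_integral lborel F (Gamma (a / 2))"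
    by (rule has_bochner_integral_nn_integral) (use F0 G0 FG in auto)
  define f where "f = (\<lambda>r::real. r powr (a - 1) * exp (- (c * r\<^sup>2)))"
  define g where "g = (\<lambda>t::real. sqrt (t / c))"
  define g' where "g' = (\<lambda>t::real. inverse (sqrt (t / c)) / 2 / c)"
  have e: "f (g t) * g' t = c powr (- a / 2) / 2 * F t" if "t > 0" for t
  proof -
    have p: "t / c > 0" using that c by simp
    have "g t powr (a - 1) = (t / c) powr ((a - 1) / 2)"
      using p by (simp add: g_def powr_half_sqrt[symmetric] powr_powr)
    moreover have "inverse (sqrt (t / c)) = (t / c) powr (- 1 / 2)"
      using p powr_minus[of "t / c" "1/2"] by (simp add: powr_half_sqrt)
    moreover have "c * (g t)\<^sup>2 = t" using p c by (simp add: g_def)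
    moreover have "(t / c) powr ((a - 1) / 2) * (t / c) powr (- 1 / 2) = (t / c) powr (a / 2 - 1)"
    proof -
      have "(a - 1) / 2 + - 1 / 2 = a / 2 - 1" by (simp add: field_simps)
      then show ?thesis by (metis powr_add)
    qed
    moreover have "(t / c) powr (a / 2 - 1) / c = c powr (- a / 2) * t powr (a / 2 - 1)"
      using that c powr_mult_base[of c "(a - 2) / 2"]
      by (simp add: powr_divide powr_diff powr_minus field_simps)
    ultimately show ?thesis using that by (simp add: f_def F_def g'_def) (metis (no_types, lifting) mult.commute mult.left_commute times_divide_eq_right)
  qed
  have ei: "einterval 0 \<infinity> = {0<..}" by (auto simp: einterval_def)
  have e': "(\<lambda>t. indicator {0<..} t * (f (g t) * g' t)) = (\<lambda>t. c powr (- a / 2) / 2 * F t)"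
  proof
    fix t
    show "indicator {0<..} t * (f (g t) * g' t) = c powr (- a / 2) / 2 * F t"
      by (cases "t > 0") (simp_all only: e, auto simp: F_def)
  qed
  have int: "set_integrable lborel (einterval 0 \<infinity>) (\<lambda>t. f (g t) * g' t)"
  proof -
    have "integrable lborel (\<lambda>t. c powr (- a / 2) / 2 * F t)"
      using hF by (auto simp: has_bochner_integral_iff)
    then show ?thesis by (simp add: set_integrable_def ei e')
  qed
  have sub: "set_integrable lborel (einterval 0 \<infinity>) f"
    "(LBINT r=0..\<infinity>. f r) = (LBINT t=0..\<infinity>. f (g t) * g' t)"
  proof -
    have A: "((ereal \<circ> g \<circ> real_of_ereal) \<longlongrightarrow> 0) (at_right 0)"
    proof -
      have "((\<lambda>t. sqrt (t / c)) \<longlongrightarrow> sqrt (0 / c)) (at_right 0)"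
        using c by (intro tendsto_intros) auto
      then have "(g \<longlongrightarrow> 0) (at_right 0)" by (simp add: g_def)
      then show ?thesis
        by (simp only: zero_ereal_def ereal_tendsto_simps1(2) ereal_tendsto_simps2(1))
    qed
    have B: "((ereal \<circ> g \<circ> real_of_ereal) \<longlongrightarrow> \<infinity>) (at_left \<infinity>)"
    proof -
      have "filterlim g at_top at_top"
        unfolding g_def using c
        by (auto simp: divide_inverse intro!: filterlim_compose[OF sqrt_at_top]
            filterlim_at_top_mult_tendsto_pos[OF tendsto_const _ filterlim_ident])
      then show ?thesis by (simp only: ereal_tendsto_simps1(3) ereal_tendsto_simps2(2))
    qed
    have d: "DERIV g t :> g' t" if "t > 0" for t
      unfolding g_def g'_def using that c by (auto intro!: derivative_eq_intros simp: field_simps)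
    have cf: "isCont f (g t)" if "t > 0" for t
      unfolding f_def using that c by (intro continuous_intros) (auto simp: g_def)
    have cg: "isCont g' t" if "t > 0" for t
      unfolding g'_def using that c by (intro continuous_intros) auto
    have pos: "0 \<le> f (g t)" "0 \<le> g' t" if "0 \<le> t" for t
      using that c by (auto simp: f_def g'_def)
    note S = interval_integral_substitution_nonneg[where a=0 and b="\<infinity>" and f=f and g=g and g'=g' and A=0 and B="\<infinity>", OF _ _ _ _ _ _ A B int]
    show "set_integrable lborel (einterval 0 \<infinity>) f"
      by (rule S(1)) (use d cf cg pos in simp_all)
    show "(LBINT r=0..\<infinity>. f r) = (LBINT t=0..\<infinity>. f (g t) * g' t)"
      by (rule S(2)) (use d cf cg pos in simp_all)
  qed
  have "(LBINT t=0..\<infinity>. f (g t) * g' t) = (\<integral>t. c powr (- a / 2) / 2 * F t \<partial>lborel)"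
    by (simp add: interval_lebesgue_integral_def set_lebesgue_integral_def ei e')
  also have "\<dots> = Gamma (a / 2) / 2 * c powr (- a / 2)"
    using hF by (simp add: has_bochner_integral_iff)
  finally have v: "(\<integral>r. indicator {0<..} r * f r \<partial>lborel) = Gamma (a / 2) / 2 * c powr (- a / 2)"
    using sub(2) by (simp add: interval_lebesgue_integral_def set_lebesgue_integral_def ei)
  have i: "integrable lborel (\<lambda>r. indicator {0<..} r * f r)"
    using sub(1) by (simp add: set_integrable_def ei)
  have "(\<integral>\<^sup>+r. ennreal (indicator {0<..} r * f r) \<partial>lborel) = ennreal (\<integral>r. indicator {0<..} r * f r \<partial>lborel)"
    by (rule nn_integral_eq_integral[OF i]) (auto simp: f_def)
  then show ?thesis unfolding v by (simp add: f_def)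
qed

lemma nn_integral_abs_moment:
  assumes q: "q > -1"
  shows "(\<integral>\<^sup>+t. ennreal (\<bar>t\<bar> powr q * exp (- t\<^sup>2)) \<partial>lborel) = ennreal (Gamma ((q + 1) / 2))"
proof -
  define f where "f = (\<lambda>t::real. ennreal (indicator {0<..} t * (t powr q * exp (- t\<^sup>2))))"
  have [measurable]: "f \<in> borel_measurable borel" unfolding f_def by measurable
  have h: "(\<integral>\<^sup>+t. f t \<partial>lborel) = ennreal (Gamma ((q + 1) / 2) / 2)"
    using nn_integral_gaussian_radial[of "q + 1" 1] q by (simp add: f_def)
  have h2: "(\<integral>\<^sup>+t. f (- t) \<partial>lborel) = (\<integral>\<^sup>+t. f t \<partial>lborel)"
    by (subst (2) nn_integral_real_affine[where c="-1" and t=0]) auto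
  have "(\<integral>\<^sup>+t. ennreal (\<bar>t\<bar> powr q * exp (- t\<^sup>2)) \<partial>lborel) = (\<integral>\<^sup>+t. f t + f (- t) \<partial>lborel)"
  proof (rule nn_integral_cong_AE)
    show "AE t in lborel. ennreal (\<bar>t\<bar> powr q * exp (- t\<^sup>2)) = f t + f (- t)"
      using AE_lborel_singleton[of "0::real"]
      by eventually_elim (auto simp: f_def indicator_def)
  qed
  also have "\<dots> = (\<integral>\<^sup>+t. f t \<partial>lborel) + (\<integral>\<^sup>+t. f (- t) \<partial>lborel)"
    by (intro nn_integral_add) measurable
  also have "\<dots> = ennreal (Gamma ((q + 1) / 2))"
    using q by (simp add: h h2 ennreal_plus[symmetric] Gamma_real_nonneg del: ennreal_plus)
  finally show ?thesis .
qed

lemma power2_norm_eq_sum_Basis: "(norm (x :: 'a::euclidean_space))\<^sup>2 = (\<Sum>j\<in>Basis. (x \<bullet> j)\<^sup>2)"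
  unfolding power2_norm_eq_inner by (subst euclidean_inner) (simp only: power2_eq_square)

lemma ennreal_mult_left_cancel_pos:
  assumes "c > 0" "ennreal c * x = ennreal c * y"
  shows "x = y"
proof -
  have c: "ennreal c \<noteq> 0" "ennreal c \<noteq> top" using assms(1) by (auto simp: ennreal_eq_0_iff)
  have "x = x * ennreal c / ennreal c" by (rule ennreal_mult_divide_eq[OF c, symmetric])
  also have "x * ennreal c = y * ennreal c" using assms(2) by (subst (1 2) mult.commute)
  also have "\<dots> / ennreal c = y" by (rule ennreal_mult_divide_eq[OF c])
  finally show ?thesis .
qed

text \<open>Along a ray the integrand is a power of the radius times a Gaussian, so the radial
  integral is \<open>nn_integral_gaussian_radial\<close> with \<open>c = Q x\<close>. This is the
  bridge from Gaussian integrals to the sphere: for \<open>Q x = (norm x)\<^sup>2\<close> the factor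
  in \<open>Q\<close> disappears, for a perturbed quadratic form it becomes the weight of a
  generating function.\<close>

lemma nn_integral_homogeneous_gaussian:
  fixes F Q :: "'a::euclidean_space \<Rightarrow> real"
  assumes a: "a + real DIM('a) > 0"
    and [measurable]: "F \<in> borel_measurable borel" "Q \<in> borel_measurable borel"
    and F0: "\<And>x. F x \<ge> 0" and Q0: "\<And>x. norm x = 1 \<Longrightarrow> Q x > 0"
    and F: "\<And>x r. r > 0 \<Longrightarrow> norm x = 1 \<Longrightarrow> F (r *\<^sub>R x) = r powr a * F x"
    and Q: "\<And>x r. r > 0 \<Longrightarrow> norm x = 1 \<Longrightarrow> Q (r *\<^sub>R x) = Q x * r\<^sup>2"
  shows "(\<integral>\<^sup>+x. ennreal (F x * exp (- Q x)) \<partial>lborel) =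
    ennreal (Gamma ((real DIM('a) + a) / 2) / 2) *
      (\<integral>\<^sup>+x. ennreal (F x * Q x powr (- (real DIM('a) + a) / 2)) \<partial>sphere_measure)"
proof -
  let ?n = "DIM('a)"
  let ?I = "\<lambda>x. \<integral>\<^sup>+r. ennreal (F (r *\<^sub>R x) * exp (- Q (r *\<^sub>R x))) \<partial>radial_measure ?n"
  let ?G = "Gamma ((real ?n + a) / 2) / 2"
  have "(\<integral>\<^sup>+x. ennreal (F x * exp (- Q x)) \<partial>lborel) =
     (\<integral>\<^sup>+x. ?I x \<partial>sphere_measure)"
    by (rule nn_integral_polar) measurable
  also have "\<dots> = (\<integral>\<^sup>+x. ennreal (?G) *
      ennreal (F x * Q x powr (- (real ?n + a) / 2)) \<partial>sphere_measure)"
  proof (rule nn_integral_cong)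
    fix x :: 'a assume "x \<in> space sphere_measure"
    then have x: "norm x = 1" by simp
    have "?I x =
       (\<integral>\<^sup>+r. ennreal (indicator {0<..} r * r ^ (?n - 1)) * ennreal (F (r *\<^sub>R x) * exp (- Q (r *\<^sub>R x))) \<partial>lborel)"
      by (rule nn_integral_radial_measure) measurable
    also have "\<dots> = (\<integral>\<^sup>+r. ennreal (F x) * ennreal (indicator {0<..} r * (r powr ((real ?n + a) - 1) * exp (- (Q x * r\<^sup>2)))) \<partial>lborel)"
    proof (rule nn_integral_cong)
      fix r :: real
      show "ennreal (indicator {0<..} r * r ^ (?n - 1)) * ennreal (F (r *\<^sub>R x) * exp (- Q (r *\<^sub>R x))) =
        ennreal (F x) * ennreal (indicator {0<..} r * (r powr ((real ?n + a) - 1) * exp (- (Q x * r\<^sup>2))))"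
      proof (cases "r > 0")
        case True
        have "r ^ (?n - 1) * r powr a = r powr ((real ?n + a) - 1)"
          using power_DIM_times_powr[OF True, of a, where 'a='a] by (simp add: add.commute)
        then have "r ^ (?n - 1) * (F (r *\<^sub>R x) * exp (- Q (r *\<^sub>R x))) =
            F x * (r powr ((real ?n + a) - 1) * exp (- (Q x * r\<^sup>2)))"
          by (simp add: F[OF True x] Q[OF True x] flip: mult.assoc)
        then show ?thesis using True F0 by (simp flip: ennreal_mult')
      qed simp
    qed
    also have "\<dots> = ennreal (F x) * ennreal (?G * Q x powr (- (real ?n + a) / 2))"
      using nn_integral_gaussian_radial[of "real ?n + a" "Q x"] a Q0[OF x]
      by (subst nn_integral_cmult) (auto simp: add.commute)
    also have "\<dots> = ennreal (?G) * ennreal (F x * Q x powr (- (real ?n + a) / 2))"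
    proof -
      have "Gamma ((real ?n + a) / 2) \<ge> 0" using a by (intro Gamma_real_nonneg) auto
      then show ?thesis using F0[of x] by (simp add: mult_ac flip: ennreal_mult)
    qed
    finally show "?I x = \<dots>" .
  qed
  also have "\<dots> = ennreal (?G) *
      (\<integral>\<^sup>+x. ennreal (F x * Q x powr (- (real ?n + a) / 2)) \<partial>sphere_measure)"
    by (rule nn_integral_cmult) (intro borel_measurable_sphere_measureI, measurable)
  finally show ?thesis .
qed

text \<open>The closed form of \<open>W_const\<close>, which needs no choice of direction;
  \<open>nn_integral_sphere_abs_inner_powr\<close> identifies it with the integral.\<close>

definition sphere_moment :: "nat \<Rightarrow> real \<Rightarrow> real"
  where "sphere_moment n q = 2 * Gamma ((q + 1) / 2) * pi powr ((real n - 1) / 2) / Gamma ((real n + q) / 2)"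

lemma sphere_moment_pos: "q > -1 \<Longrightarrow> n \<ge> 1 \<Longrightarrow> sphere_moment n q > 0"
  unfolding sphere_moment_def by (intro divide_pos_pos mult_pos_pos Gamma_real_pos) auto

text \<open>A rotation moves \<open>\<xi>\<close> to a coordinate direction \<open>b\<close>. The
  Gaussian integral of \<open>\<bar>x \<bullet> b\<bar> powr q\<close> is then computed twice: in
  polar coordinates (\<open>A\<close>) it contains the wanted integral, in Cartesian coordinates
  (\<open>B\<close>) it factors into one-dimensional ones.\<close>

lemma nn_integral_sphere_abs_inner_powr:
  fixes \<xi> :: "real ^ 'n"
  assumes q: "q > -1" and \<xi>: "norm \<xi> = 1"
  shows "(\<integral>\<^sup>+x. ennreal (\<bar>x \<bullet> \<xi>\<bar> powr q) \<partial>sphere_measure) = ennreal (sphere_moment CARD('n) q)"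
proof -
  let ?S = "sphere_measure :: (real ^ 'n) measure"
  let ?n = "DIM(real ^ 'n)"
  let ?g = "Gamma ((q + 1) / 2)"
  let ?G = "Gamma ((real ?n + q) / 2) / 2"
  obtain b :: "real ^ 'n" where b: "b \<in> Basis" using nonempty_Basis by blast
  obtain T where T: "orthogonal_transformation T" "T \<xi> = b"
    using orthogonal_transformation_exists_1[of \<xi> b] \<xi> b by auto
  let ?J = "\<integral>\<^sup>+x. ennreal (\<bar>x \<bullet> b\<bar> powr q * exp (- ((norm x)\<^sup>2))) \<partial>lborel"
  let ?I = "\<integral>\<^sup>+x. ennreal (\<bar>x \<bullet> b\<bar> powr q) \<partial>?S"
  have n1: "real ?n \<ge> 1" using DIM_positive[where 'a="real ^ 'n"] by linarith
  have n2: "real ?n + q > 0" "q + real ?n > 0" "real CARD('n) + q > 0" "q + real CARD('n) > 0"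
    using n1 q unfolding DIM_cart DIM_real by linarith+
  have "(\<integral>\<^sup>+x. ennreal (\<bar>x \<bullet> \<xi>\<bar> powr q) \<partial>?S) = (\<integral>\<^sup>+x. ennreal (\<bar>T x \<bullet> b\<bar> powr q) \<partial>?S)"
    using T by (simp add: orthogonal_transformation_def flip: T(2))
  also have "\<dots> = (?I)"
    by (rule nn_integral_sphere_orthogonal[OF T(1), of "\<lambda>x. ennreal (\<bar>x \<bullet> b\<bar> powr q)"]) measurable
  finally have rot: "(\<integral>\<^sup>+x. ennreal (\<bar>x \<bullet> \<xi>\<bar> powr q) \<partial>?S) = (?I)" .
  have "(?J) =
    ennreal (?G) *
      (\<integral>\<^sup>+x. ennreal (\<bar>x \<bullet> b\<bar> powr q * ((norm x)\<^sup>2) powr (- (real ?n + q) / 2)) \<partial>?S)"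
    using n2 by (intro nn_integral_homogeneous_gaussian)
      (auto simp: abs_mult powr_mult power_mult_distrib)
  also have "(\<integral>\<^sup>+x. ennreal (\<bar>x \<bullet> b\<bar> powr q * ((norm x)\<^sup>2) powr (- (real ?n + q) / 2)) \<partial>?S) =
      (?I)"
    by (rule nn_integral_cong) simp
  finally have A: "(?J) =
     ennreal (?G) * (?I)" .
  define f where "f = (\<lambda>(j :: real ^ 'n) t::real. (if j = b then \<bar>t\<bar> powr q else 1) * exp (- t\<^sup>2))"
  have "(?J) =
     (\<integral>\<^sup>+x. (\<Prod>j\<in>Basis. ennreal (f j (x \<bullet> j))) \<partial>lborel)"
  proof (rule nn_integral_cong)
    fix x :: "real ^ 'n"
    have "(\<Prod>j\<in>Basis. ennreal (f j (x \<bullet> j))) = ennreal (\<Prod>j\<in>Basis. f j (x \<bullet> j))"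
      by (rule prod_ennreal) (auto simp: f_def)
    also have "(\<Prod>j\<in>Basis. f j (x \<bullet> j)) = (\<Prod>j\<in>Basis. if j = b then \<bar>x \<bullet> j\<bar> powr q else 1) * (\<Prod>j\<in>Basis. exp (- (x \<bullet> j)\<^sup>2))"
      by (simp add: f_def prod.distrib)
    also have "(\<Prod>j\<in>Basis. if j = b then \<bar>x \<bullet> j\<bar> powr q else 1) = \<bar>x \<bullet> b\<bar> powr q"
      using b by (simp add: prod.delta)
    also have "(\<Prod>j\<in>Basis. exp (- (x \<bullet> j)\<^sup>2)) = exp (- ((norm x)\<^sup>2))"
      by (simp add: power2_norm_eq_sum_Basis exp_sum[symmetric] sum_negf)
    finally show "ennreal (\<bar>x \<bullet> b\<bar> powr q * exp (- ((norm x)\<^sup>2))) = (\<Prod>j\<in>Basis. ennreal (f j (x \<bullet> j)))" by simp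
  qed
  also have "\<dots> = (\<Prod>j\<in>Basis. (\<integral>\<^sup>+t. ennreal (f j t) \<partial>lborel))"
    by (rule nn_integral_lborel_prod) (auto simp: f_def)
  also have "\<dots> = (\<Prod>j\<in>Basis. ennreal (if j = b then ?g else sqrt pi))"
  proof (rule prod.cong)
    fix j :: "real ^ 'n" assume "j \<in> Basis"
    have "(\<integral>\<^sup>+t. ennreal (exp (- t\<^sup>2)) \<partial>lborel) = (\<integral>\<^sup>+t. ennreal (\<bar>t\<bar> powr 0 * exp (- t\<^sup>2)) \<partial>lborel)"
    proof (rule nn_integral_cong_AE)
      \<comment> \<open>Only almost everywhere: \<open>0 powr 0 = 0\<close>, so the two integrands
        differ at the origin.\<close>
      show "AE t in lborel. ennreal (exp (- t\<^sup>2)) = ennreal (\<bar>t\<bar> powr 0 * exp (- t\<^sup>2))"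
        using AE_lborel_singleton[of "0::real"] by eventually_elim simp
    qed
    then show "(\<integral>\<^sup>+t. ennreal (f j t) \<partial>lborel) = ennreal (if j = b then ?g else sqrt pi)"
      using nn_integral_abs_moment[OF q] nn_integral_abs_moment[of 0]
      by (simp add: f_def Gamma_one_half_real)
  qed simp
  also have "\<dots> = ennreal (\<Prod>j\<in>(Basis :: (real ^ 'n) set). (if j = b then ?g else sqrt pi))"
    using q by (intro prod_ennreal) (auto intro: Gamma_real_nonneg)
  also have "(\<Prod>j\<in>(Basis :: (real ^ 'n) set). (if j = b then ?g else sqrt pi)) =
      ?g * sqrt pi ^ (?n - 1)"
  proof -
    have "(\<Prod>j\<in>(Basis :: (real ^ 'n) set). (if j = b then ?g else sqrt pi)) =
      ?g * (\<Prod>j\<in>Basis - {b}. if j = b then ?g else sqrt pi)"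
      using b by (subst prod.remove[of _ b]) auto
    also have "(\<Prod>j\<in>Basis - {b}. if j = b then ?g else sqrt pi) = (\<Prod>j\<in>Basis - {b}. sqrt pi)"
      by (intro prod.cong) auto
    also have "\<dots> = sqrt pi ^ (?n - 1)" using b by (simp add: card_Diff_singleton)
    finally show ?thesis .
  qed
  also have "sqrt pi ^ (?n - 1) = pi powr ((real ?n - 1) / 2)"
  proof -
    have "sqrt pi ^ (?n - 1) = (pi powr (1 / 2)) powr (real (?n - 1))"
      by (subst powr_realpow) (auto simp: powr_half_sqrt)
    also have "real (?n - 1) = real ?n - 1" using n1 by (simp add: of_nat_diff)
    finally show ?thesis by (simp add: powr_powr)
  qed
  finally have B: "(?J) =
    ennreal (?g * pi powr ((real ?n - 1) / 2))" .
  have G: "?G > 0"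
    using n2 by (intro divide_pos_pos Gamma_real_pos) auto
  have "?G * sphere_moment ?n q = ?g * pi powr ((real ?n - 1) / 2)"
    using G by (simp add: sphere_moment_def)
  then have "ennreal (?G) * (?I) =
     ennreal (?G) * ennreal (sphere_moment ?n q)"
    using A B G by (simp flip: ennreal_mult')
  then have "(?I) = ennreal (sphere_moment ?n q)"
    using G ennreal_mult_left_cancel_pos by blast
  then show ?thesis using rot by simp
qed

text \<open>After rotating \<open>l\<close> to \<open>b\<close> and \<open>\<xi>\<close> to
  \<open>z\<close>, this is up to a Gamma factor the integral of
  \<open>\<bar>x \<bullet> z\<bar> powr q * exp (- Q x)\<close> with
  \<open>Q x = (norm x)\<^sup>2 - s * (x \<bullet> b)\<^sup>2\<close>; the exponent
  \<open>- (n + q) / 2\<close> is the one that polar coordinates produce. Stretching the direction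
  \<open>b\<close> by \<open>1 / sqrt (1 - s)\<close> turns \<open>Q\<close> into
  \<open>(norm x)\<^sup>2\<close>, whence \<open>(1 - s) powr (- 1 / 2)\<close> as Jacobian, and
  turns \<open>z\<close> into a vector \<open>w\<close> whose norm to the power \<open>q\<close> is
  the other factor. Expanded in \<open>s\<close>, the left side lists the even moments of the
  kernel.\<close>

lemma nn_integral_sphere_generating:
  fixes \<xi> l :: "real ^ 'n"
  assumes q: "q > -1" and s: "s < 1" and \<xi>: "norm \<xi> = 1" and l: "norm l = 1"
  shows "(\<integral>\<^sup>+x. ennreal (\<bar>x \<bullet> \<xi>\<bar> powr q * (1 - s * (x \<bullet> l)\<^sup>2) powr (- (real CARD('n) + q) / 2)) \<partial>sphere_measure) =
    ennreal (sphere_moment CARD('n) q * ((1 - s) powr (- 1 / 2) * (1 + s / (1 - s) * (\<xi> \<bullet> l)\<^sup>2) powr (q / 2)))"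
proof -
  let ?S = "sphere_measure :: (real ^ 'n) measure"
  let ?n = "DIM(real ^ 'n)"
  let ?W = "sphere_moment CARD('n) q"
  let ?f = "1 + s / (1 - s) * (\<xi> \<bullet> l)\<^sup>2"
  let ?G = "Gamma ((real ?n + q) / 2) / 2"
  define e where "e = - (real CARD('n) + q) / 2"
  obtain b :: "real ^ 'n" where b: "b \<in> Basis" using nonempty_Basis by blast
  have nb: "norm b = 1" using b by simp
  obtain T where T: "orthogonal_transformation T" "T l = b"
    using orthogonal_transformation_exists_1[of l b] l nb by auto
  have n1: "real ?n \<ge> 1" using DIM_positive[where 'a="real ^ 'n"] by linarith
  have n2: "real ?n + q > 0" "q + real ?n > 0" "real CARD('n) + q > 0" "q + real CARD('n) > 0"
    using n1 q unfolding DIM_cart DIM_real by linarith+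
  define z where "z = T \<xi>"
  let ?I = "\<integral>\<^sup>+x. ennreal (\<bar>x \<bullet> z\<bar> powr q * (1 - s * (x \<bullet> b)\<^sup>2) powr e) \<partial>?S"
  have z: "norm z = 1" "z \<bullet> b = \<xi> \<bullet> l"
    using T \<xi> orthogonal_transformation_norm[OF T(1)]
    by (auto simp: z_def orthogonal_transformation_def simp flip: T(2))
  have "(\<integral>\<^sup>+x. ennreal (\<bar>x \<bullet> \<xi>\<bar> powr q * (1 - s * (x \<bullet> l)\<^sup>2) powr e) \<partial>?S) =
     (\<integral>\<^sup>+x. ennreal (\<bar>T x \<bullet> z\<bar> powr q * (1 - s * (T x \<bullet> b)\<^sup>2) powr e) \<partial>?S)"
    using T by (simp add: orthogonal_transformation_def z_def flip: T(2))
  also have "\<dots> = (?I)"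
    by (rule nn_integral_sphere_orthogonal[OF T(1), of "\<lambda>x. ennreal (\<bar>x \<bullet> z\<bar> powr q * (1 - s * (x \<bullet> b)\<^sup>2) powr e)"]) measurable
  finally have rot: "(\<integral>\<^sup>+x. ennreal (\<bar>x \<bullet> \<xi>\<bar> powr q * (1 - s * (x \<bullet> l)\<^sup>2) powr e) \<partial>?S) =
    (?I)" .
  define Q where "Q = (\<lambda>x :: real ^ 'n. (norm x)\<^sup>2 - s * (x \<bullet> b)\<^sup>2)"
  have Qpos: "Q x > 0" if "norm x = 1" for x
  proof -
    have "\<bar>x \<bullet> b\<bar> \<le> 1" using Cauchy_Schwarz_ineq2[of x b] that nb by simp
    then have "(x \<bullet> b)\<^sup>2 \<le> 1" by (simp add: abs_square_le_1)
    then have "s * (x \<bullet> b)\<^sup>2 < 1"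
      using s by (cases "s \<le> 0") (auto intro: le_less_trans[OF mult_nonpos_nonneg] le_less_trans[OF mult_left_le])
    then show ?thesis using that by (simp add: Q_def)
  qed
  have [measurable]: "Q \<in> borel_measurable borel" unfolding Q_def by measurable
  have "(\<integral>\<^sup>+x. ennreal (\<bar>x \<bullet> z\<bar> powr q * exp (- Q x)) \<partial>lborel) =
    ennreal (?G) *
      (\<integral>\<^sup>+x. ennreal (\<bar>x \<bullet> z\<bar> powr q * Q x powr (- (real ?n + q) / 2)) \<partial>?S)"
    using n2 Qpos by (intro nn_integral_homogeneous_gaussian)
      (auto simp: abs_mult powr_mult power_mult_distrib Q_def algebra_simps)
  also have "(\<integral>\<^sup>+x. ennreal (\<bar>x \<bullet> z\<bar> powr q * Q x powr (- (real ?n + q) / 2)) \<partial>?S) =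
      (?I)"
    by (rule nn_integral_cong) (simp add: Q_def e_def)
  finally have A: "(\<integral>\<^sup>+x. ennreal (\<bar>x \<bullet> z\<bar> powr q * exp (- Q x)) \<partial>lborel) =
    ennreal (?G) *
      (?I)" .
  define c where "c = (\<lambda>j :: real ^ 'n. if j = b then 1 / sqrt (1 - s) else 1)"
  define D where "D = (\<lambda>x :: real ^ 'n. 0 + (\<Sum>j\<in>Basis. (c j * (x \<bullet> j)) *\<^sub>R j))"
  have c0: "c j \<noteq> 0" for j using s by (simp add: c_def)
  have cprod: "(\<Prod>j\<in>Basis. \<bar>c j\<bar>) = (1 - s) powr (- 1 / 2)"
  proof -
    have "(\<Prod>j\<in>Basis. \<bar>c j\<bar>) = (\<Prod>j\<in>Basis. if j = b then 1 / sqrt (1 - s) else 1)"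
      using s by (intro prod.cong) (auto simp: c_def)
    also have "\<dots> = 1 / sqrt (1 - s)" using b by (simp add: prod.delta)
    also have "\<dots> = (1 - s) powr (- 1 / 2)"
      using s powr_minus[of "1 - s" "1 / 2"] by (simp add: powr_half_sqrt inverse_eq_divide)
    finally show ?thesis .
  qed
  have Dj: "D x \<bullet> j = c j * (x \<bullet> j)" if "j \<in> Basis" for x j
    using that by (simp add: D_def inner_sum_left_Basis)
  have nD: "(norm (D x))\<^sup>2 = (norm x)\<^sup>2 + s / (1 - s) * (x \<bullet> b)\<^sup>2" for x
  proof -
    have "(norm (D x))\<^sup>2 = (\<Sum>j\<in>Basis. (c j)\<^sup>2 * (x \<bullet> j)\<^sup>2)"
      by (simp add: power2_norm_eq_sum_Basis Dj power_mult_distrib)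
    also have "\<dots> = (\<Sum>j\<in>Basis. (x \<bullet> j)\<^sup>2 + (if j = b then s / (1 - s) * (x \<bullet> b)\<^sup>2 else 0))"
      using s by (intro sum.cong) (auto simp: c_def power_divide field_simps)
    also have "\<dots> = (norm x)\<^sup>2 + s / (1 - s) * (x \<bullet> b)\<^sup>2"
      using b by (simp add: sum.distrib power2_norm_eq_sum_Basis)
    finally show ?thesis .
  qed
  have [measurable]: "D \<in> borel \<rightarrow>\<^sub>M borel" unfolding D_def by measurable
  define w where "w = D z"
  have QD: "Q (D x) = (norm x)\<^sup>2" for x
    using s b by (simp add: Q_def nD Dj c_def power_divide power_mult_distrib)
  \<comment> \<open>The stretch is diagonal, hence self-adjoint, and can be moved to
    \<open>z\<close>.\<close>
  have Dz: "D x \<bullet> z = x \<bullet> w" for x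
  proof -
    have "D x \<bullet> z = (\<Sum>j\<in>Basis. (D x \<bullet> j) * (z \<bullet> j))" by (rule euclidean_inner)
    also have "\<dots> = (\<Sum>j\<in>Basis. (x \<bullet> j) * (w \<bullet> j))"
      by (intro sum.cong) (auto simp: Dj w_def)
    also have "\<dots> = x \<bullet> w" by (rule euclidean_inner[symmetric])
    finally show ?thesis .
  qed
  have w2: "(norm w)\<^sup>2 = ?f"
    by (simp add: w_def nD z)
  have wn0: "w \<noteq> 0"
  proof
    assume "w = 0"
    then have "D z \<bullet> j = 0" if "j \<in> Basis" for j by (simp add: w_def)
    then have "z \<bullet> j = 0" if "j \<in> Basis" for j using that c0[of j] Dj[of j z] by auto
    then have "z = 0" by (intro euclidean_eqI[of z 0]) auto
    then show False using z by simp
  qed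
  define w0 where "w0 = w /\<^sub>R norm w"
  have w0: "norm w0 = 1" using wn0 by (simp add: w0_def)
  have xw: "x \<bullet> w = norm w * (x \<bullet> w0)" for x using wn0 by (simp add: w0_def)
  have "(\<integral>\<^sup>+x. ennreal (\<bar>x \<bullet> z\<bar> powr q * exp (- Q x)) \<partial>lborel) =
    (\<integral>\<^sup>+x. ennreal (\<bar>x \<bullet> z\<bar> powr q * exp (- Q x)) \<partial>density (distr lborel borel D) (\<lambda>_. (\<Prod>j\<in>Basis. \<bar>c j\<bar>)))"
    unfolding D_def by (subst lborel_affine_euclidean[of c 0]) (simp_all add: c0)
  also have "\<dots> = ennreal ((1 - s) powr (- 1 / 2)) * (\<integral>\<^sup>+x. ennreal (\<bar>D x \<bullet> z\<bar> powr q * exp (- Q (D x))) \<partial>lborel)"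
    by (simp add: nn_integral_density nn_integral_distr nn_integral_cmult cprod)
  also have "(\<integral>\<^sup>+x. ennreal (\<bar>D x \<bullet> z\<bar> powr q * exp (- Q (D x))) \<partial>lborel) =
      (\<integral>\<^sup>+x. ennreal (norm w powr q) * ennreal (\<bar>x \<bullet> w0\<bar> powr q * exp (- (norm x)\<^sup>2)) \<partial>lborel)"
    by (simp add: Dz QD xw abs_mult powr_mult mult.assoc flip: ennreal_mult')
  also have "\<dots> = ennreal (norm w powr q) * (\<integral>\<^sup>+x. ennreal (\<bar>x \<bullet> w0\<bar> powr q * exp (- (norm x)\<^sup>2)) \<partial>lborel)"
    by (rule nn_integral_cmult) measurable
  also have "(\<integral>\<^sup>+x. ennreal (\<bar>x \<bullet> w0\<bar> powr q * exp (- (norm x)\<^sup>2)) \<partial>lborel) =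
    ennreal (?G) *
      (\<integral>\<^sup>+x. ennreal (\<bar>x \<bullet> w0\<bar> powr q * ((norm x)\<^sup>2) powr (- (real ?n + q) / 2)) \<partial>?S)"
    using n2 by (intro nn_integral_homogeneous_gaussian)
      (auto simp: abs_mult powr_mult power_mult_distrib)
  also have "(\<integral>\<^sup>+x. ennreal (\<bar>x \<bullet> w0\<bar> powr q * ((norm x)\<^sup>2) powr (- (real ?n + q) / 2)) \<partial>?S) =
      (\<integral>\<^sup>+x. ennreal (\<bar>x \<bullet> w0\<bar> powr q) \<partial>?S)"
    by (rule nn_integral_cong) simp
  also have "\<dots> = ennreal (?W)"
    by (rule nn_integral_sphere_abs_inner_powr[OF q w0])
  also have "norm w powr q = (?f) powr (q / 2)"
  proof -
    have "norm w = ((norm w)\<^sup>2) powr (1 / 2)" using wn0 by (simp add: powr_half_sqrt)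
    then have "norm w powr q = ((norm w)\<^sup>2) powr (1 / 2 * q)" by (metis powr_powr)
    then show ?thesis by (simp add: w2)
  qed
  finally have "ennreal (?G) *
      (?I) =
    ennreal ((1 - s) powr (- 1 / 2)) * (ennreal ((?f) powr (q / 2)) *
     (ennreal (?G) * ennreal (?W)))"
    using A by simp
  also have "\<dots> = ennreal (?G) *
     (ennreal (?W) * (ennreal ((1 - s) powr (- 1 / 2)) * ennreal ((?f) powr (q / 2))))"
    by (simp only: mult_ac)
  also have "ennreal (?W) * (ennreal ((1 - s) powr (- 1 / 2)) * ennreal ((?f) powr (q / 2))) =
    ennreal (?W * ((1 - s) powr (- 1 / 2) * (?f) powr (q / 2)))"
    using sphere_moment_pos[OF q, of "CARD('n)"] by (simp add: ennreal_mult Suc_leI)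
  finally have fin: "ennreal (?G) *
      (?I) =
    ennreal (?G) * ennreal (?W * ((1 - s) powr (- 1 / 2) * (?f) powr (q / 2)))" .
  have G: "?G > 0"
    using n2 by (intro divide_pos_pos Gamma_real_pos) auto
  show ?thesis using ennreal_mult_left_cancel_pos[OF G fin] rot by (simp add: e_def)
qed

section \<open>Moments of the kernels\<close>

notation fps_nth (infixl "$$" 75)

lemma abs_mult_less_one:
  fixes s t :: real
  assumes "\<bar>s\<bar> < 1" "\<bar>t\<bar> \<le> 1"
  shows "\<bar>s * t\<bar> < 1"
proof -
  have "\<bar>s\<bar> * \<bar>t\<bar> \<le> \<bar>s\<bar> * 1" using assms(2) by (intro mult_left_mono) auto
  then show ?thesis using assms(1) by (simp add: abs_mult)
qed

lemma powr_half_shift: "x powr (- (a + 1) / 2) = x powr (- 1 / 2) / x powr (a / 2)" for x a :: real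
proof -
  have "- (a + 1) / 2 = - 1 / 2 - a / 2" by (simp add: field_simps)
  then show ?thesis by (simp only: powr_diff)
qed

section \<open>Power series carrying the moments of the kernels\<close>

lemma powser_coeff_unique:
  fixes a b :: "nat \<Rightarrow> real"
  assumes r: "r > 0"
    and a: "\<And>s. \<bar>s\<bar> < r \<Longrightarrow> (\<lambda>n. a n * s ^ n) sums f s"
    and b: "\<And>s. \<bar>s\<bar> < r \<Longrightarrow> (\<lambda>n. b n * s ^ n) sums f s"
  shows "a n = b n"
proof (induction n rule: less_induct)
  case (less n)
  define d where "d = (\<lambda>j. a j - b j)"
  have d0: "d j = 0" if "j < n" for j using less that by (simp add: d_def)
  \<comment> \<open>By induction the difference starts at degree \<open>n\<close>; after division by
    \<open>s ^ n\<close> its limit at 0 is the coefficient in question.\<close>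
  have z: "(\<lambda>j. d (j + n) * s ^ j) sums 0" if s: "s \<noteq> 0" "norm s < r" for s
  proof -
    have "(\<lambda>j. d j * s ^ j) sums 0"
      using sums_diff[OF a b, of s s] s by (simp add: d_def algebra_simps)
    then have "(\<lambda>j. d (j + n) * s ^ (j + n)) sums (0 - (\<Sum>j<n. d j * s ^ j))"
      by (rule sums_split_initial_segment)
    then have "(\<lambda>j. (d (j + n) * s ^ j) * s ^ n) sums (0 * s ^ n)"
      by (simp add: d0 power_add mult_ac)
    then show ?thesis using s by (subst (asm) sums_mult2_iff) auto
  qed
  have "((\<lambda>_. 0) \<longlongrightarrow> d (0 + n)) (at (0::real))"
    by (rule powser_limit_0_strong[where a="\<lambda>j. d (j + n)", OF r z])
  then show ?case by (simp add: d_def tendsto_const_iff)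
qed

text \<open>The expansion of \<open>(1 - \<tau> * s) powr a\<close> in \<open>s\<close>, kept formal
  so that \<open>a\<close> may be any real number and derivatives need no convergence.\<close>

definition binom_series :: "real \<Rightarrow> real \<Rightarrow> real fps"
  where "binom_series a \<tau> = Abs_fps (\<lambda>n. (a gchoose n) * (- \<tau>) ^ n)"

lemma binom_series_nth [simp]: "binom_series a \<tau> $$ n = (a gchoose n) * (- \<tau>) ^ n"
  by (simp add: binom_series_def)

lemma fps_deriv_binom_series:
  "fps_deriv (binom_series a \<tau>) = - (fps_const (a * \<tau>) * binom_series (a - 1) \<tau>)"
proof (rule fps_ext)
  fix n
  have "real (Suc n) * (a gchoose Suc n) = a * ((a - 1) gchoose n)"
    using gbinomial_absorption[of n a] by simp
  then show "fps_deriv (binom_series a \<tau>) $$ n = (- (fps_const (a * \<tau>) * binom_series (a - 1) \<tau>)) $$ n"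
    by (simp add: algebra_simps del: of_nat_Suc)
qed

lemma binom_series_eq_mult:
  "binom_series a \<tau> = (1 - fps_const \<tau> * fps_X) * binom_series (a - 1) \<tau>"
proof (rule fps_ext)
  fix n
  show "binom_series a \<tau> $$ n = ((1 - fps_const \<tau> * fps_X) * binom_series (a - 1) \<tau>) $$ n"
  proof (cases n)
    case (Suc k)
    have "a gchoose Suc k = ((a - 1) gchoose k) + ((a - 1) gchoose Suc k)"
      using gbinomial_Suc_Suc[of "a - 1" k] by simp
    then show ?thesis by (simp add: Suc left_diff_distrib mult.assoc algebra_simps)
  qed (simp add: left_diff_distrib mult.assoc)
qed

text \<open>For \<open>A > -1\<close> these are, up to normalization, the even moments of
  \<open>\<bar>x \<bullet> \<xi>\<bar> powr A\<close>, see \<open>sphere_even_moment\<close>. For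
  \<open>A \<le> -1\<close> that kernel is not integrable over the sphere and the series takes the
  place of its moments.\<close>

definition moment_series :: "real \<Rightarrow> real \<Rightarrow> real fps"
  where "moment_series A \<tau> = binom_series (- (A + 1) / 2) 1 * binom_series (A / 2) \<tau>"

text \<open>Passing from \<open>A\<close> to \<open>A - 2\<close> multiplies the first factor by
  \<open>1 - s\<close> and divides the second by \<open>1 - \<tau> * s\<close>. The division is
  traded for a derivative: the coefficients are chosen so that the \<open>\<tau>\<close> coming from
  the derivative of \<open>S\<close> cancels the one in \<open>S = (1 - \<tau> * s) * R\<close>.
  Only a relation free of \<open>\<tau>\<close> can match the Laplacian recursion, whose
  coefficients do not depend on \<open>\<xi>\<close> and \<open>l\<close>.\<close>

lemma moment_series_deriv:
  "fps_const A * moment_series (A - 2) \<tau> =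
    (fps_const A + fps_X) * moment_series A \<tau> - 2 * fps_X * (1 - fps_X) * fps_deriv (moment_series A \<tau>)"
proof -
  \<comment> \<open>\<open>P\<close> and \<open>S\<close> are the two factors of the series;
    \<open>P1\<close> and \<open>R\<close> are the same with the exponent lowered by 1.\<close>
  define P where "P = binom_series (- (A + 1) / 2) 1"
  define P1 where "P1 = binom_series (- (A + 1) / 2 - 1) 1"
  define R where "R = binom_series (A / 2 - 1) \<tau>"
  define S where "S = binom_series (A / 2) \<tau>"
  have S: "S = (1 - fps_const \<tau> * fps_X) * R"
    unfolding S_def R_def by (rule binom_series_eq_mult)
  have P: "P = (1 - fps_X) * P1"
    unfolding P_def P1_def by (subst binom_series_eq_mult) simp
  have "binom_series (- (A - 2 + 1) / 2) 1 = (1 - fps_X) * P"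
    unfolding P_def by (subst binom_series_eq_mult) (simp add: field_simps)
  then have M2: "moment_series (A - 2) \<tau> = (1 - fps_X) * P * R"
    by (simp add: moment_series_def R_def diff_divide_distrib)
  have dP: "2 * ((1 - fps_X) * fps_deriv P) = (fps_const A + 1) * P"
  proof -
    have "fps_deriv P = - (fps_const (- (A + 1) / 2) * P1)"
      unfolding P_def P1_def by (subst fps_deriv_binom_series) simp
    also have "- (A + 1) / 2 = - ((A + 1) / 2)" by (rule minus_divide_left[symmetric])
    also have "- (fps_const \<dots> * P1) = fps_const ((A + 1) / 2) * P1"
      by (simp only: fps_const_neg[symmetric] mult_minus_left minus_minus)
    finally have "2 * ((1 - fps_X) * fps_deriv P) = (2 * fps_const ((A + 1) / 2)) * P"
      by (simp add: P mult_ac)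
    also have "2 * fps_const ((A + 1) / 2) = fps_const A + 1"
      by (simp add: numeral_fps_const flip: fps_const_mult fps_const_add fps_const_1_eq_1)
    finally show ?thesis .
  qed
  have dS: "2 * fps_deriv S = - (fps_const A * fps_const \<tau> * R)"
  proof -
    have "fps_deriv S = - (fps_const (A / 2 * \<tau>) * R)"
      unfolding S_def R_def by (rule fps_deriv_binom_series)
    then have "2 * fps_deriv S = - ((2 * fps_const (A / 2 * \<tau>)) * R)" by (simp add: mult.assoc)
    also have "2 * fps_const (A / 2 * \<tau>) = fps_const A * fps_const \<tau>"
      by (simp add: numeral_fps_const)
    finally show ?thesis .
  qed
  have "2 * fps_X * (1 - fps_X) * fps_deriv (P * S) =
     fps_X * (2 * ((1 - fps_X) * fps_deriv P)) * S + fps_X * (1 - fps_X) * P * (2 * fps_deriv S)"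
    by (simp add: algebra_simps)
  also have "\<dots> = fps_X * ((fps_const A + 1) * P) * S - fps_X * (1 - fps_X) * P * (fps_const A * fps_const \<tau> * R)"
    unfolding dP dS by simp
  finally have "(fps_const A + fps_X) * (P * S) - 2 * fps_X * (1 - fps_X) * fps_deriv (P * S) =
     fps_const A * ((1 - fps_X) * P * R)"
    by (simp add: S algebra_simps)
  moreover have "moment_series A \<tau> = P * S" unfolding moment_series_def P_def S_def ..
  ultimately show ?thesis unfolding M2 by simp
qed

text \<open>Coefficients are compared in the differential equation. Up to the normalizing factors
  put back in \<open>laplacian_step_moment_series\<close>, this is the recursion
  \<open>laplacian_step\<close>.\<close>

lemma moment_series_rec:
  "A * moment_series (A - 2) \<tau> $$ j =
    (A - 2 * real j) * moment_series A \<tau> $$ j + (if j = 0 then 0 else (2 * real j - 1) * moment_series A \<tau> $$ (j - 1))"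
proof -
  let ?G = "moment_series A \<tau>"
  have "A * moment_series (A - 2) \<tau> $$ j = (fps_const A * moment_series (A - 2) \<tau>) $$ j" by simp
  also have "\<dots> = (fps_const A * ?G + fps_X * ?G - fps_const 2 * (fps_X * fps_deriv ?G) + fps_const 2 * (fps_X * (fps_X * fps_deriv ?G))) $$ j"
    unfolding moment_series_deriv by (simp add: algebra_simps numeral_fps_const)
  also have "\<dots> = (A - 2 * real j) * ?G $$ j + (if j = 0 then 0 else (2 * real j - 1) * ?G $$ (j - 1))"
    by (cases j; cases "j - 1") (auto simp: algebra_simps)
  finally show ?thesis .
qed

lemma summable_norm_gchoose:
  fixes a s :: real
  assumes "\<bar>s\<bar> < 1"
  shows "summable (\<lambda>n. \<bar>a gchoose n\<bar> * \<bar>s\<bar> ^ n)"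
proof -
  have "ereal (norm s) < conv_radius (\<lambda>n. a gchoose n)"
    using assms by (auto simp: conv_radius_gchoose)
  from abs_summable_in_conv_radius[OF this] show ?thesis by (simp add: abs_mult power_abs)
qed

text \<open>A majorant of the coefficients that is uniform in
  \<open>\<bar>\<tau>\<bar> \<le> 1\<close>, hence over the whole sphere, and still summable against
  \<open>\<bar>s\<bar> ^ j\<close> for \<open>\<bar>s\<bar> < 1\<close>, being a Cauchy
  product.\<close>

definition moment_series_bound :: "real \<Rightarrow> nat \<Rightarrow> real"
  where "moment_series_bound A j = (\<Sum>i\<le>j. \<bar>(- (A + 1) / 2) gchoose i\<bar> * \<bar>(A / 2) gchoose (j - i)\<bar>)"

lemma moment_series_nth_bound:
  assumes "\<bar>\<tau>\<bar> \<le> 1"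
  shows "\<bar>moment_series A \<tau> $$ j\<bar> \<le> moment_series_bound A j"
proof -
  have "\<bar>moment_series A \<tau> $$ j\<bar> \<le> (\<Sum>i=0..j. \<bar>binom_series (- (A + 1) / 2) 1 $$ i * binom_series (A / 2) \<tau> $$ (j - i)\<bar>)"
    unfolding moment_series_def fps_mult_nth by (rule sum_abs)
  also have "\<dots> \<le> (\<Sum>i=0..j. \<bar>(- (A + 1) / 2) gchoose i\<bar> * \<bar>(A / 2) gchoose (j - i)\<bar>)"
  proof (rule sum_mono)
    fix i
    have "\<bar>\<tau>\<bar> ^ (j - i) \<le> 1" using assms by (intro power_le_one) auto
    then show "\<bar>binom_series (- (A + 1) / 2) 1 $$ i * binom_series (A / 2) \<tau> $$ (j - i)\<bar>
       \<le> \<bar>(- (A + 1) / 2) gchoose i\<bar> * \<bar>(A / 2) gchoose (j - i)\<bar>"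
      by (simp add: abs_mult power_abs mult_left_mono mult_left_le)
  qed
  finally show ?thesis by (simp add: moment_series_bound_def atMost_atLeast0)
qed

lemma summable_moment_series_bound:
  assumes s: "\<bar>s\<bar> < 1"
  shows "summable (\<lambda>j. moment_series_bound A j * \<bar>s\<bar> ^ j)"
proof -
  let ?t = "\<lambda>i j. (\<bar>(- (A + 1) / 2) gchoose i\<bar> * \<bar>s\<bar> ^ i) * (\<bar>(A / 2) gchoose (j - i)\<bar> * \<bar>s\<bar> ^ (j - i))"
  have "summable (\<lambda>j. \<Sum>i\<le>j. ?t i j)"
    by (rule summable_Cauchy_product) (simp_all add: abs_mult power_abs summable_norm_gchoose[OF s])
  also have "(\<lambda>j. \<Sum>i\<le>j. ?t i j)
     = (\<lambda>j. moment_series_bound A j * \<bar>s\<bar> ^ j)"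
  proof
    fix j
    have "(a * \<bar>s\<bar> ^ i) * (b * \<bar>s\<bar> ^ (j - i)) = a * b * \<bar>s\<bar> ^ j" if "i \<le> j" for i a b
    proof -
      have "(a * \<bar>s\<bar> ^ i) * (b * \<bar>s\<bar> ^ (j - i)) = a * b * (\<bar>s\<bar> ^ i * \<bar>s\<bar> ^ (j - i))" by (simp only: mult_ac)
      then show ?thesis using that by (simp flip: power_add)
    qed
    then show "(\<Sum>i\<le>j. ?t i j) = moment_series_bound A j * \<bar>s\<bar> ^ j"
      unfolding moment_series_bound_def sum_distrib_right by (intro sum.cong refl) auto
  qed
  finally show ?thesis .
qed

lemma moment_series_sums:
  assumes s: "\<bar>s\<bar> < 1" and t: "\<bar>\<tau>\<bar> \<le> 1"
  shows "(\<lambda>j. moment_series A \<tau> $$ j * s ^ j) sums ((1 - s) powr (- (A + 1) / 2) * (1 - s * \<tau>) powr (A / 2))"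
proof -
  let ?t = "\<lambda>i j. (((- (A + 1) / 2) gchoose i) * (- s) ^ i) * (((A / 2) gchoose (j - i)) * (- (s * \<tau>)) ^ (j - i))"
  have st: "\<bar>- (s * \<tau>)\<bar> < 1"
    using abs_mult_less_one[OF s t] by simp
  have s': "\<bar>- s\<bar> < 1" using s by simp
  have a: "(\<lambda>n. ((- (A + 1) / 2) gchoose n) * (- s) ^ n) sums ((1 - s) powr (- (A + 1) / 2))"
    using gen_binomial_real[OF s', of "- (A + 1) / 2"] by simp
  have b: "(\<lambda>n. ((A / 2) gchoose n) * (- (s * \<tau>)) ^ n) sums ((1 - s * \<tau>) powr (A / 2))"
    using gen_binomial_real[OF st, of "A / 2"] by simp
  have "(\<lambda>j. \<Sum>i\<le>j. ?t i j)
     sums ((\<Sum>n. ((- (A + 1) / 2) gchoose n) * (- s) ^ n) * (\<Sum>n. ((A / 2) gchoose n) * (- (s * \<tau>)) ^ n))"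
    by (rule Cauchy_product_sums)
      (use summable_norm_gchoose[OF s'] summable_norm_gchoose[OF st] in \<open>simp_all add: abs_mult power_abs\<close>)
  also have "(\<lambda>j. \<Sum>i\<le>j. ?t i j)
     = (\<lambda>j. moment_series A \<tau> $$ j * s ^ j)"
  proof
    fix j
    have "?t i j =
       ((((- (A + 1) / 2) gchoose i) * (- 1) ^ i) * (((A / 2) gchoose (j - i)) * (- \<tau>) ^ (j - i))) * s ^ j" if "i \<le> j" for i
    proof -
      have "(- s) ^ i * (- (s * \<tau>)) ^ (j - i) = (-1) ^ i * (- \<tau>) ^ (j - i) * (s ^ i * s ^ (j - i))"
        using power_mult_distrib[of "-1" s i] power_mult_distrib[of s "- \<tau>" "j - i"] by (simp add: mult_ac)
      also have "s ^ i * s ^ (j - i) = s ^ j" using that by (simp flip: power_add)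
      finally show ?thesis by (simp add: mult_ac)
    qed
    then show "(\<Sum>i\<le>j. ?t i j)
     = moment_series A \<tau> $$ j * s ^ j"
      unfolding moment_series_def fps_mult_nth sum_distrib_right atMost_atLeast0 binom_series_nth
      by (intro sum.cong refl) (simp add: mult.assoc)
  qed
  finally show ?thesis using a b by (simp add: sums_iff)
qed

text \<open>This extracts single moments from an integrated generating function. The majorant
  \<open>D\<close>, free of \<open>x\<close>, justifies termwise integration, and two power series
  with the same sum have the same coefficients.\<close>

lemma integral_powser_coeff:
  fixes c :: "nat \<Rightarrow> 'a \<Rightarrow> real" and w :: "'a \<Rightarrow> real"
  assumes w: "integrable M w"
    and c [measurable]: "\<And>j. c j \<in> borel_measurable M"
    and bd: "\<And>j x. x \<in> space M \<Longrightarrow> \<bar>c j x\<bar> \<le> D j"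
    and D: "\<And>s. \<bar>s\<bar> < 1 \<Longrightarrow> summable (\<lambda>j. D j * \<bar>s\<bar> ^ j)"
    and F: "\<And>s x. \<bar>s\<bar> < 1 \<Longrightarrow> x \<in> space M \<Longrightarrow> (\<lambda>j. c j x * s ^ j) sums F s x"
    and b: "\<And>s. \<bar>s\<bar> < 1 \<Longrightarrow> (\<lambda>j. b j * s ^ j) sums (\<integral>x. w x * F s x \<partial>M)"
  shows "integrable M (\<lambda>x. w x * c j x) \<and> (\<integral>x. w x * c j x \<partial>M) = b j"
proof -
  have [measurable]: "w \<in> borel_measurable M" using w by auto
  have D0: "D j \<ge> 0" if "x \<in> space M" for x j using bd[OF that, of j] by linarith
  have i: "integrable M (\<lambda>x. w x * c j x)" for j
  proof (rule Bochner_Integration.integrable_bound[where f="\<lambda>x. D j * w x"])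
    show "AE x in M. norm (w x * c j x) \<le> norm (D j * w x)"
      using bd D0 by (intro AE_I2) (simp add: abs_mult mult.commute[of _ "\<bar>c j _\<bar>"] mult_right_mono)
  qed (use w in auto)
  have "(\<lambda>j. (\<integral>x. w x * c j x \<partial>M) * s ^ j) sums (\<integral>x. w x * F s x \<partial>M)" if s: "\<bar>s\<bar> < 1" for s
  proof -
    have "(\<lambda>j. \<integral>x. (w x * c j x) * s ^ j \<partial>M) sums (\<integral>x. (\<Sum>j. (w x * c j x) * s ^ j) \<partial>M)"
    proof (rule sums_integral)
      show "integrable M (\<lambda>x. (w x * c j x) * s ^ j)" for j using i by simp
      have bd2: "\<bar>(w x * c j x) * s ^ j\<bar> \<le> \<bar>w x\<bar> * (D j * \<bar>s\<bar> ^ j)" if "x \<in> space M" for x j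
        using bd[OF that, of j] by (simp add: abs_mult power_abs mult.assoc mult_left_mono mult_right_mono)
      show "AE x in M. summable (\<lambda>j. norm ((w x * c j x) * s ^ j))"
        using D[OF s] bd2 by (intro AE_I2 summable_comparison_test'[OF summable_mult[OF D[OF s]], of 0]) auto
      show "summable (\<lambda>j. \<integral>x. norm ((w x * c j x) * s ^ j) \<partial>M)"
      proof (rule summable_comparison_test'[where N=0])
        show "summable (\<lambda>j. (\<integral>x. \<bar>w x\<bar> \<partial>M) * (D j * \<bar>s\<bar> ^ j))" by (rule summable_mult[OF D[OF s]])
        fix j
        have "(\<integral>x. norm ((w x * c j x) * s ^ j) \<partial>M) \<le> (\<integral>x. \<bar>w x\<bar> * (D j * \<bar>s\<bar> ^ j) \<partial>M)"
          using bd2 i w by (intro integral_mono) auto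
        then show "norm (\<integral>x. norm ((w x * c j x) * s ^ j) \<partial>M) \<le> (\<integral>x. \<bar>w x\<bar> \<partial>M) * (D j * \<bar>s\<bar> ^ j)"
          by simp
      qed
    qed
    also have "(\<integral>x. (\<Sum>j. (w x * c j x) * s ^ j) \<partial>M) = (\<integral>x. w x * F s x \<partial>M)"
    proof (intro Bochner_Integration.integral_cong refl)
      fix x assume "x \<in> space M"
      then show "(\<Sum>j. (w x * c j x) * s ^ j) = w x * F s x"
        using sums_mult[OF F[OF s], of x "w x"] by (simp add: sums_iff mult.assoc)
    qed
    finally show ?thesis by simp
  qed
  from powser_coeff_unique[of 1 _ "\<lambda>s. \<integral>x. w x * F s x \<partial>M" b, OF _ this b]
  show ?thesis using i by simp
qed

section \<open>Even moments of the kernel of exponent \<open>q\<close> and dual moments of the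
  kernel of exponent \<open>p\<close>\<close>

lemma has_bochner_integral_sphere_generating:
  fixes \<xi> l :: "real ^ 'n"
  assumes q: "q > -1" and s: "s < 1" and \<xi>: "norm \<xi> = 1" and l: "norm l = 1"
  shows "has_bochner_integral sphere_measure
    (\<lambda>x. \<bar>x \<bullet> \<xi>\<bar> powr q * (1 - s * (x \<bullet> l)\<^sup>2) powr (- (real CARD('n) + q) / 2))
    (sphere_moment CARD('n) q * ((1 - s) powr (- 1 / 2) * (1 + s / (1 - s) * (\<xi> \<bullet> l)\<^sup>2) powr (q / 2)))"
  using nn_integral_sphere_generating[OF assms] sphere_moment_pos[OF q, of "CARD('n)"]
  by (intro has_bochner_integral_nn_integral borel_measurable_sphere_measureI) (auto simp: Suc_leI)

lemma has_bochner_integral_sphere_abs_inner_powr: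
  fixes \<xi> :: "real ^ 'n"
  assumes q: "q > -1" and \<xi>: "norm \<xi> = 1"
  shows "has_bochner_integral sphere_measure (\<lambda>x. \<bar>x \<bullet> \<xi>\<bar> powr q) (sphere_moment CARD('n) q)"
  using nn_integral_sphere_abs_inner_powr[OF assms] sphere_moment_pos[OF q, of "CARD('n)"]
  by (intro has_bochner_integral_nn_integral borel_measurable_sphere_measureI) (auto simp: Suc_leI)

lemma inner_square_le_one:
  assumes "norm x = 1" "norm y = 1"
  shows "(x \<bullet> y)\<^sup>2 \<le> 1"
  using Cauchy_Schwarz_ineq2[of x y] assms by (simp add: abs_square_le_1)

lemma abs_inner_power_le_one:
  assumes "norm x = 1" "norm l = 1"
  shows "\<bar>(x \<bullet> l) ^ (2 * j)\<bar> \<le> 1"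
  using inner_square_le_one[OF assms] by (simp add: power_mult power_le_one)

lemma pochhammer_half_nonzero:
  assumes "a \<notin> \<int>"
  shows "pochhammer ((real n + a) / 2) j \<noteq> 0"
proof
  assume "pochhammer ((real n + a) / 2) j = 0"
  then obtain i where "(real n + a) / 2 = - real i" by (auto simp: pochhammer_eq_0_iff)
  then have "a = of_int (- 2 * int i - int n)" by simp
  then show False using assms Ints_of_int by metis
qed

text \<open>Both sides are coefficients of the same generating function. On the left
  \<open>(1 - s * (x \<bullet> l)\<^sup>2) powr a\<close> with \<open>a = - (n + q) / 2\<close> is
  expanded under the integral, which yields \<open>pochhammer (- a) j / fact j\<close>; on the right
  \<open>1 + s / (1 - s) * (\<xi> \<bullet> l)\<^sup>2 = (1 - s * \<tau>) / (1 - s)\<close>.\<close>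

lemma sphere_even_moment:
  fixes \<xi> l :: "real ^ 'n"
  assumes q: "q > -1" and \<xi>: "norm \<xi> = 1" and l: "norm l = 1"
  shows "pochhammer ((real CARD('n) + q) / 2) j / fact j * (\<integral>x. \<bar>x \<bullet> \<xi>\<bar> powr q * (x \<bullet> l) ^ (2 * j) \<partial>sphere_measure) =
     sphere_moment CARD('n) q * moment_series q (1 - (\<xi> \<bullet> l)\<^sup>2) $$ j"
proof -
  let ?S = "sphere_measure :: (real ^ 'n) measure"
  let ?P = "pochhammer ((real CARD('n) + q) / 2) j / fact j"
  let ?W = "sphere_moment CARD('n) q"
  define a where "a = - (real CARD('n) + q) / 2"
  have a_neg: "- a = (real CARD('n) + q) / 2" by (simp add: a_def minus_divide_left)
  define \<tau> where "\<tau> = 1 - (\<xi> \<bullet> l)\<^sup>2"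
  have t: "\<bar>\<tau>\<bar> \<le> 1" using inner_square_le_one[OF \<xi> l] by (simp add: \<tau>_def)
  define c where "c = (\<lambda>j (x :: real ^ 'n). (a gchoose j) * (- (x \<bullet> l)\<^sup>2) ^ j)"
  have "integrable ?S (\<lambda>x. \<bar>x \<bullet> \<xi>\<bar> powr q * c j x) \<and>
     (\<integral>x. \<bar>x \<bullet> \<xi>\<bar> powr q * c j x \<partial>?S) = ?W * moment_series q \<tau> $$ j"
  proof (rule integral_powser_coeff[where c=c and j=j and D="\<lambda>j. \<bar>a gchoose j\<bar>" and F="\<lambda>s x. (1 - s * (x \<bullet> l)\<^sup>2) powr a"])
    show "integrable ?S (\<lambda>x. \<bar>x \<bullet> \<xi>\<bar> powr q)"
      using has_bochner_integral_sphere_abs_inner_powr[OF q \<xi>] by (auto simp: has_bochner_integral_iff)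
    show "c j \<in> borel_measurable ?S" for j
      unfolding c_def by (intro borel_measurable_sphere_measureI) measurable
    show "\<bar>c j x\<bar> \<le> \<bar>a gchoose j\<bar>" if "x \<in> space ?S" for j x
    proof -
      have "\<bar>(- (x \<bullet> l)\<^sup>2) ^ j\<bar> \<le> 1"
        using inner_square_le_one[of x l] that l by (simp add: power_abs power_le_one)
      then show ?thesis by (simp add: c_def abs_mult mult_left_le)
    qed
    show "summable (\<lambda>j. \<bar>a gchoose j\<bar> * \<bar>s\<bar> ^ j)" if "\<bar>s\<bar> < 1" for s
      using that by (rule summable_norm_gchoose)
    show "(\<lambda>j. c j x * s ^ j) sums ((1 - s * (x \<bullet> l)\<^sup>2) powr a)" if s: "\<bar>s\<bar> < 1" and x: "x \<in> space ?S" for s x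
    proof -
      have "(x \<bullet> l)\<^sup>2 \<le> 1" using inner_square_le_one[of x l] x l by simp
      then have "\<bar>- (s * (x \<bullet> l)\<^sup>2)\<bar> < 1"
        using abs_mult_less_one[OF s, of "(x \<bullet> l)\<^sup>2"] by simp
      moreover have "(- (s * (x \<bullet> l)\<^sup>2)) ^ n = (- (x \<bullet> l)\<^sup>2) ^ n * s ^ n" for n
        using power_mult_distrib[of "- (x \<bullet> l)\<^sup>2" s n] by (simp add: mult.commute)
      ultimately show ?thesis using gen_binomial_real[of "- (s * (x \<bullet> l)\<^sup>2)" a]
        by (simp add: c_def mult.assoc)
    qed
    show "(\<lambda>j. (?W * moment_series q \<tau> $$ j) * s ^ j) sums
      (\<integral>x. \<bar>x \<bullet> \<xi>\<bar> powr q * (1 - s * (x \<bullet> l)\<^sup>2) powr a \<partial>?S)" if s: "\<bar>s\<bar> < 1" for s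
    proof -
      have s1: "1 - s > 0" using s by simp
      have "(1 + s / (1 - s) * (\<xi> \<bullet> l)\<^sup>2) = (1 - s * \<tau>) / (1 - s)"
        using s1 by (simp add: \<tau>_def field_simps)
      moreover have "1 - s * \<tau> \<ge> 0"
        using abs_mult_less_one[OF s t] by linarith
      moreover have "(1 - s) powr (- (q + 1) / 2) = (1 - s) powr (- 1 / 2) / (1 - s) powr (q / 2)"
        by (rule powr_half_shift)
      ultimately have "(1 - s) powr (- 1 / 2) * (1 + s / (1 - s) * (\<xi> \<bullet> l)\<^sup>2) powr (q / 2) =
         (1 - s) powr (- (q + 1) / 2) * (1 - s * \<tau>) powr (q / 2)"
        using s1 by (simp add: powr_divide)
      then have "(\<integral>x. \<bar>x \<bullet> \<xi>\<bar> powr q * (1 - s * (x \<bullet> l)\<^sup>2) powr a \<partial>?S) =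
         ?W * ((1 - s) powr (- (q + 1) / 2) * (1 - s * \<tau>) powr (q / 2))"
        using has_bochner_integral_sphere_generating[OF q _ \<xi> l, of s] s
        by (simp add: has_bochner_integral_iff a_def)
      then show ?thesis using sums_mult[OF moment_series_sums[OF s t, of q], of "?W"]
        by (simp add: mult.assoc)
    qed
  qed
  then have "(\<integral>x. \<bar>x \<bullet> \<xi>\<bar> powr q * c j x \<partial>?S) = ?W * moment_series q \<tau> $$ j"
    by blast
  also have "(\<integral>x. \<bar>x \<bullet> \<xi>\<bar> powr q * c j x \<partial>?S) =
     (\<integral>x. ?P * (\<bar>x \<bullet> \<xi>\<bar> powr q * (x \<bullet> l) ^ (2 * j)) \<partial>?S)"
  proof (intro Bochner_Integration.integral_cong refl)
    fix x :: "real ^ 'n"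
    have "c j x = ((a gchoose j) * (-1) ^ j) * (x \<bullet> l) ^ (2 * j)"
      using power_mult_distrib[of "-1" "(x \<bullet> l)\<^sup>2" j] by (simp add: c_def power_mult)
    also have "(a gchoose j) * (-1) ^ j = ?P"
      by (simp add: gbinomial_pochhammer a_neg mult.commute flip: power_mult_distrib)
    finally show "\<bar>x \<bullet> \<xi>\<bar> powr q * c j x = ?P * (\<bar>x \<bullet> \<xi>\<bar> powr q * (x \<bullet> l) ^ (2 * j))"
      by simp
  qed
  finally show ?thesis by (simp add: \<tau>_def)
qed

text \<open>The counterpart of \<open>sphere_even_moment\<close>. For the exponent
  \<open>B = - n - p\<close> the sum of the moment series is, up to a power of \<open>1 - s\<close>,
  the weight of \<open>has_bochner_integral_sphere_generating\<close> for the exponent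
  \<open>p\<close>, taken at \<open>s' = - s / (1 - s)\<close>. The powers of \<open>1 - s\<close>
  cancel, and \<open>(1 - s * (\<theta> \<bullet> l)\<^sup>2) powr (p / 2)\<close> remains to be
  expanded.\<close>

lemma sphere_dual_moment:
  fixes \<theta> l :: "real ^ 'n"
  assumes p: "p > -1" and \<theta>: "norm \<theta> = 1" and l: "norm l = 1"
  shows "(\<integral>\<xi>. \<bar>\<theta> \<bullet> \<xi>\<bar> powr p * moment_series (- real CARD('n) - p) (1 - (\<xi> \<bullet> l)\<^sup>2) $$ j \<partial>sphere_measure) =
     sphere_moment CARD('n) p * (pochhammer (- p / 2) j / fact j * (\<theta> \<bullet> l) ^ (2 * j))"
proof -
  let ?S = "sphere_measure :: (real ^ 'n) measure"
  let ?W = "sphere_moment CARD('n) p"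
  define B where "B = - real CARD('n) - p"
  let ?F = "\<lambda>s (x :: real ^ 'n). (1 - s) powr (- (B + 1) / 2) * (1 - s * (1 - (x \<bullet> l)\<^sup>2)) powr (B / 2)"
  define c where "c = (\<lambda>j (x :: real ^ 'n). moment_series B (1 - (x \<bullet> l)\<^sup>2) $$ j)"
  have t: "\<bar>1 - (x \<bullet> l)\<^sup>2\<bar> \<le> 1" if "x \<in> space ?S" for x :: "real ^ 'n"
    using inner_square_le_one[of x l] l that by simp
  have eqF: "?F s x =
     (1 - s) powr (- 1 / 2) * (1 - (- s / (1 - s)) * (x \<bullet> l)\<^sup>2) powr (- (real CARD('n) + p) / 2)"
    if s: "\<bar>s\<bar> < 1" and x: "x \<in> space ?S" for s and x :: "real ^ 'n"
  proof -
    have s1: "1 - s > 0" using s by simp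
    have e: "1 - (- s / (1 - s)) * (x \<bullet> l)\<^sup>2 = (1 - s * (1 - (x \<bullet> l)\<^sup>2)) / (1 - s)"
      using s1 by (simp add: field_simps)
    have nn: "1 - s * (1 - (x \<bullet> l)\<^sup>2) \<ge> 0"
      using abs_mult_less_one[OF s t[OF x]] by linarith
    have BB: "- (real CARD('n) + p) / 2 = B / 2" by (simp add: B_def)
    have "(1 - s) powr (- (B + 1) / 2) = (1 - s) powr (- 1 / 2) / (1 - s) powr (B / 2)"
      by (rule powr_half_shift)
    then show ?thesis unfolding e BB using s1 nn by (simp add: powr_divide)
  qed
  have "integrable ?S (\<lambda>x. \<bar>x \<bullet> \<theta>\<bar> powr p * c j x) \<and>
     (\<integral>x. \<bar>x \<bullet> \<theta>\<bar> powr p * c j x \<partial>?S) = ?W * (pochhammer (- p / 2) j / fact j * (\<theta> \<bullet> l) ^ (2 * j))"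
  proof (rule integral_powser_coeff[where c=c and j=j and D="moment_series_bound B" and
       F="\<lambda>s (x :: real ^ 'n). ?F s x"])
    show "integrable ?S (\<lambda>x. \<bar>x \<bullet> \<theta>\<bar> powr p)"
      using has_bochner_integral_sphere_abs_inner_powr[OF p \<theta>] by (auto simp: has_bochner_integral_iff)
    show "c j \<in> borel_measurable ?S" for j
      unfolding c_def moment_series_def fps_mult_nth binom_series_nth
      by (intro borel_measurable_sphere_measureI) measurable
    show "\<bar>c j x\<bar> \<le> moment_series_bound B j" if "x \<in> space ?S" for j and x :: "real ^ 'n"
      unfolding c_def by (rule moment_series_nth_bound[OF t[OF that]])
    show "summable (\<lambda>j. moment_series_bound B j * \<bar>s\<bar> ^ j)" if "\<bar>s\<bar> < 1" for s
      using that by (rule summable_moment_series_bound)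
    show "(\<lambda>j. c j x * s ^ j) sums ?F s x"
      if s: "\<bar>s\<bar> < 1" and x: "x \<in> space ?S" for s x
      unfolding c_def by (rule moment_series_sums[OF s t[OF x]])
    show "(\<lambda>j. (?W * (pochhammer (- p / 2) j / fact j * (\<theta> \<bullet> l) ^ (2 * j))) * s ^ j) sums
      (\<integral>x. \<bar>x \<bullet> \<theta>\<bar> powr p * ?F s x \<partial>?S)"
      if s: "\<bar>s\<bar> < 1" for s
    proof -
      have s1: "1 - s > 0" using s by simp
      \<comment> \<open>\<open>s'\<close> stays below 1 but is unbounded below as \<open>s\<close>
        tends to 1, which is why the generating formula is proved for all \<open>s < 1\<close> and
        not only for \<open>\<bar>s\<bar> < 1\<close>.\<close>
      define s' where "s' = - s / (1 - s)"
      have s': "s' < 1" "1 - s' = 1 / (1 - s)" "s' / (1 - s') = - s"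
        using s1 by (auto simp: s'_def field_simps)
      have "(\<integral>x. \<bar>x \<bullet> \<theta>\<bar> powr p * ?F s x \<partial>?S) =
        (\<integral>x. (1 - s) powr (- 1 / 2) * (\<bar>x \<bullet> \<theta>\<bar> powr p * (1 - s' * (x \<bullet> l)\<^sup>2) powr (- (real CARD('n) + p) / 2)) \<partial>?S)"
        unfolding s'_def by (intro Bochner_Integration.integral_cong refl) (simp only: eqF[OF s], simp)
      also have "\<dots> = (1 - s) powr (- 1 / 2) * (?W * ((1 - s') powr (- 1 / 2) * (1 + s' / (1 - s') * (\<theta> \<bullet> l)\<^sup>2) powr (p / 2)))"
        using has_bochner_integral_sphere_generating[OF p s'(1) \<theta> l]
        by (simp add: has_bochner_integral_iff)
      also have "\<dots> = ?W * (1 - s * (\<theta> \<bullet> l)\<^sup>2) powr (p / 2)"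
        unfolding s'(3) unfolding s'(2) using s1 by (simp add: powr_divide powr_minus field_simps)
      finally have I: "(\<integral>x. \<bar>x \<bullet> \<theta>\<bar> powr p * ?F s x \<partial>?S) =
         ?W * (1 - s * (\<theta> \<bullet> l)\<^sup>2) powr (p / 2)" .
      have "\<bar>- (s * (\<theta> \<bullet> l)\<^sup>2)\<bar> < 1"
        using abs_mult_less_one[OF s, of "(\<theta> \<bullet> l)\<^sup>2"] inner_square_le_one[OF \<theta> l] by simp
      from sums_mult[OF gen_binomial_real[OF this, of "p / 2"], of "?W"]
      have "(\<lambda>j. ?W * (((p / 2) gchoose j) * (- (s * (\<theta> \<bullet> l)\<^sup>2)) ^ j)) sums
        (?W * (1 - s * (\<theta> \<bullet> l)\<^sup>2) powr (p / 2))" by simp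
      also have "(\<lambda>j. ?W * (((p / 2) gchoose j) * (- (s * (\<theta> \<bullet> l)\<^sup>2)) ^ j)) =
        (\<lambda>j. (?W * (pochhammer (- p / 2) j / fact j * (\<theta> \<bullet> l) ^ (2 * j))) * s ^ j)"
      proof
        fix j
        have "((p / 2) gchoose j) * (- (s * (\<theta> \<bullet> l)\<^sup>2)) ^ j = (((p / 2) gchoose j) * (-1) ^ j) * ((\<theta> \<bullet> l) ^ (2 * j) * s ^ j)"
          using power_mult_distrib[of "-1" "s * (\<theta> \<bullet> l)\<^sup>2" j] power_mult_distrib[of s "(\<theta> \<bullet> l)\<^sup>2" j]
          unfolding power_mult[of "\<theta> \<bullet> l" 2 j] by simp
        also have "((p / 2) gchoose j) * (-1) ^ j = pochhammer (- p / 2) j / fact j"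
          by (simp add: gbinomial_pochhammer mult.commute flip: power_mult_distrib)
        finally show "?W * (((p / 2) gchoose j) * (- (s * (\<theta> \<bullet> l)\<^sup>2)) ^ j) =
          (?W * (pochhammer (- p / 2) j / fact j * (\<theta> \<bullet> l) ^ (2 * j))) * s ^ j"
          by simp
      qed
      finally show ?thesis unfolding I .
    qed
  qed
  then show ?thesis by (simp add: c_def B_def inner_commute)
qed

section \<open>Test functions and the weak Laplacian\<close>

text \<open>The polynomial factor makes the family closed under differentiation: \<open>P\<close> is
  replaced by \<open>[:0, 0, 1:] * (P - pderiv P)\<close>.\<close>

definition flat_exp :: "real poly \<Rightarrow> real \<Rightarrow> real"
  where "flat_exp P x = (if x > 0 then poly P (1 / x) * exp (- (1 / x)) else 0)"

lemma poly_times_exp_tendsto_0: "((\<lambda>t. poly P t * exp (- t)) \<longlongrightarrow> (0::real)) at_top"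
proof -
  have "((\<lambda>t. \<Sum>i\<le>degree P. coeff P i * (t ^ i / exp t)) \<longlongrightarrow> (\<Sum>i\<le>degree P. coeff P i * 0)) at_top"
    by (intro tendsto_intros tendsto_power_div_exp_0)
  then show ?thesis
    by (simp add: poly_altdef sum_distrib_right exp_minus divide_inverse mult.assoc)
qed

text \<open>At the gluing point 0 the difference quotient tends to 0, because
  \<open>exp (- (1 / x))\<close> beats every polynomial in \<open>1 / x\<close>; elsewhere this is
  the chain rule.\<close>

lemma flat_exp_has_derivative:
  "(flat_exp P has_real_derivative flat_exp ([:0, 0, 1:] * (P - pderiv P)) x) (at x)"
proof -
  consider "x > 0" | "x < 0" | "x = 0" by linarith
  then show ?thesis
  proof cases
    case 1
    have "((\<lambda>x. poly P (1 / x) * exp (- (1 / x))) has_real_derivative flat_exp ([:0, 0, 1:] * (P - pderiv P)) x) (at x)"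
      using 1 by (auto intro!: derivative_eq_intros poly_DERIV[THEN DERIV_chain2]
          simp: flat_exp_def field_simps power2_eq_square)
    then show ?thesis
      by (rule has_field_derivative_transform_within_open[where S="{0<..}"]) (use 1 in \<open>auto simp: flat_exp_def\<close>)
  next
    case 2
    have "((\<lambda>x. 0) has_real_derivative flat_exp ([:0, 0, 1:] * (P - pderiv P)) x) (at x)"
      using 2 by (simp add: flat_exp_def)
    then show ?thesis
      by (rule has_field_derivative_transform_within_open[where S="{..<0}"]) (use 2 in \<open>auto simp: flat_exp_def\<close>)
  next
    case 3
    have "((\<lambda>y. flat_exp P y / y) \<longlongrightarrow> 0) (at 0)"
    proof (rule filterlim_split_at)
      have "eventually (\<lambda>y::real. flat_exp P y / y = 0) (at_left 0)"
        by (auto simp: flat_exp_def eventually_at_filter)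
      then show "((\<lambda>y. flat_exp P y / y) \<longlongrightarrow> 0) (at_left 0)"
        by (rule tendsto_eventually)
      \<comment> \<open>Division by \<open>y\<close> multiplies the polynomial in
        \<open>1 / y\<close> by its variable, hence \<open>pCons 0 P\<close>.\<close>
      have "((\<lambda>y. poly (pCons 0 P) (inverse y) * exp (- inverse y)) \<longlongrightarrow> 0) (at_right (0::real))"
        by (rule filterlim_compose[OF poly_times_exp_tendsto_0 filterlim_inverse_at_top_right])
      then show "((\<lambda>y. flat_exp P y / y) \<longlongrightarrow> 0) (at_right 0)"
        by (rule filterlim_cong[THEN iffD1, rotated 3])
           (auto simp: flat_exp_def eventually_at_filter field_simps)
    qed
    then show ?thesis using 3 by (simp add: has_field_derivative_iff flat_exp_def)
  qed
qed

text \<open>Smoothness asks for all iterated derivatives, so a class is generated that contains the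
  derivatives of its members. Multiplication by \<open>x\<close> is included because the Laplacian
  of \<open>h (x \<bullet> x)\<close> contains \<open>4 * t * h'' t\<close> at
  \<open>t = x \<bullet> x\<close>. The two \<open>flat_exp\<close> factors confine the support to
  \<open>[1, 4]\<close>, away from the origin.\<close>

inductive_set profiles :: "(real \<Rightarrow> real) set" where
  profiles_base: "(\<lambda>x. flat_exp P (x - 1) * flat_exp Q (4 - x)) \<in> profiles"
| profiles_times: "h \<in> profiles \<Longrightarrow> (\<lambda>x. x * h x) \<in> profiles"
| profiles_scale: "h \<in> profiles \<Longrightarrow> (\<lambda>x. c * h x) \<in> profiles"
| profiles_add: "h \<in> profiles \<Longrightarrow> k \<in> profiles \<Longrightarrow> (\<lambda>x. h x + k x) \<in> profiles"

lemma profiles_deriv: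
  "h \<in> profiles \<Longrightarrow> \<exists>h'\<in>profiles. \<forall>x. (h has_real_derivative h' x) (at x)"
proof (induction rule: profiles.induct)
  case (profiles_base P Q)
  let ?D = "\<lambda>P. [:0, 0, 1:] * (P - pderiv P)"
  have D: "((\<lambda>x. flat_exp P (x - 1) * flat_exp Q (4 - x)) has_real_derivative
      flat_exp (?D P) (x - 1) * flat_exp Q (4 - x) + (- 1) * (flat_exp P (x - 1) * flat_exp (?D Q) (4 - x))) (at x)" for x
    by (rule derivative_eq_intros DERIV_chain2[OF flat_exp_has_derivative] refl | simp)+
  have M: "(\<lambda>x. flat_exp (?D P) (x - 1) * flat_exp Q (4 - x) + (- 1) * (flat_exp P (x - 1) * flat_exp (?D Q) (4 - x))) \<in> profiles"
    by (intro profiles.intros)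
  show ?case by (intro bexI[OF _ M] allI D)
next
  case (profiles_times h)
  then obtain h' where h': "h' \<in> profiles" "\<And>x. (h has_real_derivative h' x) (at x)" by blast
  have "((\<lambda>x. x * h x) has_real_derivative (h x + x * h' x)) (at x)" for x
    using h'(2) by (auto intro!: derivative_eq_intros)
  with h' profiles_times show ?case
    by (intro bexI[of _ "\<lambda>x. h x + x * h' x"]) (auto intro!: profiles.intros)
next
  case (profiles_scale h c)
  then obtain h' where h': "h' \<in> profiles" "\<And>x. (h has_real_derivative h' x) (at x)" by blast
  then show ?case
    by (intro bexI[of _ "\<lambda>x. c * h' x"]) (auto intro!: profiles.intros derivative_eq_intros)
next
  case (profiles_add h k)
  then obtain h' k' where h': "h' \<in> profiles" "\<And>x. (h has_real_derivative h' x) (at x)"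
    "k' \<in> profiles" "\<And>x. (k has_real_derivative k' x) (at x)" by blast
  then show ?case
    by (intro bexI[of _ "\<lambda>x. h' x + k' x"]) (auto intro!: profiles.intros derivative_eq_intros)
qed

lemma profiles_support: "h \<in> profiles \<Longrightarrow> x \<le> 1 \<or> x \<ge> 4 \<Longrightarrow> h x = 0"
  by (induction rule: profiles.induct) (auto simp: flat_exp_def)

lemma profiles_continuous: "h \<in> profiles \<Longrightarrow> continuous_on A h"
  using profiles_deriv by (meson DERIV_continuous continuous_at_imp_continuous_on)

text \<open>The same device in several variables: an algebra closed under
  \<open>partial_deriv\<close>, so that its members are \<open>smooth\<close> and it is stable under
  \<open>laplacian\<close>. Compact support is not built in; it is shown separately for
  \<open>zonal_bump\<close>.\<close>

inductive_set bumps :: "('a::euclidean_space \<Rightarrow> real) set" where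
  bumps_const: "(\<lambda>_. c) \<in> bumps"
| bumps_inner: "(\<lambda>x. x \<bullet> a) \<in> bumps"
| bumps_profile: "h \<in> profiles \<Longrightarrow> (\<lambda>x. h (x \<bullet> x)) \<in> bumps"
| bumps_add: "f \<in> bumps \<Longrightarrow> g \<in> bumps \<Longrightarrow> (\<lambda>x. f x + g x) \<in> bumps"
| bumps_mult: "f \<in> bumps \<Longrightarrow> g \<in> bumps \<Longrightarrow> (\<lambda>x. f x * g x) \<in> bumps"

lemma has_derivative_comp_inner_self:
  fixes x :: "'a::real_inner"
  assumes "\<And>t. (h has_real_derivative h' t) (at t)"
  shows "((\<lambda>x. h (x \<bullet> x)) has_derivative (\<lambda>v. h' (x \<bullet> x) * (2 * (x \<bullet> v)))) (at x)"
proof -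
  have "((\<lambda>x. x \<bullet> x) has_derivative (\<lambda>v. 2 * (x \<bullet> v))) (at x)"
    by (auto intro!: derivative_eq_intros simp: inner_commute)
  from has_derivative_compose[OF this, of h "\<lambda>t. h' (x \<bullet> x) * t"] assms[of "x \<bullet> x"]
  show ?thesis by (simp add: has_field_derivative_def)
qed

lemma bumps_has_derivative:
  "f \<in> bumps \<Longrightarrow> \<exists>f'. (\<forall>x. (f has_derivative f' x) (at x)) \<and> (\<forall>v. (\<lambda>x. f' x v) \<in> bumps)"
proof (induction rule: bumps.induct)
  case (bumps_const c)
  show ?case by (rule exI[of _ "\<lambda>_ _. 0"]) (auto intro: bumps.intros)
next
  case (bumps_inner a)
  show ?case by (rule exI[of _ "\<lambda>_ v. v \<bullet> a"]) (auto intro!: bumps.intros derivative_eq_intros)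
next
  case (bumps_profile h)
  then obtain h' where h': "h' \<in> profiles" "\<And>x. (h has_real_derivative h' x) (at x)"
    using profiles_deriv by blast
  have "((\<lambda>x. h (x \<bullet> x)) has_derivative (\<lambda>v. h' (x \<bullet> x) * (2 * (x \<bullet> v)))) (at x)" for x :: 'a
    by (rule has_derivative_comp_inner_self[OF h'(2)])
  moreover have "(\<lambda>x. h' (x \<bullet> x) * (2 * (x \<bullet> v))) \<in> bumps" for v :: 'a
    using h'(1) by (intro bumps.intros)
  ultimately show ?case by (intro exI[of _ "\<lambda>x v. h' (x \<bullet> x) * (2 * (x \<bullet> v))"]) blast
next
  case (bumps_add f g)
  then obtain f' g' where "\<And>x. (f has_derivative f' x) (at x)" "\<And>v. (\<lambda>x. f' x v) \<in> bumps"
    "\<And>x. (g has_derivative g' x) (at x)" "\<And>v. (\<lambda>x. g' x v) \<in> bumps" by blast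
  then show ?case
    by (intro exI[of _ "\<lambda>x v. f' x v + g' x v"]) (auto intro!: bumps.intros derivative_intros)
next
  case (bumps_mult f g)
  then obtain f' g' where "\<And>x. (f has_derivative f' x) (at x)" "\<And>v. (\<lambda>x. f' x v) \<in> bumps"
    "\<And>x. (g has_derivative g' x) (at x)" "\<And>v. (\<lambda>x. g' x v) \<in> bumps" by blast
  with bumps_mult show ?case
    by (intro exI[of _ "\<lambda>x v. f x * g' x v + f' x v * g x"]) (auto intro!: bumps.intros derivative_intros)
qed

lemma partial_deriv_eqI:
  assumes "\<And>x. (f has_derivative f' x) (at x)"
  shows "partial_deriv v f = (\<lambda>x. f' x v)"
  unfolding partial_deriv_def using frechet_derivative_at[OF assms] by (auto simp: fun_eq_iff)

lemma bumps_partial_deriv: "f \<in> bumps \<Longrightarrow> partial_deriv v f \<in> bumps"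
  using bumps_has_derivative[of f] partial_deriv_eqI[of f] by metis

lemma bumps_differentiable: "f \<in> bumps \<Longrightarrow> f differentiable (at x)"
  using bumps_has_derivative[of f] differentiable_def by blast

lemma bumps_smooth: "f \<in> bumps \<Longrightarrow> smooth f"
proof -
  have "f \<in> bumps \<Longrightarrow> fold partial_deriv vs f \<in> bumps" for vs
    by (induction vs arbitrary: f) (auto intro: bumps_partial_deriv)
  then show "f \<in> bumps \<Longrightarrow> smooth f"
    by (auto simp: smooth_def differentiable_on_def intro!: differentiable_at_withinI bumps_differentiable)
qed

lemma bumps_sum: "finite A \<Longrightarrow> (\<And>i. i \<in> A \<Longrightarrow> f i \<in> bumps) \<Longrightarrow> (\<lambda>x. \<Sum>i\<in>A. f i x) \<in> bumps"
  by (induction A rule: finite_induct) (auto intro: bumps.intros)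

lemma bumps_power: "f \<in> bumps \<Longrightarrow> (\<lambda>x. f x ^ d) \<in> bumps"
  by (induction d) (auto intro: bumps.intros)

lemma bumps_laplacian: "f \<in> bumps \<Longrightarrow> laplacian f \<in> bumps"
  unfolding laplacian_def [abs_def] by (intro bumps_sum bumps_partial_deriv) auto

lemma partial_deriv_linear:
  assumes "f \<in> bumps" "g \<in> bumps"
  shows "partial_deriv v (\<lambda>x. f x + c * g x) = (\<lambda>x. partial_deriv v f x + c * partial_deriv v g x)"
proof -
  obtain f' g' where "\<And>x. (f has_derivative f' x) (at x)" "\<And>x. (g has_derivative g' x) (at x)"
    using bumps_has_derivative assms by meson
  moreover from this have "((\<lambda>x. f x + c * g x) has_derivative (\<lambda>v. f' x v + c * g' x v)) (at x)" for x
    by (auto intro!: derivative_intros)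
  ultimately show ?thesis
    using partial_deriv_eqI[of f f' v] partial_deriv_eqI[of g g' v]
      partial_deriv_eqI[of "\<lambda>x. f x + c * g x" "\<lambda>x v. f' x v + c * g' x v" v] by simp
qed

lemma laplacian_linear:
  assumes "f \<in> bumps" "g \<in> bumps"
  shows "laplacian (\<lambda>x. f x + c * g x) = (\<lambda>x. laplacian f x + c * laplacian g x)"
  unfolding laplacian_def[abs_def]
  by (simp add: partial_deriv_linear bumps_partial_deriv assms sum.distrib sum_distrib_left)

lemma laplacian_power_linear:
  "f \<in> bumps \<Longrightarrow> g \<in> bumps \<Longrightarrow>
    (laplacian ^^ k) (\<lambda>x. f x + c * g x) = (\<lambda>x. (laplacian ^^ k) f x + c * (laplacian ^^ k) g x)"
proof (induction k arbitrary: f g)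
  case (Suc k)
  have "(laplacian ^^ Suc k) (\<lambda>x. f x + c * g x) = (laplacian ^^ k) (laplacian (\<lambda>x. f x + c * g x))"
    by (simp add: funpow_swap1)
  also have "\<dots> = (\<lambda>x. (laplacian ^^ k) (laplacian f) x + c * (laplacian ^^ k) (laplacian g) x)"
    unfolding laplacian_linear[OF Suc.prems] by (rule Suc.IH) (intro bumps_laplacian Suc.prems)+
  finally show ?case by (simp add: funpow_swap1)
qed simp

section \<open>Zonal test functions and their Laplacian\<close>

definition zonal_bump :: "(real \<Rightarrow> real) \<Rightarrow> 'a::euclidean_space \<Rightarrow> nat \<Rightarrow> 'a \<Rightarrow> real"
  where "zonal_bump h l j x = h (x \<bullet> x) * (x \<bullet> l) ^ (2 * j)"

lemma zonal_bump_bumps: "h \<in> profiles \<Longrightarrow> zonal_bump h l j \<in> bumps"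
  unfolding zonal_bump_def[abs_def] by (intro bumps.intros bumps_power)

lemma zonal_bump_test_function:
  fixes l :: "'a::euclidean_space"
  assumes "h \<in> profiles"
  shows "test_function_on (- {0}) (zonal_bump h l j)"
proof -
  let ?K = "{x :: 'a. 1 \<le> x \<bullet> x \<and> x \<bullet> x \<le> 4}"
  have "closed ?K" by (intro closed_Collect_conj closed_Collect_le continuous_intros)
  have "norm x \<le> 2" if "x \<bullet> x \<le> 4" for x :: 'a
  proof (rule power2_le_imp_le)
    show "(norm x)\<^sup>2 \<le> 2\<^sup>2" unfolding power2_norm_eq_inner using that by simp
  qed simp
  then have "bounded ?K" by (auto simp: bounded_iff)
  have "{x. zonal_bump h l j x \<noteq> 0} \<subseteq> ?K"
  proof
    fix x assume "x \<in> {x. zonal_bump h l j x \<noteq> 0}"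
    then have "h (x \<bullet> x) \<noteq> 0" by (auto simp: zonal_bump_def)
    then have "\<not> (x \<bullet> x \<le> 1 \<or> x \<bullet> x \<ge> 4)" using profiles_support[OF assms] by blast
    then show "x \<in> ?K" by auto
  qed
  then have sub: "closure {x. zonal_bump h l j x \<noteq> 0} \<subseteq> ?K"
    using \<open>closed ?K\<close> by (rule closure_minimal)
  moreover have "compact (closure {x. zonal_bump h l j x \<noteq> 0})"
    using sub \<open>bounded ?K\<close> by (meson bounded_subset closed_closure compact_eq_bounded_closed)
  ultimately show ?thesis
    using bumps_smooth[OF zonal_bump_bumps[OF assms]] by (auto simp: test_function_on_def)
qed

text \<open>Product rule for the radial and the zonal factor: \<open>8 * j\<close> comes from the
  mixed gradient term by Euler's identity for \<open>(x \<bullet> l) ^ (2 * j)\<close>, the last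
  summand from the Laplacian of that power. Plain powers rather than harmonic polynomials keep the
  family closed at the cost of one lower neighbour \<open>j - 1\<close>.\<close>

lemma laplacian_zonal_bump:
  fixes l :: "'a::euclidean_space"
  assumes h: "\<And>t. (h has_real_derivative h' t) (at t)" "\<And>t. (h' has_real_derivative h'' t) (at t)"
    and l: "norm l = 1"
  shows "laplacian (zonal_bump h l j) =
    (\<lambda>x. zonal_bump (\<lambda>t. 4 * (t * h'' t) + (2 * real DIM('a) + 8 * real j) * h' t) l j x +
      real (2 * j) * (real (2 * j) - 1) * zonal_bump h l (j - 1) x)"
proof
  fix x :: 'a
  define d where "d = 2 * j"
  note sq = has_derivative_comp_inner_self
  have pw: "((\<lambda>x. (x \<bullet> l) ^ m) has_derivative (\<lambda>v. real m * (v \<bullet> l) * (x \<bullet> l) ^ (m - 1))) (at x)" for m and x :: 'a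
    by (auto intro!: derivative_eq_intros simp: mult_ac)
  have p1: "partial_deriv v (zonal_bump h l j) =
     (\<lambda>x. h (x \<bullet> x) * (real d * (v \<bullet> l) * (x \<bullet> l) ^ (d - 1)) + h' (x \<bullet> x) * (2 * (x \<bullet> v)) * (x \<bullet> l) ^ d)" for v
    by (rule partial_deriv_eqI)
       (unfold zonal_bump_def[abs_def] d_def[symmetric], rule has_derivative_mult[OF sq[OF h(1)] pw])
  let ?R = "\<lambda>C v. 4 * h'' (x \<bullet> x) * (x \<bullet> l) ^ d * (x \<bullet> v)\<^sup>2 + 2 * h' (x \<bullet> x) * (x \<bullet> l) ^ d * (v \<bullet> v)
       + 4 * real d * h' (x \<bullet> x) * (x \<bullet> l) ^ (d - 1) * ((x \<bullet> v) * (v \<bullet> l))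
       + real d * C * h (x \<bullet> x) * (x \<bullet> l) ^ (d - 2) * (v \<bullet> l)\<^sup>2"
  have p2: "partial_deriv v (partial_deriv v (zonal_bump h l j)) x = ?R (real d - 1) v" for v
  proof -
    have "((\<lambda>x. h (x \<bullet> x) * (real d * (v \<bullet> l) * (x \<bullet> l) ^ (d - 1)) + h' (x \<bullet> x) * (2 * (x \<bullet> v)) * (x \<bullet> l) ^ d)
      has_derivative (\<lambda>w. (h (x \<bullet> x) * (real d * (v \<bullet> l) * (real (d - 1) * (w \<bullet> l) * (x \<bullet> l) ^ (d - 1 - 1))) +
           h' (x \<bullet> x) * (2 * (x \<bullet> w)) * (real d * (v \<bullet> l) * (x \<bullet> l) ^ (d - 1))) +
         ((h' (x \<bullet> x) * (2 * (x \<bullet> v))) * (real d * (w \<bullet> l) * (x \<bullet> l) ^ (d - 1)) +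
           (h' (x \<bullet> x) * (2 * (w \<bullet> v)) + h'' (x \<bullet> x) * (2 * (x \<bullet> w)) * (2 * (x \<bullet> v))) * (x \<bullet> l) ^ d))) (at x)" for x :: 'a
      by (intro has_derivative_add has_derivative_mult sq[OF h(1)] sq[OF h(2)] pw has_derivative_mult_right
          bounded_linear_imp_has_derivative bounded_linear_inner_left)
    from partial_deriv_eqI[OF this, of v]
    have "partial_deriv v (partial_deriv v (zonal_bump h l j)) x =
       (h (x \<bullet> x) * (real d * (v \<bullet> l) * (real (d - 1) * (v \<bullet> l) * (x \<bullet> l) ^ (d - 1 - 1))) +
           h' (x \<bullet> x) * (2 * (x \<bullet> v)) * (real d * (v \<bullet> l) * (x \<bullet> l) ^ (d - 1))) +
         ((h' (x \<bullet> x) * (2 * (x \<bullet> v))) * (real d * (v \<bullet> l) * (x \<bullet> l) ^ (d - 1)) +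
           (h' (x \<bullet> x) * (2 * (v \<bullet> v)) + h'' (x \<bullet> x) * (2 * (x \<bullet> v)) * (2 * (x \<bullet> v))) * (x \<bullet> l) ^ d)"
      unfolding p1 by simp
    then have "partial_deriv v (partial_deriv v (zonal_bump h l j)) x =  ?R (real (d - 1)) v"
      by (simp add: power2_eq_square algebra_simps numeral_2_eq_2)
    \<comment> \<open>The truncated \<open>d - 1\<close> at \<open>d = 0\<close> is harmless because
      of the factor \<open>d\<close>.\<close>
    moreover have "real d * real (d - 1) = real d * (real d - 1)"
      by (cases d) auto
    ultimately show ?thesis by simp
  qed
  have s1: "(\<Sum>v\<in>Basis. (x \<bullet> v)\<^sup>2) = x \<bullet> x"
    by (simp add: euclidean_inner[of x x] power2_eq_square)
  have s2: "(\<Sum>v\<in>(Basis::'a set). v \<bullet> v) = real DIM('a)" by simp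
  have s3: "(\<Sum>v\<in>Basis. (x \<bullet> v) * (v \<bullet> l)) = x \<bullet> l"
    by (subst euclidean_inner[of x l], intro sum.cong refl) (metis inner_commute)
  have s4: "(\<Sum>v\<in>Basis. (v \<bullet> l)\<^sup>2) = 1"
    using l power2_norm_eq_sum_Basis[of l] by (simp add: inner_commute)
  have "laplacian (zonal_bump h l j) x =
     4 * h'' (x \<bullet> x) * (x \<bullet> l) ^ d * (x \<bullet> x) + 2 * h' (x \<bullet> x) * (x \<bullet> l) ^ d * real DIM('a)
     + 4 * real d * h' (x \<bullet> x) * (x \<bullet> l) ^ (d - 1) * (x \<bullet> l)
     + real d * (real d - 1) * h (x \<bullet> x) * (x \<bullet> l) ^ (d - 2)"
    unfolding laplacian_def p2 sum.distrib sum_distrib_left[symmetric] s1 s2 s3 s4 by simp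
  moreover have "real d * (x \<bullet> l) ^ (d - 1) * (x \<bullet> l) = real d * (x \<bullet> l) ^ d"
    by (cases d) auto
  ultimately have "laplacian (zonal_bump h l j) x =
     4 * h'' (x \<bullet> x) * (x \<bullet> l) ^ d * (x \<bullet> x) + 2 * h' (x \<bullet> x) * (x \<bullet> l) ^ d * real DIM('a)
     + 4 * h' (x \<bullet> x) * (real d * (x \<bullet> l) ^ d)
     + real d * (real d - 1) * h (x \<bullet> x) * (x \<bullet> l) ^ (d - 2)"
    by (simp add: mult.assoc mult.left_commute[of "real d"])
  moreover have "d - 2 = 2 * (j - 1)" by (simp add: d_def)
  ultimately show "laplacian (zonal_bump h l j) x =
    zonal_bump (\<lambda>t. 4 * (t * h'' t) + (2 * real DIM('a) + 8 * real j) * h' t) l j x +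
      real (2 * j) * (real (2 * j) - 1) * zonal_bump h l (j - 1) x"
    by (simp add: zonal_bump_def d_def algebra_simps)
qed

section \<open>Radial integrals of the profiles\<close>

definition radial_moment :: "(real \<Rightarrow> real) \<Rightarrow> real \<Rightarrow> real"
  where "radial_moment h a = (\<integral>r. indicator {0<..} r * (r powr a * h (r\<^sup>2)) \<partial>lborel)"

lemma radial_moment_Icc:
  assumes h: "h \<in> profiles"
  shows "indicator {0<..} r * (r powr a * h (r\<^sup>2)) = indicator {1..2} r * (r powr a * h (r\<^sup>2))"
proof (cases "r \<in> {0<..} \<and> r \<notin> {1..2}")
  case True
  then have "r\<^sup>2 \<le> 1 \<or> r\<^sup>2 \<ge> 4"
    using power_mono[of 2 r 2] by (auto simp: power_le_one)
  then show ?thesis using profiles_support[OF h] by simp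
qed (auto simp: indicator_def)

lemma integrable_radial_moment:
  assumes h: "h \<in> profiles"
  shows "integrable lborel (\<lambda>r. indicator {0<..} r * (r powr a * h (r\<^sup>2)))"
proof -
  have "set_integrable lborel {1..2} (\<lambda>r. r powr a * h (r\<^sup>2))"
    by (intro borel_integrable_atLeastAtMost' continuous_intros continuous_on_compose2[OF profiles_continuous[OF h, of UNIV]]) auto
  then show ?thesis by (simp add: set_integrable_def radial_moment_Icc[OF h])
qed

text \<open>Integration by parts for \<open>r powr b * h (r\<^sup>2)\<close> on
  \<open>[1, 2]\<close>: the profile vanishes at both ends.\<close>

lemma radial_moment_deriv:
  assumes h: "h \<in> profiles" "h' \<in> profiles" "\<And>x. (h has_real_derivative h' x) (at x)"
  shows "2 * radial_moment h' (b + 1) = - b * radial_moment h (b - 1)"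
proof -
  have "(\<integral>r. (b * r powr (b - 1) * h (r\<^sup>2) + r powr b * (h' (r\<^sup>2) * (2 * r))) * indicator {1..2} r \<partial>lborel)
    = 2 powr b * h (2\<^sup>2) - 1 powr b * h (1\<^sup>2)"
  proof (rule integral_FTC_Icc_real)
    fix r :: real assume "1 \<le> r" "r \<le> 2"
    then show "((\<lambda>r. r powr b * h (r\<^sup>2)) has_real_derivative
        (b * r powr (b - 1) * h (r\<^sup>2) + r powr b * (h' (r\<^sup>2) * (2 * r)))) (at r)"
      by (auto intro!: derivative_eq_intros DERIV_chain2[OF h(3)])
    show "isCont (\<lambda>r. b * r powr (b - 1) * h (r\<^sup>2) + r powr b * (h' (r\<^sup>2) * (2 * r))) r"
      using \<open>1 \<le> r\<close> profiles_continuous[OF h(1), of UNIV] profiles_continuous[OF h(2), of UNIV]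
      by (intro continuous_intros isCont_o2[where f="\<lambda>r. r\<^sup>2"]) (auto simp: continuous_on_eq_continuous_at)
  qed simp
  also have "\<dots> = 0" using profiles_support[OF h(1)] by simp
  also have "(\<lambda>r. (b * r powr (b - 1) * h (r\<^sup>2) + r powr b * (h' (r\<^sup>2) * (2 * r))) * indicator {1..2} r) =
    (\<lambda>r. b * (indicator {0<..} r * (r powr (b - 1) * h (r\<^sup>2))) + 2 * (indicator {0<..} r * (r powr (b + 1) * h' (r\<^sup>2))))"
    unfolding radial_moment_Icc[OF h(1)] radial_moment_Icc[OF h(2)]
    by (auto simp: fun_eq_iff indicator_def powr_add)
  also have "integral\<^sup>L lborel \<dots> = b * radial_moment h (b - 1) + 2 * radial_moment h' (b + 1)"
    unfolding radial_moment_def using integrable_radial_moment[OF h(1)] integrable_radial_moment[OF h(2)]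
    by simp
  finally show ?thesis by simp
qed

lemma radial_moment_add:
  assumes "h \<in> profiles" "k \<in> profiles"
  shows "radial_moment (\<lambda>t. h t + k t) a = radial_moment h a + radial_moment k a"
  unfolding radial_moment_def
  using integrable_radial_moment[OF assms(1)] integrable_radial_moment[OF assms(2)]
  by (simp add: distrib_left flip: Bochner_Integration.integral_add)

lemma radial_moment_scale: "radial_moment (\<lambda>t. c * h t) a = c * radial_moment h a"
  unfolding radial_moment_def by (simp add: mult.left_commute flip: integral_mult_right_zero)

lemma radial_moment_times: "radial_moment (\<lambda>t. t * h t) a = radial_moment h (a + 2)"
  unfolding radial_moment_def
  by (intro Bochner_Integration.integral_cong refl) (auto simp: indicator_def powr_add powr_realpow mult_ac)

text \<open>The weak equation yields the moment identity multiplied by a radial moment of the test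
  profile; with this profile it can be cancelled whatever the exponent.\<close>

lemma profile_radial_moment_pos: "\<exists>h\<in>profiles. \<forall>a. radial_moment h a > 0"
proof -
  let ?h = "\<lambda>x. flat_exp 1 (x - 1) * flat_exp 1 (4 - x)"
  have h: "?h \<in> profiles" by (rule profiles_base)
  have "radial_moment ?h a > 0" for a
  proof -
    have nn: "0 \<le> indicator {0<..} r * (r powr a * ?h (r\<^sup>2))" for r
      by (simp add: flat_exp_def)
    have "radial_moment ?h a \<noteq> 0"
    proof
      assume "radial_moment ?h a = 0"
      then have "AE r in lborel. indicator {0<..} r * (r powr a * ?h (r\<^sup>2)) = 0"
        unfolding radial_moment_def using integral_nonneg_eq_0_iff_AE[OF integrable_radial_moment[OF h, of a]] nn by simp
      then have "AE r in lborel. r \<notin> {1<..<2::real}"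
      proof eventually_elim
        case (elim r)
        show ?case
        proof
          assume r: "r \<in> {1<..<2}"
          then have "r\<^sup>2 > 1" "r\<^sup>2 < 4"
            using power_strict_mono[of 1 r 2] power_strict_mono[of r 2 2] by auto
          then show False using elim r by (simp add: flat_exp_def)
        qed
      qed
      then have "emeasure lborel {1<..<2::real} = 0"
        by (subst (asm) AE_iff_measurable[of "{1<..<2}"]) auto
      then show False by simp
    qed
    moreover have "radial_moment ?h a \<ge> 0"
      unfolding radial_moment_def using nn by (intro Bochner_Integration.integral_nonneg) auto
    ultimately show ?thesis by simp
  qed
  with h show ?thesis by blast
qed

text \<open>The effect of the Laplacian, in the weak sense, on the moments \<open>m j\<close> against
  \<open>(x \<bullet> l) ^ (2 * j)\<close> over the unit sphere of a function of degree \<open>A\<close>.\<close>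

definition laplacian_step :: "nat \<Rightarrow> real \<Rightarrow> (nat \<Rightarrow> real) \<Rightarrow> nat \<Rightarrow> real"
  where "laplacian_step n A m j =
    (A - 2 * real j) * (A + 2 * real j + real n - 2) * m j + 2 * real j * (2 * real j - 1) * m (j - 1)"

fun laplacian_moments :: "nat \<Rightarrow> real \<Rightarrow> nat \<Rightarrow> (nat \<Rightarrow> real) \<Rightarrow> nat \<Rightarrow> real"
  where "laplacian_moments n q 0 m = m"
  | "laplacian_moments n q (Suc k) m = laplacian_step n (q - 2 * real k) (laplacian_moments n q k m)"

lemma has_bochner_integral_homogeneous_zonal_bump:
  fixes u :: "'a::euclidean_space \<Rightarrow> real"
  assumes hom: "\<And>x r. r > 0 \<Longrightarrow> norm x = 1 \<Longrightarrow> u (r *\<^sub>R x) = r powr q * u x"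
    and int: "integrable sphere_measure (\<lambda>x. u x * (x \<bullet> l) ^ (2 * j))"
    and h: "h \<in> profiles"
  shows "has_bochner_integral lborel (\<lambda>x. u x * zonal_bump h l j x)
     ((\<integral>x. u x * (x \<bullet> l) ^ (2 * j) \<partial>sphere_measure) * radial_moment h (q + 2 * real j + real DIM('a) - 1))"
proof -
  have "has_bochner_integral lborel (\<lambda>x. (u x * (x \<bullet> l) ^ (2 * j)) * h ((norm x)\<^sup>2))
     ((\<integral>x. u x * (x \<bullet> l) ^ (2 * j) \<partial>sphere_measure) *
       (\<integral>r. indicator {0<..} r * (r powr ((q + 2 * real j) + real DIM('a) - 1) * h (r\<^sup>2)) \<partial>lborel))"
  proof (rule has_bochner_integral_homogeneous_radial[where f="\<lambda>x. u x * (x \<bullet> l) ^ (2 * j)"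
        and a="q + 2 * real j" and h="\<lambda>r. h (r\<^sup>2)"])
    fix x :: 'a and r :: real assume r: "r > 0" and x: "norm x = 1"
    have "r ^ (2 * j) = r powr (2 * real j)" using r powr_realpow[of r "2 * j"] by simp
    then show "u (r *\<^sub>R x) * (r *\<^sub>R x \<bullet> l) ^ (2 * j) = r powr (q + 2 * real j) * (u x * (x \<bullet> l) ^ (2 * j))"
      using r by (simp add: hom[OF r x] power_mult_distrib powr_add)
  next
    show "(\<lambda>r. h (r\<^sup>2)) \<in> borel_measurable borel"
      by (intro borel_measurable_continuous_onI continuous_on_compose2[OF profiles_continuous[OF h, of UNIV]] continuous_intros) auto
  qed (use int integrable_radial_moment[OF h] in auto)
  then show ?thesis
    by (simp add: zonal_bump_def[abs_def] radial_moment_def power2_norm_eq_inner mult_ac)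
qed

text \<open>A Laplacian acting on the test function changes the profile \<open>h\<close> into
  \<open>hh\<close>. Two integrations by parts express \<open>radial_moment hh a\<close> through
  \<open>radial_moment h (a - 2)\<close>, which is also the radial factor of the term with
  \<open>j - 1\<close>. So a single radial moment of the original \<open>h\<close> factors out, and
  what is left is \<open>laplacian_step\<close>. The induction runs over all \<open>h\<close> and
  \<open>j\<close>, as its hypothesis is applied to \<open>hh\<close> and to
  \<open>j - 1\<close>.\<close>

lemma has_bochner_integral_laplacian_power_zonal_bump:
  fixes u :: "'a::euclidean_space \<Rightarrow> real"
  assumes hom: "\<And>x r. r > 0 \<Longrightarrow> norm x = 1 \<Longrightarrow> u (r *\<^sub>R x) = r powr q * u x"
    and int: "\<And>j. integrable sphere_measure (\<lambda>x. u x * (x \<bullet> l) ^ (2 * j))"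
    and l: "norm l = 1"
  shows "h \<in> profiles \<Longrightarrow> has_bochner_integral lborel (\<lambda>x. u x * (laplacian ^^ k) (zonal_bump h l j) x)
     (laplacian_moments DIM('a) q k (\<lambda>j. \<integral>x. u x * (x \<bullet> l) ^ (2 * j) \<partial>sphere_measure) j *
       radial_moment h (q - 2 * real k + 2 * real j + real DIM('a) - 1))"
proof (induction k arbitrary: h j)
  case 0
  then show ?case using has_bochner_integral_homogeneous_zonal_bump[OF hom int] by simp
next
  case (Suc k)
  let ?n = "DIM('a)"
  let ?M = "laplacian_moments ?n q k (\<lambda>j. \<integral>x. u x * (x \<bullet> l) ^ (2 * j) \<partial>sphere_measure)"
  obtain h' where h': "h' \<in> profiles" "\<And>t. (h has_real_derivative h' t) (at t)"
    using profiles_deriv Suc.prems by blast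
  obtain h'' where h'': "h'' \<in> profiles" "\<And>t. (h' has_real_derivative h'' t) (at t)"
    using profiles_deriv h' by blast
  define c where "c = 2 * real ?n + 8 * real j"
  define hh where "hh = (\<lambda>t. 4 * (t * h'' t) + c * h' t)"
  define e where "e = real (2 * j) * (real (2 * j) - 1)"
  have hh: "hh \<in> profiles" unfolding hh_def by (intro profiles.intros h' h'')
  define a where "a = q - 2 * real k + 2 * real j + real ?n - 1"
  have "radial_moment hh a = 4 * radial_moment h'' (a + 2) + c * radial_moment h' a"
    unfolding hh_def using h' h''
    by (simp add: radial_moment_add profiles.intros radial_moment_scale radial_moment_times)
  also have "4 * radial_moment h'' (a + 2) = - (2 * (a + 1)) * radial_moment h' a"
    using radial_moment_deriv[OF h'(1) h'', of "a + 1"] by (simp add: add.assoc algebra_simps)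
  also have "- (2 * (a + 1)) * radial_moment h' a + c * radial_moment h' a = (c / 2 - a - 1) * (2 * radial_moment h' a)"
    by (simp add: algebra_simps)
  also have "2 * radial_moment h' a = - (a - 1) * radial_moment h (a - 2)"
    using radial_moment_deriv[OF Suc.prems h', of "a - 1"] by simp
  finally have "radial_moment hh a = ((c / 2 - a - 1) * - (a - 1)) * radial_moment h (a - 2)"
    by (simp only: mult.assoc)
  also have "(c / 2 - a - 1) * - (a - 1) = (q - 2 * real k - 2 * real j) * (q - 2 * real k + 2 * real j + real ?n - 2)"
  proof -
    have ch: "c / 2 = real ?n + 4 * real j" by (simp add: c_def)
    show ?thesis unfolding ch a_def by (simp add: algebra_simps)
  qed
  finally have R: "radial_moment hh a = (q - 2 * real k - 2 * real j) * (q - 2 * real k + 2 * real j + real ?n - 2) * radial_moment h (a - 2)" .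
  have "(laplacian ^^ Suc k) (zonal_bump h l j) = (laplacian ^^ k) (laplacian (zonal_bump h l j))"
    by (simp add: funpow_swap1)
  also have "laplacian (zonal_bump h l j) = (\<lambda>x. zonal_bump hh l j x + e * zonal_bump h l (j - 1) x)"
    unfolding hh_def c_def e_def by (rule laplacian_zonal_bump[OF h'(2) h''(2) l])
  also have "(laplacian ^^ k) \<dots> = (\<lambda>x. (laplacian ^^ k) (zonal_bump hh l j) x + e * (laplacian ^^ k) (zonal_bump h l (j - 1)) x)"
    by (rule laplacian_power_linear) (intro zonal_bump_bumps hh Suc.prems)+
  finally have eq: "(\<lambda>x. u x * (laplacian ^^ Suc k) (zonal_bump h l j) x) =
     (\<lambda>x. u x * (laplacian ^^ k) (zonal_bump hh l j) x + e * (u x * (laplacian ^^ k) (zonal_bump h l (j - 1)) x))"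
    by (simp add: algebra_simps)
  have hb: "has_bochner_integral lborel (\<lambda>x. u x * (laplacian ^^ k) (zonal_bump hh l j) x + e * (u x * (laplacian ^^ k) (zonal_bump h l (j - 1)) x)) (?M j * radial_moment hh a +
      e * (?M (j - 1) * radial_moment h (q - 2 * real k + 2 * real (j - 1) + real ?n - 1)))"
    unfolding a_def by (intro has_bochner_integral_add has_bochner_integral_mult_right Suc.IH hh Suc.prems)
  \<comment> \<open>At \<open>j = 0\<close> the truncated index \<open>j - 1\<close> does no harm,
    since \<open>e = 0\<close>.\<close>
  have e2: "e * (?M (j - 1) * radial_moment h (q - 2 * real k + 2 * real (j - 1) + real ?n - 1)) =
      2 * real j * (2 * real j - 1) * ?M (j - 1) * radial_moment h (a - 2)"
    by (cases j) (simp_all add: e_def a_def algebra_simps)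
  have a2: "a - 2 = q - 2 * real (Suc k) + 2 * real j + real ?n - 1"
    by (simp add: a_def)
  have "m * (x * y * r) + z * m' * r = (x * y * m + z * m') * r" for m m' x y z r :: real
    by (simp add: algebra_simps)
  then have "?M j * radial_moment hh a + e * (?M (j - 1) * radial_moment h (q - 2 * real k + 2 * real (j - 1) + real ?n - 1)) =
     laplacian_step ?n (q - 2 * real k) ?M j * radial_moment h (a - 2)"
    unfolding R e2 laplacian_step_def .
  then show ?case using hb unfolding eq a2 laplacian_moments.simps by simp
qed

section \<open>Constants and uniqueness\<close>

lemma half_shift_notin_Ints:
  fixes q :: real
  assumes "q \<notin> \<int>"
  shows "(of_int m + q) / 2 \<notin> \<int>" "(of_int m - q) / 2 \<notin> \<int>"
proof -
  show "(of_int m + q) / 2 \<notin> \<int>"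
  proof
    assume "(of_int m + q) / 2 \<in> \<int>"
    then obtain i where "(of_int m + q) / 2 = of_int i" by (auto elim: Ints_cases)
    then have "q = of_int (2 * i - m)" by simp
    then show False using assms Ints_of_int by metis
  qed
  show "(of_int m - q) / 2 \<notin> \<int>"
  proof
    assume "(of_int m - q) / 2 \<in> \<int>"
    then obtain i where "(of_int m - q) / 2 = of_int i" by (auto elim: Ints_cases)
    then have "q = of_int (m - 2 * i)" by simp
    then show False using assms Ints_of_int by metis
  qed
qed

lemma diff_even_notin_Ints: "q \<notin> \<int> \<Longrightarrow> q - 2 * real k \<notin> \<int>"
  using Ints_add[of "q - 2 * real k" "2 * real k"] by auto

text \<open>With \<open>a = (n + A - 2) / 2\<close> the diagonal factor
  \<open>A + 2 * j + n - 2\<close> is \<open>2 * (a + j)\<close>, which turns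
  \<open>1 / pochhammer (a + 1) j\<close> into a multiple of \<open>1 / pochhammer a j\<close>; in
  the neighbour term the factor \<open>j\<close> does the same by completing
  \<open>fact (j - 1)\<close>. Both terms then share the factor
  \<open>2 * a * (fact j / pochhammer a j)\<close>, and \<open>moment_series_rec\<close>
  applies.\<close>

lemma laplacian_step_moment_series:
  assumes A: "A \<notin> \<int>"
  shows "laplacian_step n A (\<lambda>j. fact j / pochhammer ((real n + A) / 2) j * moment_series A \<tau> $$ j) j =
    A * (real n + A - 2) * (fact j / pochhammer ((real n + (A - 2)) / 2) j * moment_series (A - 2) \<tau> $$ j)"
proof -
  define a where "a = (real n + (A - 2)) / 2"
  have a1: "(real n + A) / 2 = a + 1" unfolding a_def by (simp add: add_divide_distrib diff_divide_distrib)
  have an: "a = (of_int (int n - 2) + A) / 2" by (simp add: a_def)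
  have aZ: "a \<notin> \<int>" unfolding an by (rule half_shift_notin_Ints[OF A])
  have aj: "a + real i \<noteq> 0" for i
  proof
    assume "a + real i = 0"
    then have "a = of_int (- int i)" by simp
    then show False using aZ Ints_of_int by metis
  qed
  have p: "pochhammer a i \<noteq> 0" for i
    using aj by (auto simp: pochhammer_eq_0_iff) (metis add.left_inverse)
  have p1: "pochhammer (a + 1) i = (a + real i) * pochhammer a i / a" for i
    using pochhammer_rec[of a i] pochhammer_rec'[of a i] aj[of 0] by (simp add: field_simps)
  have "laplacian_step n A (\<lambda>j. fact j / pochhammer (a + 1) j * moment_series A \<tau> $$ j) j =
     2 * a * (fact j / pochhammer a j) * ((A - 2 * real j) * moment_series A \<tau> $$ j +
       (if j = 0 then 0 else (2 * real j - 1) * moment_series A \<tau> $$ (j - 1)))"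
  proof -
    have 1: "(A - 2 * real j) * (A + 2 * real j + real n - 2) * (fact j / pochhammer (a + 1) j * moment_series A \<tau> $$ j)
       = 2 * a * (fact j / pochhammer a j) * ((A - 2 * real j) * moment_series A \<tau> $$ j)"
    proof -
      have e: "A + 2 * real j + real n - 2 = 2 * (a + real j)" by (simp add: a_def)
      have h: "(a + real j) * (fact j / pochhammer (a + 1) j) = a * (fact j / pochhammer a j)"
        unfolding p1 using aj[of j] aj[of 0] p[of j] by simp
      have "(A - 2 * real j) * (2 * (a + real j)) * (fact j / pochhammer (a + 1) j * moment_series A \<tau> $$ j) =
          2 * ((a + real j) * (fact j / pochhammer (a + 1) j)) * ((A - 2 * real j) * moment_series A \<tau> $$ j)"
        by (simp only: mult_ac)
      then show ?thesis unfolding e h by (simp only: mult.assoc)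
    qed
    have 2: "2 * real j * (2 * real j - 1) * (fact (j - 1) / pochhammer (a + 1) (j - 1) * moment_series A \<tau> $$ (j - 1))
       = 2 * a * (fact j / pochhammer a j) * (if j = 0 then 0 else (2 * real j - 1) * moment_series A \<tau> $$ (j - 1))"
    proof (cases j)
      case (Suc i)
      have h: "real (Suc i) * (fact i / pochhammer (a + 1) i) = a * (fact (Suc i) / pochhammer a (Suc i))"
        using aj[of 0] p[of "Suc i"] by (simp add: pochhammer_rec)
      have "2 * real (Suc i) * (2 * real (Suc i) - 1) * (fact i / pochhammer (a + 1) i * moment_series A \<tau> $$ i) =
          2 * (real (Suc i) * (fact i / pochhammer (a + 1) i)) * ((2 * real (Suc i) - 1) * moment_series A \<tau> $$ i)"
        by (simp only: mult_ac)
      then show ?thesis unfolding h by (simp add: Suc mult.assoc del: of_nat_Suc fact_Suc)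
    qed simp
    show ?thesis unfolding laplacian_step_def 1 2 by (simp add: distrib_left)
  qed
  also have "\<dots> = 2 * a * (fact j / pochhammer a j) * (A * moment_series (A - 2) \<tau> $$ j)"
    by (subst moment_series_rec) (rule refl)
  also have "2 * a = real n + A - 2" by (simp add: a_def)
  finally show ?thesis unfolding a1 a_def[symmetric] by (simp only: mult_ac)
qed

text \<open>The factor of one step is \<open>A * (A - 1)\<close>, as in the Laplacian of
  \<open>\<bar>x \<bullet> \<xi>\<bar> powr A\<close>, times the quotient of
  \<open>sphere_moment n (A - 2)\<close> by \<open>sphere_moment n A\<close>, which is
  \<open>(n + A - 2) / (A - 1)\<close>.\<close>

definition laplacian_factor :: "nat \<Rightarrow> real \<Rightarrow> nat \<Rightarrow> real"
  where "laplacian_factor n q k = (\<Prod>i<k. (q - 2 * real i) * (real n + q - 2 * real i - 2))"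

lemma laplacian_step_scale: "laplacian_step n A (\<lambda>j. c * m j) j = c * laplacian_step n A m j"
  by (simp add: laplacian_step_def algebra_simps)

lemma laplacian_moments_moment_series:
  assumes q: "q \<notin> \<int>"
  shows "laplacian_moments n q k (\<lambda>j. fact j / pochhammer ((real n + q) / 2) j * moment_series q \<tau> $$ j) =
    (\<lambda>j. laplacian_factor n q k *
      (fact j / pochhammer ((real n + (q - 2 * real k)) / 2) j * moment_series (q - 2 * real k) \<tau> $$ j))"
proof (induction k)
  case 0
  show ?case by (simp add: laplacian_factor_def)
next
  case (Suc k)
  have e: "q - 2 * real k - 2 = q - 2 * real (Suc k)" by simp
  have f: "laplacian_factor n q (Suc k) = laplacian_factor n q k * ((q - 2 * real k) * (real n + (q - 2 * real k) - 2))"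
    unfolding laplacian_factor_def prod.lessThan_Suc by (simp add: add_diff_eq)
  show ?case
    unfolding laplacian_moments.simps Suc.IH
  proof
    fix j
    show "laplacian_step n (q - 2 * real k) (\<lambda>j. laplacian_factor n q k *
        (fact j / pochhammer ((real n + (q - 2 * real k)) / 2) j * moment_series (q - 2 * real k) \<tau> $$ j)) j =
      laplacian_factor n q (Suc k) * (fact j / pochhammer ((real n + (q - 2 * real (Suc k))) / 2) j *
        moment_series (q - 2 * real (Suc k)) \<tau> $$ j)"
      unfolding laplacian_step_scale laplacian_step_moment_series[OF diff_even_notin_Ints[OF q]] e
      by (simp only: f mult.assoc)
  qed
qed

lemma laplacian_moments_scale:
  "laplacian_moments n q k (\<lambda>j. c * m j) = (\<lambda>j. c * laplacian_moments n q k m j)"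
  by (induction k) (simp_all add: laplacian_step_scale)

text \<open>The recursion is linear with coefficients free of \<open>x\<close>, so it may be applied
  to the kernel before \<open>b\<close> is integrated against it.\<close>

lemma laplacian_moments_integral:
  assumes "\<And>j. integrable M (\<lambda>x. b x * f x j)"
  shows "integrable M (\<lambda>x. b x * laplacian_moments n q k (f x) j) \<and>
    laplacian_moments n q k (\<lambda>j. \<integral>x. b x * f x j \<partial>M) j = (\<integral>x. b x * laplacian_moments n q k (f x) j \<partial>M)"
proof (induction k arbitrary: j)
  case (Suc k)
  let ?A = "q - 2 * real k"
  have eq: "b x * laplacian_moments n q (Suc k) (f x) j =
      (?A - 2 * real j) * (?A + 2 * real j + real n - 2) * (b x * laplacian_moments n q k (f x) j) +
      2 * real j * (2 * real j - 1) * (b x * laplacian_moments n q k (f x) (j - 1))" for x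
    by (simp add: laplacian_step_def algebra_simps)
  have i: "integrable M (\<lambda>x. b x * laplacian_moments n q k (f x) i)"
    and e: "laplacian_moments n q k (\<lambda>j. \<integral>x. b x * f x j \<partial>M) i = (\<integral>x. b x * laplacian_moments n q k (f x) i \<partial>M)" for i
    using Suc.IH[of i] by auto
  show ?case
    unfolding eq using i
    by (simp add: laplacian_step_def e)
qed (use assms in simp)

lemma laplacian_step_inj:
  assumes A: "A \<notin> \<int>" and eq: "laplacian_step n A m = laplacian_step n A m'"
  shows "m = m'"
proof
  fix j
  have c: "(A - 2 * real j) * (A + 2 * real j + real n - 2) \<noteq> 0" for j
  proof -
    have "A \<noteq> of_int (2 * int j)" "A \<noteq> of_int (2 - 2 * int j - int n)" using A Ints_of_int by metis+
    then show ?thesis by auto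
  qed
  show "m j = m' j"
  proof (induction j)
    case 0
    show ?case using fun_cong[OF eq, of 0] c[of 0] by (simp add: laplacian_step_def)
  next
    case (Suc j)
    show ?case using fun_cong[OF eq, of "Suc j"] c[of "Suc j"] by (simp add: laplacian_step_def Suc)
  qed
qed

lemma laplacian_moments_inj:
  assumes q: "q \<notin> \<int>"
  shows "laplacian_moments n q k m = laplacian_moments n q k m' \<Longrightarrow> m = m'"
  by (induction k) (auto dest: laplacian_step_inj[OF diff_even_notin_Ints[OF q]])

text \<open>The factor with index \<open>i\<close> is \<open>- 4 * y * z\<close> for
  \<open>y = i - q / 2\<close> and \<open>z = (n + q) / 2 - i - 1\<close>, so the product telescopes
  into two Gamma quotients; as \<open>q\<close> is not an integer, no argument is a pole.\<close>

lemma laplacian_factor_Gamma: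
  assumes q: "q \<notin> \<int>"
  shows "laplacian_factor n q k = (- 4) ^ k * (Gamma (real k - q / 2) / Gamma (- q / 2)) *
    (Gamma ((real n + q) / 2) / Gamma ((real n + q) / 2 - real k))"
proof (induction k)
  case 0
  have "- q / 2 \<notin> \<int>" "(real n + q) / 2 \<notin> \<int>"
    using half_shift_notin_Ints(2)[OF q, of 0] half_shift_notin_Ints(1)[OF q, of "int n"] by auto
  then have "Gamma (- q / 2) \<noteq> 0" "Gamma ((real n + q) / 2) \<noteq> 0"
    by (auto simp: Gamma_eq_zero_iff dest: nonpos_Ints_Int)
  then show ?case by (simp add: laplacian_factor_def)
next
  case (Suc k)
  define y where "y = real k - q / 2"
  define z where "z = (real n + q) / 2 - real k - 1"
  have y: "y \<notin> \<int>" using half_shift_notin_Ints(2)[OF q, of "2 * int k"] by (simp add: y_def diff_divide_distrib)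
  have z: "z \<notin> \<int>"
    using half_shift_notin_Ints(1)[OF q, of "int n - 2 * int k - 2"] by (simp add: z_def field_simps)
  have y1: "Gamma (y + 1) = y * Gamma y" using y by (intro Gamma_plus1) (auto dest: nonpos_Ints_Int)
  have z1: "Gamma (z + 1) = z * Gamma z" using z by (intro Gamma_plus1) (auto dest: nonpos_Ints_Int)
  have z0: "z \<noteq> 0" "Gamma z \<noteq> 0" using z by (auto simp: Gamma_eq_zero_iff dest: nonpos_Ints_Int)
  have f: "(q - 2 * real k) * (real n + q - 2 * real k - 2) = (- 4) * (y * z)"
    by (simp add: y_def z_def field_simps)
  have e: "real (Suc k) - q / 2 = y + 1" "(real n + q) / 2 - real (Suc k) = z"
    "real k - q / 2 = y" "(real n + q) / 2 - real k = z + 1" by (auto simp: y_def z_def)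
  have "laplacian_factor n q (Suc k) = laplacian_factor n q k * ((- 4) * (y * z))"
    unfolding laplacian_factor_def prod.lessThan_Suc f ..
  also have "\<dots> = (- 4) ^ Suc k * (Gamma (y + 1) / Gamma (- q / 2)) * (Gamma ((real n + q) / 2) / Gamma z)"
    unfolding Suc.IH e y1 z1 using z0 by (simp add: field_simps)
  finally show ?case unfolding e .
qed

text \<open>By the choice of \<open>p\<close>, \<open>k - q / 2 = (n + p) / 2\<close> and
  \<open>(n + q) / 2 - k = - p / 2\<close>. Hence two Gamma values of
  \<open>laplacian_factor\<close> cancel the denominators of the sphere moments, and the other two
  are the denominators of \<open>C_const p\<close> and \<open>C_const q\<close>. The powers of 2
  collect to \<open>2 * 4 ^ k\<close>, and \<open>(-1) ^ k\<close> absorbs the sign of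
  \<open>(- 4) ^ k\<close>.\<close>

lemma blaschke_levy_constant:
  fixes p q :: real and n k :: nat
  assumes n: "n \<ge> 1" and q: "q > -1" "q \<notin> \<int>" and p: "p = - real n - q + 2 * real k" "p > -1"
  shows "(-1) ^ k * (pi / (2 * (2 * pi) ^ (n - 1) * C_const p * C_const q)) *
     (sphere_moment n q * laplacian_factor n q k * sphere_moment n p) = 1"
proof -
  have pZ: "p \<notin> \<int>"
  proof
    assume "p \<in> \<int>"
    then obtain i where "p = of_int i" by (auto elim: Ints_cases)
    then have "q = of_int (2 * int k - int n - i)" using p by simp
    then show False using q Ints_of_int by metis
  qed
  have nz: "Gamma (- q / 2) \<noteq> 0" "Gamma (- p / 2) \<noteq> 0"
    using half_shift_notin_Ints(2)[OF q(2), of 0] half_shift_notin_Ints(2)[OF pZ, of 0]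
    by (auto simp: Gamma_eq_zero_iff dest: nonpos_Ints_Int)
  have pos: "Gamma ((q + 1) / 2) > 0" "Gamma ((p + 1) / 2) > 0"
    "Gamma ((real n + q) / 2) > 0" "Gamma ((real n + p) / 2) > 0"
    using n q p by (auto intro!: Gamma_real_pos)
  have e1: "real k - q / 2 = (real n + p) / 2" and e2: "(real n + q) / 2 - real k = - p / 2"
    using p by (auto simp: field_simps)
  define P where "P = pi powr ((real n - 1) / 2)"
  have P: "P * P = pi ^ (n - 1)"
  proof -
    have "P * P = pi powr (real (n - 1))"
      unfolding P_def using n by (simp flip: powr_add add: of_nat_diff)
    then show ?thesis by (simp add: powr_realpow)
  qed
  have pw: "2 powr (p + 1) * 2 powr (q + 1) * 2 ^ (n - 1) = 2 * 4 ^ k"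
  proof -
    have "2 powr (p + 1) * 2 powr (q + 1) * 2 powr (real (n - 1)) = 2 powr (1 + 2 * real k)"
      using n by (simp flip: powr_add add: of_nat_diff p add.commute)
    moreover have "(2::real) powr (2 * real k) = 4 ^ k"
      by (simp add: powr_powr[symmetric] powr_realpow)
    ultimately show ?thesis by (simp add: powr_add powr_realpow)
  qed
  have m: "(-1) ^ k * (- 4) ^ k = (4 :: real) ^ k" by (simp flip: power_mult_distrib)
  have CC: "C_const p * C_const q = 2 powr (p + 1) * 2 powr (q + 1) * pi * (Gamma ((p + 1) / 2) * Gamma ((q + 1) / 2)) / (Gamma (- p / 2) * Gamma (- q / 2))"
    by (simp add: C_const_def)
  have D: "2 * (2 * pi) ^ (n - 1) * (C_const p * C_const q) =
     4 * 4 ^ k * pi ^ (n - 1) * pi * (Gamma ((p + 1) / 2) * Gamma ((q + 1) / 2)) / (Gamma (- p / 2) * Gamma (- q / 2))"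
    unfolding CC power_mult_distrib
    using pw by (simp add: mult_ac)
  have S: "sphere_moment n q * laplacian_factor n q k * sphere_moment n p =
     4 * (- 4) ^ k * (P * P) * (Gamma ((p + 1) / 2) * Gamma ((q + 1) / 2)) / (Gamma (- p / 2) * Gamma (- q / 2))"
    unfolding sphere_moment_def laplacian_factor_Gamma[OF q(2)] e1 e2 P_def[symmetric]
    using pos by (simp add: field_simps)
  have "(-1) ^ k * (pi / (2 * (2 * pi) ^ (n - 1) * C_const p * C_const q)) *
     (sphere_moment n q * laplacian_factor n q k * sphere_moment n p) =
     pi * (((-1) ^ k * (- 4) ^ k) * 4 * (P * P) * (Gamma ((p + 1) / 2) * Gamma ((q + 1) / 2)) / (Gamma (- p / 2) * Gamma (- q / 2)))
       / (2 * (2 * pi) ^ (n - 1) * (C_const p * C_const q))"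
    unfolding S by (simp add: mult_ac)
  also have "\<dots> = 1"
    unfolding m D P using pos nz by simp
  finally show ?thesis .
qed

section \<open>Even moments determine an even continuous function on the sphere\<close>

lemma measure_sphere_cap_pos:
  fixes l :: "'a::euclidean_space"
  assumes l: "norm l = 1" and c: "0 \<le> c" "c < 1"
  shows "measure sphere_measure {x \<in> sphere 0 1. (x \<bullet> l)\<^sup>2 > c} > 0"
proof -
  let ?A = "{x \<in> sphere 0 1. (x \<bullet> l)\<^sup>2 > c}"
  \<comment> \<open>The cone over the caps, written homogeneously so that it is visibly open. The
    strict inequality excludes the origin, and \<open>l /\<^sub>R 2\<close> shows that the set is
    not empty.\<close>
  let ?U = "{x \<in> ball 0 1. (x \<bullet> l)\<^sup>2 > c * (x \<bullet> x)}"
  let ?E = "{x \<in> ball 0 1 - {0}. x /\<^sub>R norm x \<in> ?A}"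
  have U: "?U = ball 0 1 \<inter> {x. c * (x \<bullet> x) < (x \<bullet> l)\<^sup>2}" by auto
  have "open ?U" unfolding U by (intro open_Int open_Collect_less continuous_intros) auto
  moreover have "l /\<^sub>R 2 \<in> ?U"
    using l c by (simp add: power2_eq_square flip: norm_eq_1[unfolded norm_eq_1]) (simp add: norm_eq_1)
  ultimately have "\<not> negligible ?U" using open_not_negligible by blast
  then have U0: "emeasure lborel ?U \<noteq> 0"
    using \<open>open ?U\<close> by (simp add: negligible_iff_null_sets null_sets_completion_iff null_sets_def)
  have "?A \<in> sets (restrict_space borel (sphere 0 1))"
    by (auto simp: sets_restrict_space_iff)
  then have A: "?A \<in> sets sphere_measure" by (simp add: sets_sphere_measure)
  have sub: "?U \<subseteq> ?E"
  proof
    fix x assume x: "x \<in> ?U"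
    then have x0: "x \<noteq> 0" by auto
    have "((x /\<^sub>R norm x) \<bullet> l)\<^sup>2 = (x \<bullet> l)\<^sup>2 / (x \<bullet> x)"
      by (simp add: power_mult_distrib power2_norm_eq_inner field_simps)
    also have "\<dots> > c" using x x0 by (simp add: pos_less_divide_eq)
    finally show "x \<in> ?E" using x x0 by simp
  qed
  have "emeasure lborel ?U \<le> emeasure lborel ?E"
  proof (rule emeasure_mono[OF sub])
    have "?E = {x \<in> ball 0 1 - {0}. ((x /\<^sub>R norm x) \<bullet> l)\<^sup>2 > c}"
      by auto
    also have "\<dots> \<in> sets lborel" by measurable
    finally show "?E \<in> sets lborel" .
  qed
  then have "emeasure lborel ?E \<noteq> 0" using U0 by auto
  then have "emeasure sphere_measure ?A \<noteq> 0"
    unfolding emeasure_sphere_measure[OF A] by simp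
  then show ?thesis
    using sphere.emeasure_eq_measure[of ?A] by (metis ennreal_0 measure_nonneg order_le_less)
qed

lemma continuous_on_sphere_bounded:
  fixes f :: "'a::euclidean_space \<Rightarrow> real"
  assumes "continuous_on (sphere 0 1) f"
  obtains M where "\<And>x. norm x = 1 \<Longrightarrow> \<bar>f x\<bar> \<le> M"
proof -
  have "compact (sphere (0::'a) 1)" by simp
  then obtain M where "\<forall>y\<in>f ` sphere 0 1. norm y \<le> M"
    using compact_imp_bounded[OF compact_continuous_image[OF assms]] unfolding bounded_iff by blast
  then show ?thesis using that[of M] by auto
qed

lemma integrable_continuous_on_sphere:
  fixes f :: "'a::euclidean_space \<Rightarrow> real"
  assumes f: "continuous_on (sphere 0 1) f"
  shows "integrable sphere_measure f"
proof -
  obtain M where "\<And>x. norm x = 1 \<Longrightarrow> \<bar>f x\<bar> \<le> M" using continuous_on_sphere_bounded[OF f] by blast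
  then show ?thesis
    using borel_measurable_continuous_on_restrict[OF f]
    by (intro sphere.integrable_const_bound[of _ M])
       (auto simp: measurable_cong_sets[OF sets_sphere_measure refl])
qed

text \<open>The weight \<open>(x \<bullet> l) ^ (2 * j)\<close> concentrates at \<open>l\<close> and
  \<open>- l\<close> as \<open>j\<close> grows, so a positive \<open>w l\<close> would force a
  positive moment. The conclusion is one-sided; applied to \<open>w\<close> and to its negative it
  gives \<open>w l = 0\<close>.\<close>

lemma even_continuous_nonpos_of_moments:
  fixes w :: "'a::euclidean_space \<Rightarrow> real"
  assumes cont: "continuous_on (sphere 0 1) w"
    and even: "\<And>x. norm x = 1 \<Longrightarrow> w (- x) = w x"
    and int: "\<And>l j. norm l = 1 \<Longrightarrow> (\<integral>x. w x * (x \<bullet> l) ^ (2 * j) \<partial>sphere_measure) = 0"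
    and l: "norm l = 1"
  shows "w l \<le> 0"
proof (rule ccontr)
  let ?S = "sphere_measure :: 'a measure"
  assume "\<not> w l \<le> 0"
  then have wl: "w l > 0" by simp
  obtain d where d: "d > 0" "\<And>x. norm x = 1 \<Longrightarrow> dist x l < d \<Longrightarrow> dist (w x) (w l) < w l / 2"
    using cont[unfolded continuous_on_iff, rule_format, of l "w l / 2"] l wl by auto
  define e where "e = min d 1"
  have e: "0 < e" "e \<le> 1" "e \<le> d" using d(1) by (auto simp: e_def)
  \<comment> \<open>As \<open>(dist x l)\<^sup>2 = 2 - 2 * (x \<bullet> l)\<close> on the sphere,
    \<open>(x \<bullet> l)\<^sup>2 > c\<close> means that \<open>x\<close> is within
    \<open>e\<close> of \<open>l\<close> or of \<open>- l\<close>; \<open>e \<le> 1\<close> keeps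
    \<open>1 - e\<^sup>2 / 2\<close> positive, so that squares can be compared.\<close>
  define c where "c = (1 - e\<^sup>2 / 2)\<^sup>2"
  have e2: "0 < e\<^sup>2" "e\<^sup>2 \<le> 1" using e by (auto simp: power_le_one)
  have c: "0 < c" "c < 1"
    using e2 by (auto simp: c_def abs_square_less_1)
  have near: "w x \<ge> w l / 2" if x: "norm x = 1" "(x \<bullet> l)\<^sup>2 > c" for x
  proof -
    have n: "(dist y l)\<^sup>2 = 2 - 2 * (y \<bullet> l)" if "norm y = 1" for y
      using that l unfolding dist_norm power2_norm_eq_inner
      by (simp add: inner_diff inner_commute norm_eq_1)
    have g: "w y \<ge> w l / 2" if y: "norm y = 1" "(y \<bullet> l)\<^sup>2 > c" "y \<bullet> l \<ge> 0" for y
    proof -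
      have "y \<bullet> l > 1 - e\<^sup>2 / 2" using y(2,3) unfolding c_def by (rule power2_less_imp_less)
      then have "(dist y l)\<^sup>2 < e\<^sup>2" unfolding n[OF y(1)] by simp
      then have "dist y l < d" using e by (meson less_le_trans less_imp_le power2_less_imp_less)
      then have "dist (w y) (w l) < w l / 2" using d(2) y(1) by blast
      then show ?thesis using wl unfolding dist_real_def by linarith
    qed
    show ?thesis
    proof (cases "x \<bullet> l \<ge> 0")
      case False
      then have "w (- x) \<ge> w l / 2" using x by (intro g) auto
      then show ?thesis using even x by simp
    qed (use g x in auto)
  qed
  obtain M where M: "\<And>x. norm x = 1 \<Longrightarrow> \<bar>w x\<bar> \<le> M"
    using continuous_on_sphere_bounded[OF cont] by blast
  have M0: "M \<ge> 0" using M[OF l] by linarith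
  \<comment> \<open>A strictly higher level is needed: where
    \<open>(x \<bullet> l)\<^sup>2 \<le> c\<close> the weight is at most \<open>c ^ j\<close>, on
    the smaller caps \<open>A\<close> at least \<open>c' ^ j\<close>, and the quotient
    \<open>(c / c') ^ j\<close> tends to 0.\<close>
  define c' where "c' = (1 + c) / 2"
  have c': "0 < c'" "c < c'" "c' < 1" using c by (auto simp: c'_def)
  define A where "A = {x \<in> sphere 0 1. (x \<bullet> l)\<^sup>2 > c'}"
  have mA: "measure ?S A > 0"
    unfolding A_def using measure_sphere_cap_pos[OF l] c' by simp
  define S where "S = measure ?S (sphere 0 1 :: 'a set)"
  have As: "A \<in> sets ?S"
    unfolding A_def by (auto simp: sets_sphere_measure sets_restrict_space_iff)
  have AS: "A \<inter> sphere 0 1 = A" by (auto simp: A_def)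
  have bnd: "w l / 2 * measure ?S A \<le> M * S * (c / c') ^ j" for j
  proof -
    have i: "integrable ?S (\<lambda>x. w x * (x \<bullet> l) ^ (2 * j))"
      by (intro integrable_continuous_on_sphere continuous_intros cont)
    have "(\<integral>x. w l / 2 * c' ^ j * indicator A x - M * c ^ j \<partial>?S) \<le> (\<integral>x. w x * (x \<bullet> l) ^ (2 * j) \<partial>?S)"
    proof (rule integral_mono[OF _ i])
      show "integrable ?S (\<lambda>x. w l / 2 * c' ^ j * indicator A x - M * c ^ j)"
        using As by (intro Bochner_Integration.integrable_diff integrable_mult_right sphere.integrable_const)
           (auto simp: sphere.emeasure_eq_measure)
      fix x :: 'a assume "x \<in> space ?S"
      then have x: "norm x = 1" by simp
      show "w l / 2 * c' ^ j * indicator A x - M * c ^ j \<le> w x * (x \<bullet> l) ^ (2 * j)"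
      proof (cases "(x \<bullet> l)\<^sup>2 > c")
        case True
        have w2: "w x \<ge> w l / 2" using near[OF x True] .
        have "w l / 2 * c' ^ j * indicator A x \<le> w x * ((x \<bullet> l)\<^sup>2) ^ j"
        proof (cases "x \<in> A")
          case True
          then have "c' ^ j \<le> ((x \<bullet> l)\<^sup>2) ^ j" using c' by (intro power_mono) (auto simp: A_def)
          then have "w l / 2 * c' ^ j \<le> w x * ((x \<bullet> l)\<^sup>2) ^ j" using w2 wl c' by (intro mult_mono) auto
          then show ?thesis using True by simp
        qed (use w2 wl in auto)
        moreover have "M * c ^ j \<ge> 0" using M0 c by simp
        ultimately show ?thesis unfolding power_mult by linarith
      next
        case False
        then have "x \<notin> A" using c' by (auto simp: A_def)
        have "((x \<bullet> l)\<^sup>2) ^ j \<le> c ^ j" using False by (intro power_mono) auto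
        then have "\<bar>w x * ((x \<bullet> l)\<^sup>2) ^ j\<bar> \<le> M * c ^ j"
          unfolding abs_mult using M[OF x] M0 by (intro mult_mono) (auto simp: power_abs)
        then show ?thesis using \<open>x \<notin> A\<close> unfolding power_mult by simp
      qed
    qed
    also have "\<dots> = 0" by (rule int[OF l])
    also have "(\<integral>x. w l / 2 * c' ^ j * indicator A x - M * c ^ j \<partial>?S) =
      w l / 2 * c' ^ j * measure ?S A - M * c ^ j * S"
      using As by (subst Bochner_Integration.integral_diff) (auto simp: S_def sphere.emeasure_eq_measure AS)
    finally have "w l / 2 * measure ?S A * c' ^ j \<le> M * S * c ^ j" by (simp add: mult_ac)
    then show ?thesis using c' by (simp add: power_divide field_simps)
  qed
  have "(\<lambda>j. M * S * (c / c') ^ j) \<longlonglongrightarrow> M * S * 0"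
    using c c' by (intro tendsto_intros LIMSEQ_power_zero) auto
  from LIMSEQ_le_const[OF this, of "w l / 2 * measure ?S A"] bnd
  have "w l / 2 * measure ?S A \<le> 0" by auto
  then show False using wl mA by (simp add: mult_le_0_iff)
qed

section \<open>The Blaschke-Levy representation\<close>

lemma borel_measurable_sphere_pairI:
  fixes f :: "'a::euclidean_space \<times> 'a \<Rightarrow> 'b::topological_space"
  assumes "f \<in> borel_measurable (borel \<Otimes>\<^sub>M borel)"
  shows "f \<in> borel_measurable (sphere_measure \<Otimes>\<^sub>M sphere_measure)"
proof -
  have "(\<lambda>z. (fst z, snd z)) \<in> sphere_measure \<Otimes>\<^sub>M sphere_measure \<rightarrow>\<^sub>M (borel :: 'a measure) \<Otimes>\<^sub>M (borel :: 'a measure)"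
    by (intro measurable_Pair measurable_compose[OF measurable_fst measurable_ident_sphere]
        measurable_compose[OF measurable_snd measurable_ident_sphere])
  from measurable_compose[OF this assms] show ?thesis by simp
qed

lemma pair_sigma_finite_sphere:
  "pair_sigma_finite (sphere_measure :: 'a::euclidean_space measure) (sphere_measure :: 'a measure)"
  by (simp add: pair_sigma_finite_def sphere.sigma_finite_measure_axioms)

text \<open>For \<open>p < 0\<close> the kernel is unbounded. Integrability on the product holds
  because its integral over \<open>\<xi>\<close> has the same finite value for every
  \<open>\<theta>\<close>.\<close>

lemma sphere_kernel_integrable:
  fixes g :: "real ^ 'n \<Rightarrow> real"
  assumes p: "p > -1" and g: "integrable sphere_measure g"
  shows "integrable (sphere_measure \<Otimes>\<^sub>M sphere_measure) (\<lambda>(\<theta>, \<xi>). \<bar>\<theta> \<bullet> \<xi>\<bar> powr p * g \<theta>)"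
proof (rule pair_sigma_finite.Fubini_integrable[OF pair_sigma_finite_sphere])
  let ?S = "sphere_measure :: (real ^ 'n) measure"
  have [measurable]: "g \<in> borel_measurable ?S" using g by auto
  have "(\<lambda>z :: (real ^ 'n) \<times> (real ^ 'n). \<bar>fst z \<bullet> snd z\<bar> powr p) \<in> borel_measurable (?S \<Otimes>\<^sub>M ?S)"
    by (rule borel_measurable_sphere_pairI) measurable
  moreover have "(\<lambda>z :: (real ^ 'n) \<times> (real ^ 'n). g (fst z)) \<in> borel_measurable (?S \<Otimes>\<^sub>M ?S)"
    by measurable
  ultimately show "(\<lambda>(\<theta>, \<xi>). \<bar>\<theta> \<bullet> \<xi>\<bar> powr p * g \<theta>) \<in> borel_measurable (?S \<Otimes>\<^sub>M ?S)"
    unfolding case_prod_beta' by (rule borel_measurable_times)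
  have h: "has_bochner_integral ?S (\<lambda>\<xi>. \<bar>\<theta> \<bullet> \<xi>\<bar> powr p) (sphere_moment CARD('n) p)"
    if "\<theta> \<in> space ?S" for \<theta> :: "real ^ 'n"
    using has_bochner_integral_sphere_abs_inner_powr[OF p, of \<theta>] that by (simp add: inner_commute)
  have "integrable ?S (\<lambda>\<theta>. sphere_moment CARD('n) p * \<bar>g \<theta>\<bar>)" using g by auto
  then show "integrable ?S (\<lambda>\<theta>. \<integral>\<xi>. norm (case (\<theta>, \<xi>) of (\<theta>, \<xi>) \<Rightarrow> \<bar>\<theta> \<bullet> \<xi>\<bar> powr p * g \<theta>) \<partial>?S)"
  proof (rule Bochner_Integration.integrable_cong[THEN iffD1, OF refl, rotated])
    fix \<theta> :: "real ^ 'n" assume "\<theta> \<in> space ?S"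
    from h[OF this] show "sphere_moment CARD('n) p * \<bar>g \<theta>\<bar> =
        (\<integral>\<xi>. norm (case (\<theta>, \<xi>) of (\<theta>, \<xi>) \<Rightarrow> \<bar>\<theta> \<bullet> \<xi>\<bar> powr p * g \<theta>) \<partial>?S)"
      by (simp add: abs_mult has_bochner_integral_iff)
  qed
  show "AE \<theta> in ?S. integrable ?S (\<lambda>\<xi>. case (\<theta>, \<xi>) of (\<theta>, \<xi>) \<Rightarrow> \<bar>\<theta> \<bullet> \<xi>\<bar> powr p * g \<theta>)"
  proof (rule AE_I2)
    fix \<theta> :: "real ^ 'n" assume "\<theta> \<in> space ?S"
    from h[OF this] show "integrable ?S (\<lambda>\<xi>. case (\<theta>, \<xi>) of (\<theta>, \<xi>) \<Rightarrow> \<bar>\<theta> \<bullet> \<xi>\<bar> powr p * g \<theta>)"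
      by (simp add: has_bochner_integral_iff)
  qed
qed

text \<open>Serves for the moments of the potential of \<open>b\<close>, for the dual moments of
  \<open>g\<close>, and with \<open>m = 1\<close> for the L1 estimate.\<close>

lemma sphere_kernel_Fubini:
  fixes g m :: "real ^ 'n \<Rightarrow> real"
  assumes p: "p > -1" and g: "integrable sphere_measure g"
    and m: "m \<in> borel_measurable sphere_measure" and D: "\<And>\<xi>. norm \<xi> = 1 \<Longrightarrow> \<bar>m \<xi>\<bar> \<le> D"
  shows "(\<integral>\<xi>. (\<integral>\<theta>. \<bar>\<theta> \<bullet> \<xi>\<bar> powr p * g \<theta> \<partial>sphere_measure) * m \<xi> \<partial>sphere_measure) =
    (\<integral>\<theta>. g \<theta> * (\<integral>\<xi>. \<bar>\<theta> \<bullet> \<xi>\<bar> powr p * m \<xi> \<partial>sphere_measure) \<partial>sphere_measure)"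
proof -
  let ?S = "sphere_measure :: (real ^ 'n) measure"
  have P: "integrable (?S \<Otimes>\<^sub>M ?S) (\<lambda>(\<theta>, \<xi>). \<bar>\<theta> \<bullet> \<xi>\<bar> powr p * g \<theta>)"
    by (rule sphere_kernel_integrable[OF p g])
  have "integrable (?S \<Otimes>\<^sub>M ?S) (\<lambda>(\<theta>, \<xi>). (\<bar>\<theta> \<bullet> \<xi>\<bar> powr p * g \<theta>) * m \<xi>)"
  proof (rule Bochner_Integration.integrable_bound)
    show "integrable (?S \<Otimes>\<^sub>M ?S) (\<lambda>z. D * (case z of (\<theta>, \<xi>) \<Rightarrow> \<bar>\<theta> \<bullet> \<xi>\<bar> powr p * g \<theta>))"
      using P by (rule integrable_mult_right)
    have "(\<lambda>z. m (snd z)) \<in> borel_measurable (?S \<Otimes>\<^sub>M ?S)" using m by measurable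
    from borel_measurable_times[OF borel_measurable_integrable[OF P] this]
    show "(\<lambda>(\<theta>, \<xi>). (\<bar>\<theta> \<bullet> \<xi>\<bar> powr p * g \<theta>) * m \<xi>) \<in> borel_measurable (?S \<Otimes>\<^sub>M ?S)"
      by (simp add: case_prod_beta')
    show "AE z in ?S \<Otimes>\<^sub>M ?S. norm (case z of (\<theta>, \<xi>) \<Rightarrow> (\<bar>\<theta> \<bullet> \<xi>\<bar> powr p * g \<theta>) * m \<xi>)
        \<le> norm (D * (case z of (\<theta>, \<xi>) \<Rightarrow> \<bar>\<theta> \<bullet> \<xi>\<bar> powr p * g \<theta>))"
    proof (rule AE_I2)
      fix z :: "(real ^ 'n) \<times> (real ^ 'n)" assume "z \<in> space (?S \<Otimes>\<^sub>M ?S)"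
      then have "\<bar>m (snd z)\<bar> \<le> \<bar>D\<bar>" using D[of "snd z"] by (auto simp: space_pair_measure)
      then show "norm (case z of (\<theta>, \<xi>) \<Rightarrow> (\<bar>\<theta> \<bullet> \<xi>\<bar> powr p * g \<theta>) * m \<xi>)
        \<le> norm (D * (case z of (\<theta>, \<xi>) \<Rightarrow> \<bar>\<theta> \<bullet> \<xi>\<bar> powr p * g \<theta>))"
        by (simp add: case_prod_beta' abs_mult mult.commute[of "\<bar>D\<bar>"] mult_left_mono)
    qed
  qed
  from pair_sigma_finite.Fubini_integral[OF pair_sigma_finite_sphere this]
  have "(\<integral>\<xi>. (\<integral>\<theta>. (\<bar>\<theta> \<bullet> \<xi>\<bar> powr p * g \<theta>) * m \<xi> \<partial>?S) \<partial>?S) = (\<integral>\<theta>. (\<integral>\<xi>. g \<theta> * (\<bar>\<theta> \<bullet> \<xi>\<bar> powr p * m \<xi>) \<partial>?S) \<partial>?S)"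
    by (simp add: mult_ac)
  then show ?thesis by simp
qed

lemma abs_inner_powr_le_one:
  assumes "norm x = 1" "norm y = 1" "q > 0"
  shows "\<bar>x \<bullet> y\<bar> powr q \<le> 1"
  using Cauchy_Schwarz_ineq2[of x y] assms powr_mono2[of q "\<bar>x \<bullet> y\<bar>" 1] by simp

lemma sphere_potential_moments:
  fixes b :: "real ^ 'n \<Rightarrow> real"
  assumes q: "q > 0" and b: "integrable sphere_measure b" and l: "norm l = 1"
  shows "(\<integral>x. (\<integral>\<xi>. \<bar>x \<bullet> \<xi>\<bar> powr q * b \<xi> \<partial>sphere_measure) * (x \<bullet> l) ^ (2 * j) \<partial>sphere_measure) =
    (\<integral>\<xi>. b \<xi> * (\<integral>x. \<bar>x \<bullet> \<xi>\<bar> powr q * (x \<bullet> l) ^ (2 * j) \<partial>sphere_measure) \<partial>sphere_measure)"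
proof -
  have "(\<lambda>x. (x \<bullet> l) ^ (2 * j)) \<in> borel_measurable sphere_measure"
    by (intro borel_measurable_sphere_measureI) measurable
  then show ?thesis
    using sphere_kernel_Fubini[of q b "\<lambda>x. (x \<bullet> l) ^ (2 * j)" 1] q b abs_inner_power_le_one[OF _ l]
    by (simp add: inner_commute)
qed

lemma continuous_on_sphere_potential:
  fixes b :: "real ^ 'n \<Rightarrow> real"
  assumes q: "q > 0" and b: "integrable sphere_measure b"
  shows "continuous_on (sphere 0 1) (\<lambda>x. \<integral>\<xi>. \<bar>x \<bullet> \<xi>\<bar> powr q * b \<xi> \<partial>sphere_measure)"
  unfolding continuous_on_sequentially
proof (intro allI ballI impI)
  fix X :: "nat \<Rightarrow> real ^ 'n" and a
  assume a: "a \<in> sphere 0 1" and X: "(\<forall>n. X n \<in> sphere 0 1) \<and> X \<longlonglongrightarrow> a"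
  let ?S = "sphere_measure :: (real ^ 'n) measure"
  have bm [measurable]: "b \<in> borel_measurable ?S" using b by auto
  have m: "(\<lambda>\<xi>. \<bar>x \<bullet> \<xi>\<bar> powr q * b \<xi>) \<in> borel_measurable ?S" for x :: "real ^ 'n"
    by (intro borel_measurable_times bm borel_measurable_sphere_measureI) measurable
  have "(\<lambda>n. \<integral>\<xi>. \<bar>X n \<bullet> \<xi>\<bar> powr q * b \<xi> \<partial>?S) \<longlonglongrightarrow> (\<integral>\<xi>. \<bar>a \<bullet> \<xi>\<bar> powr q * b \<xi> \<partial>?S)"
  proof (rule integral_dominated_convergence[where w="\<lambda>\<xi>. \<bar>b \<xi>\<bar>"])
    show "AE \<xi> in ?S. (\<lambda>n. \<bar>X n \<bullet> \<xi>\<bar> powr q * b \<xi>) \<longlonglongrightarrow> \<bar>a \<bullet> \<xi>\<bar> powr q * b \<xi>"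
      using X q by (intro AE_I2 tendsto_intros) auto
    show "AE \<xi> in ?S. norm (\<bar>X n \<bullet> \<xi>\<bar> powr q * b \<xi>) \<le> \<bar>b \<xi>\<bar>" for n
    proof (rule AE_I2)
      fix \<xi> :: "real ^ 'n" assume "\<xi> \<in> space ?S"
      then have "\<bar>X n \<bullet> \<xi>\<bar> powr q \<le> 1" using X q by (intro abs_inner_powr_le_one) auto
      then show "norm (\<bar>X n \<bullet> \<xi>\<bar> powr q * b \<xi>) \<le> \<bar>b \<xi>\<bar>"
        by (simp add: abs_mult mult_left_le_one_le)
    qed
  qed (use b m in auto)
  then show "((\<lambda>x. \<integral>\<xi>. \<bar>x \<bullet> \<xi>\<bar> powr q * b \<xi> \<partial>?S) \<circ> X) \<longlonglongrightarrow> (\<integral>\<xi>. \<bar>a \<bullet> \<xi>\<bar> powr q * b \<xi> \<partial>?S)"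
    by (simp add: comp_def)
qed

text \<open>Fubini brings the moments \<open>f \<xi>\<close> of the kernel under the integral
  against \<open>b\<close>, where \<open>k\<close> recursion steps turn them into a multiple of
  \<open>moment_series B\<close> with \<open>B = - n - p\<close>. After inserting \<open>b\<close>
  and exchanging once more, \<open>sphere_dual_moment\<close> returns the moments of
  \<open>g\<close>. The distribution \<open>\<Delta>\<^sup>k\<close> of the potential itself is
  never formed.\<close>

lemma laplacian_moments_sphere_potential:
  fixes g b :: "real ^ 'n \<Rightarrow> real"
  assumes q: "q > 0" "q \<notin> \<int>" and p: "p = - real CARD('n) - q + 2 * real k" "p > -1"
    and g: "integrable sphere_measure g" and l: "norm l = 1"
    and b: "integrable sphere_measure b" "\<And>\<xi>. b \<xi> = c * (\<integral>\<theta>. \<bar>\<theta> \<bullet> \<xi>\<bar> powr p * g \<theta> \<partial>sphere_measure)"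
    and c: "c * (sphere_moment CARD('n) q * laplacian_factor CARD('n) q k * sphere_moment CARD('n) p) = 1"
  shows "laplacian_moments CARD('n) q k
      (\<lambda>j. \<integral>x. (\<integral>\<xi>. \<bar>x \<bullet> \<xi>\<bar> powr q * b \<xi> \<partial>sphere_measure) * (x \<bullet> l) ^ (2 * j) \<partial>sphere_measure) j =
    (\<integral>\<theta>. g \<theta> * (\<theta> \<bullet> l) ^ (2 * j) \<partial>sphere_measure)"
proof -
  let ?n = "CARD('n)"
  let ?h = "\<lambda>j. fact j / pochhammer ((real ?n + q) / 2) j"
  let ?m = "\<lambda>\<xi> j. moment_series q (1 - (\<xi> \<bullet> l)\<^sup>2) $$ j"
  let ?S = "sphere_measure :: (real ^ 'n) measure"
  let ?F = "laplacian_factor ?n q k"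
  let ?W = "sphere_moment ?n q"
  define f where "f = (\<lambda>\<xi> j. \<integral>x. \<bar>x \<bullet> \<xi>\<bar> powr q * (x \<bullet> l) ^ (2 * j) \<partial>?S)"
  define B where "B = - real ?n - p"
  define ms where "ms = (\<lambda>j (\<xi> :: real ^ 'n). moment_series B (1 - (\<xi> \<bullet> l)\<^sup>2) $$ j)"
  define h where "h = fact j / pochhammer (- p / 2) j"
  have Bq: "q - 2 * real k = B" using p by (simp add: B_def)
  \<comment> \<open>Because of this identity nothing depending on \<open>j\<close> survives: after
    \<open>k\<close> steps the normalization \<open>fact j / pochhammer\<close> is the reciprocal of
    the coefficient in \<open>sphere_dual_moment\<close>.\<close>
  have hp: "(real ?n + B) / 2 = - p / 2" by (simp add: B_def)
  have p0: "pochhammer (- p / 2) j \<noteq> 0"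
    using pochhammer_half_nonzero[OF diff_even_notin_Ints[OF q(2)], of ?n k j] unfolding Bq hp .
  have f: "f \<xi> j = ?W * (?h j * ?m \<xi> j)"
    if "norm \<xi> = 1" for \<xi> j
    using sphere_even_moment[of q \<xi> l j] q(1) that l pochhammer_half_nonzero[OF q(2), of ?n j]
    by (simp add: f_def field_simps)
  have lf: "laplacian_moments ?n q k (f \<xi>) j = ?W * ?F * h * ms j \<xi>"
    if "norm \<xi> = 1" for \<xi>
  proof -
    have "f \<xi> = (\<lambda>j. ?W * (?h j * ?m \<xi> j))"
      using f[OF that] by auto
    then show ?thesis
      by (simp only: laplacian_moments_scale laplacian_moments_moment_series[OF q(2)] Bq hp ms_def h_def mult.assoc)
  qed
  have bi: "integrable ?S (\<lambda>\<xi>. b \<xi> * f \<xi> j)" for j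
  proof (rule Bochner_Integration.integrable_bound)
    let ?C = "\<bar>?W\<bar> * (\<bar>?h j\<bar> * moment_series_bound q j)"
    show "integrable ?S (\<lambda>\<xi>. ?C * b \<xi>)" using b(1) by (rule integrable_mult_right)
    have eq: "b \<xi> * f \<xi> j = b \<xi> * (?W * (?h j * ?m \<xi> j))"
      if "\<xi> \<in> space ?S" for \<xi>
      using f[of \<xi> j] that by simp
    have "(\<lambda>\<xi>. b \<xi> * (?W * (?h j * ?m \<xi> j))) \<in> borel_measurable ?S"
      using b(1) unfolding moment_series_def fps_mult_nth binom_series_nth
      by (intro borel_measurable_times) (auto intro!: borel_measurable_sphere_measureI)
    then show "(\<lambda>\<xi>. b \<xi> * f \<xi> j) \<in> borel_measurable ?S"
      by (rule measurable_cong[THEN iffD2, rotated]) (rule eq)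
    show "AE \<xi> in ?S. norm (b \<xi> * f \<xi> j) \<le> norm (?C * b \<xi>)"
    proof (rule AE_I2)
      fix \<xi> :: "real ^ 'n" assume x: "\<xi> \<in> space ?S"
      then have "\<bar>?m \<xi> j\<bar> \<le> moment_series_bound q j"
        using inner_square_le_one[of \<xi> l] l by (intro moment_series_nth_bound) simp
      then have le: "\<bar>?W\<bar> * (\<bar>?h j\<bar> *
          \<bar>?m \<xi> j\<bar>) \<le> ?C"
        by (intro mult_left_mono) auto
      have "norm \<xi> = 1" using x by simp
      then have "\<bar>f \<xi> j\<bar> \<le> ?C" using le by (simp only: f abs_mult)
      then have "\<bar>f \<xi> j\<bar> \<le> \<bar>?C\<bar>" by (rule order_trans[OF _ abs_ge_self])
      then show "norm (b \<xi> * f \<xi> j) \<le> norm (?C * b \<xi>)"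
        unfolding real_norm_def abs_mult[of _ "b \<xi>"] abs_mult[of "b \<xi>"]
        by (subst mult.commute) (rule mult_right_mono, auto)
    qed
  qed
  have msm: "ms j \<in> borel_measurable ?S"
    unfolding ms_def moment_series_def fps_mult_nth binom_series_nth
    by (intro borel_measurable_sphere_measureI) measurable
  have msb: "\<bar>ms j \<xi>\<bar> \<le> moment_series_bound B j" if "norm \<xi> = 1" for \<xi>
    unfolding ms_def using inner_square_le_one[OF that l] by (intro moment_series_nth_bound) simp
  have "laplacian_moments ?n q k
      (\<lambda>j. \<integral>x. (\<integral>\<xi>. \<bar>x \<bullet> \<xi>\<bar> powr q * b \<xi> \<partial>?S) * (x \<bullet> l) ^ (2 * j) \<partial>?S) j =
     laplacian_moments ?n q k (\<lambda>j. \<integral>\<xi>. b \<xi> * f \<xi> j \<partial>?S) j"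
    unfolding f_def sphere_potential_moments[OF q(1) b(1) l] ..
  also have "\<dots> = (\<integral>\<xi>. b \<xi> * laplacian_moments ?n q k (f \<xi>) j \<partial>?S)"
    using laplacian_moments_integral[of ?S b f ?n q k j, OF bi] by blast
  also have "\<dots> = (\<integral>\<xi>. (?W * ?F * h * c) *
      ((\<integral>\<theta>. \<bar>\<theta> \<bullet> \<xi>\<bar> powr p * g \<theta> \<partial>?S) * ms j \<xi>) \<partial>?S)"
    by (intro Bochner_Integration.integral_cong refl) (simp add: lf b(2))
  also have "\<dots> = (?W * ?F * h * c) *
      (\<integral>\<theta>. g \<theta> * (\<integral>\<xi>. \<bar>\<theta> \<bullet> \<xi>\<bar> powr p * ms j \<xi> \<partial>?S) \<partial>?S)"
    using sphere_kernel_Fubini[OF p(2) g msm msb] by simp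
  also have "(\<integral>\<theta>. g \<theta> * (\<integral>\<xi>. \<bar>\<theta> \<bullet> \<xi>\<bar> powr p * ms j \<xi> \<partial>?S) \<partial>?S) =
     (\<integral>\<theta>. (sphere_moment ?n p * (pochhammer (- p / 2) j / fact j)) * (g \<theta> * (\<theta> \<bullet> l) ^ (2 * j)) \<partial>?S)"
    unfolding ms_def B_def
    by (intro Bochner_Integration.integral_cong refl) (simp add: sphere_dual_moment[OF p(2) _ l])
  also have "(?W * ?F * h * c) * \<dots> =
     (c * (?W * ?F * sphere_moment ?n p)) * (h * (pochhammer (- p / 2) j / fact j)) *
       (\<integral>\<theta>. g \<theta> * (\<theta> \<bullet> l) ^ (2 * j) \<partial>?S)"
    by simp
  also have "h * (pochhammer (- p / 2) j / fact j) = 1"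
    using p0 by (simp add: h_def)
  finally show ?thesis unfolding c by simp
qed

text \<open>Tested with \<open>zonal_bump\<close>, each side of the weak equation is a moment times
  the same radial moment, as the degree of \<open>g\<close> is \<open>q - 2 * k\<close>; that factor
  is positive and cancels.\<close>

lemma laplacian_moments_distr_laplacian:
  fixes u g :: "real ^ 'n \<Rightarrow> real"
  assumes u: "continuous_on (sphere 0 1) u" "\<And>x r. r > 0 \<Longrightarrow> norm x = 1 \<Longrightarrow> u (r *\<^sub>R x) = r powr q * u x"
    and g: "integrable sphere_measure g" "\<And>x r. r > 0 \<Longrightarrow> norm x = 1 \<Longrightarrow> g (r *\<^sub>R x) = r powr (q - 2 * real k) * g x"
    and d: "distr_laplacian_power_on (- {0}) k u g" and l: "norm l = 1"
  shows "laplacian_moments CARD('n) q k (\<lambda>j. \<integral>x. u x * (x \<bullet> l) ^ (2 * j) \<partial>sphere_measure) j =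
    (\<integral>\<theta>. g \<theta> * (\<theta> \<bullet> l) ^ (2 * j) \<partial>sphere_measure)"
proof -
  obtain h where h: "h \<in> profiles" "\<And>a. radial_moment h a > 0" using profile_radial_moment_pos by blast
  have ui: "integrable sphere_measure (\<lambda>x. u x * (x \<bullet> l) ^ (2 * j))" for j
    by (intro integrable_continuous_on_sphere continuous_intros u)
  have gi: "integrable sphere_measure (\<lambda>x. g x * (x \<bullet> l) ^ (2 * j))"
  proof (rule Bochner_Integration.integrable_bound[OF g(1)])
    show "(\<lambda>x. g x * (x \<bullet> l) ^ (2 * j)) \<in> borel_measurable sphere_measure"
      using g(1) by (intro borel_measurable_times) (auto intro!: borel_measurable_sphere_measureI)
    show "AE x in sphere_measure. norm (g x * (x \<bullet> l) ^ (2 * j)) \<le> norm (g x)"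
    proof (rule AE_I2)
      fix x :: "real ^ 'n" assume "x \<in> space sphere_measure"
      then have "\<bar>(x \<bullet> l) ^ (2 * j)\<bar> \<le> 1" using l by (intro abs_inner_power_le_one) auto
      then show "norm (g x * (x \<bullet> l) ^ (2 * j)) \<le> norm (g x)"
        by (simp add: abs_mult mult_left_le)
    qed
  qed
  let ?a = "q - 2 * real k + 2 * real j + real CARD('n) - 1"
  have L: "(\<integral>x. u x * (laplacian ^^ k) (zonal_bump h l j) x \<partial>lborel) =
    laplacian_moments CARD('n) q k (\<lambda>j. \<integral>x. u x * (x \<bullet> l) ^ (2 * j) \<partial>sphere_measure) j * radial_moment h ?a"
    using has_bochner_integral_laplacian_power_zonal_bump[OF u(2) ui l h(1), of k j]
    by (simp add: has_bochner_integral_iff)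
  have R: "(\<integral>x. g x * zonal_bump h l j x \<partial>lborel) =
    (\<integral>\<theta>. g \<theta> * (\<theta> \<bullet> l) ^ (2 * j) \<partial>sphere_measure) * radial_moment h ?a"
    using has_bochner_integral_homogeneous_zonal_bump[OF g(2) gi h(1)]
    by (simp add: has_bochner_integral_iff)
  have "(\<integral>x. u x * (laplacian ^^ k) (zonal_bump h l j) x \<partial>lborel) = (\<integral>x. g x * zonal_bump h l j x \<partial>lborel)"
    using d zonal_bump_test_function[OF h(1)] by (auto simp: distr_laplacian_power_on_def)
  then show ?thesis unfolding L R using h(2)[of ?a] by simp
qed

text \<open>Injectivity of the recursion is used for each direction \<open>y\<close> separately. The
  difference of \<open>u\<close> and the potential is continuous and even with vanishing even
  moments, and both signs of it are fed into
  \<open>even_continuous_nonpos_of_moments\<close>.\<close>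

lemma sphere_potential_unique:
  fixes u g b :: "real ^ 'n \<Rightarrow> real"
  assumes q: "q > 0" "q \<notin> \<int>" and p: "p = - real CARD('n) - q + 2 * real k" "p > -1"
    and u: "continuous_on (sphere 0 1) u" "\<And>x r. r > 0 \<Longrightarrow> norm x = 1 \<Longrightarrow> u (r *\<^sub>R x) = r powr q * u x"
      "\<And>x. norm x = 1 \<Longrightarrow> u (- x) = u x"
    and g: "integrable sphere_measure g" "\<And>x r. r > 0 \<Longrightarrow> norm x = 1 \<Longrightarrow> g (r *\<^sub>R x) = r powr (q - 2 * real k) * g x"
    and d: "distr_laplacian_power_on (- {0}) k u g"
    and b: "integrable sphere_measure b" "\<And>\<xi>. b \<xi> = c * (\<integral>\<theta>. \<bar>\<theta> \<bullet> \<xi>\<bar> powr p * g \<theta> \<partial>sphere_measure)"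
    and c: "c * (sphere_moment CARD('n) q * laplacian_factor CARD('n) q k * sphere_moment CARD('n) p) = 1"
    and l: "norm l = 1"
  shows "u l = (\<integral>\<xi>. \<bar>l \<bullet> \<xi>\<bar> powr q * b \<xi> \<partial>sphere_measure)"
proof -
  define v where "v = (\<lambda>x. \<integral>\<xi>. \<bar>x \<bullet> \<xi>\<bar> powr q * b \<xi> \<partial>sphere_measure)"
  have vc: "continuous_on (sphere 0 1) v"
    unfolding v_def by (rule continuous_on_sphere_potential[OF q(1) b(1)])
  have mom: "(\<integral>x. u x * (x \<bullet> y) ^ (2 * j) \<partial>sphere_measure) = (\<integral>x. v x * (x \<bullet> y) ^ (2 * j) \<partial>sphere_measure)"
    if y: "norm y = 1" for y j
  proof -
    have "laplacian_moments CARD('n) q k (\<lambda>j. \<integral>x. u x * (x \<bullet> y) ^ (2 * j) \<partial>sphere_measure) =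
       laplacian_moments CARD('n) q k (\<lambda>j. \<integral>x. v x * (x \<bullet> y) ^ (2 * j) \<partial>sphere_measure)"
      unfolding v_def
      using laplacian_moments_distr_laplacian[OF u(1,2) g d y]
        laplacian_moments_sphere_potential[OF q p g(1) y b c] by auto
    from laplacian_moments_inj[OF q(2) this] show ?thesis by meson
  qed
  have ui: "integrable sphere_measure (\<lambda>x. u x * (x \<bullet> y) ^ (2 * j))"
    and vi: "integrable sphere_measure (\<lambda>x. v x * (x \<bullet> y) ^ (2 * j))" for y j
    by (intro integrable_continuous_on_sphere continuous_intros u vc)+
  have ve: "v (- x) = v x" for x by (simp add: v_def)
  have "u l - v l \<le> 0"
    by (rule even_continuous_nonpos_of_moments[of "\<lambda>x. u x - v x"])
      (use mom ui vi ve u(3) l in \<open>auto intro!: continuous_intros u(1) vc simp: left_diff_distrib\<close>)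
  moreover have "v l - u l \<le> 0"
    by (rule even_continuous_nonpos_of_moments[of "\<lambda>x. v x - u x"])
      (use mom ui vi ve u(3) l in \<open>auto intro!: continuous_intros u(1) vc simp: left_diff_distrib\<close>)
  ultimately show ?thesis by (simp add: v_def)
qed

section \<open>Norm estimates\<close>

lemma W_const_eq_sphere_moment:
  fixes \<eta> :: "real ^ 'n"
  assumes "p > -1" "norm \<eta> = 1"
  shows "W_const \<eta> p = sphere_moment CARD('n) p"
  using has_bochner_integral_sphere_abs_inner_powr[OF assms]
  by (simp add: W_const_def has_bochner_integral_iff)

lemma sphere_L1_norm_kernel_le:
  fixes g b :: "real ^ 'n \<Rightarrow> real"
  assumes p: "p > -1" and g: "integrable sphere_measure g"
    and b: "integrable sphere_measure b" "\<And>\<xi>. b \<xi> = c * (\<integral>\<theta>. \<bar>\<theta> \<bullet> \<xi>\<bar> powr p * g \<theta> \<partial>sphere_measure)"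
  shows "sphere_L1_norm b \<le> \<bar>c\<bar> * sphere_moment CARD('n) p * sphere_L1_norm g"
proof -
  let ?S = "sphere_measure :: (real ^ 'n) measure"
  have g': "integrable ?S (\<lambda>\<theta>. \<bar>g \<theta>\<bar>)" using g by auto
  have i: "integrable ?S (\<lambda>\<xi>. \<integral>\<theta>. \<bar>\<theta> \<bullet> \<xi>\<bar> powr p * \<bar>g \<theta>\<bar> \<partial>?S)"
    using pair_sigma_finite.integrable_snd[OF pair_sigma_finite_sphere sphere_kernel_integrable[OF p g']]
    by simp
  have "sphere_L1_norm b \<le> (\<integral>\<xi>. \<bar>c\<bar> * (\<integral>\<theta>. \<bar>\<theta> \<bullet> \<xi>\<bar> powr p * \<bar>g \<theta>\<bar> \<partial>?S) \<partial>?S)"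
    unfolding sphere_L1_norm_def
  proof (rule integral_mono)
    fix \<xi> :: "real ^ 'n"
    \<comment> \<open>Valid for every \<open>\<xi>\<close>: where the kernel integral does not
      exist, the Bochner integral is 0 by default.\<close>
    have "\<bar>\<integral>\<theta>. \<bar>\<theta> \<bullet> \<xi>\<bar> powr p * g \<theta> \<partial>?S\<bar> \<le> (\<integral>\<theta>. \<bar>\<theta> \<bullet> \<xi>\<bar> powr p * \<bar>g \<theta>\<bar> \<partial>?S)"
      using integral_norm_bound[of ?S "\<lambda>\<theta>. \<bar>\<theta> \<bullet> \<xi>\<bar> powr p * g \<theta>"] by (simp add: abs_mult)
    then show "\<bar>b \<xi>\<bar> \<le> \<bar>c\<bar> * (\<integral>\<theta>. \<bar>\<theta> \<bullet> \<xi>\<bar> powr p * \<bar>g \<theta>\<bar> \<partial>?S)"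
      unfolding b(2) abs_mult by (rule mult_left_mono) simp
  qed (use b(1) i in auto)
  also have "\<dots> = \<bar>c\<bar> * (\<integral>\<xi>. (\<integral>\<theta>. \<bar>\<theta> \<bullet> \<xi>\<bar> powr p * \<bar>g \<theta>\<bar> \<partial>?S) * 1 \<partial>?S)"
    by simp
  also have "(\<integral>\<xi>. (\<integral>\<theta>. \<bar>\<theta> \<bullet> \<xi>\<bar> powr p * \<bar>g \<theta>\<bar> \<partial>?S) * 1 \<partial>?S) =
      (\<integral>\<theta>. \<bar>g \<theta>\<bar> * (\<integral>\<xi>. \<bar>\<theta> \<bullet> \<xi>\<bar> powr p * 1 \<partial>?S) \<partial>?S)"
    by (rule sphere_kernel_Fubini[OF p g', where D=1]) auto
  also have "\<dots> = (\<integral>\<theta>. \<bar>g \<theta>\<bar> * sphere_moment CARD('n) p \<partial>?S)"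
  proof (intro Bochner_Integration.integral_cong refl)
    fix \<theta> :: "real ^ 'n" assume "\<theta> \<in> space ?S"
    then show "\<bar>g \<theta>\<bar> * (\<integral>\<xi>. \<bar>\<theta> \<bullet> \<xi>\<bar> powr p * 1 \<partial>?S) = \<bar>g \<theta>\<bar> * sphere_moment CARD('n) p"
      using has_bochner_integral_sphere_abs_inner_powr[OF p, of \<theta>]
      by (simp add: has_bochner_integral_iff inner_commute)
  qed
  also have "\<bar>c\<bar> * \<dots> = \<bar>c\<bar> * sphere_moment CARD('n) p * sphere_L1_norm g"
    by (simp add: sphere_L1_norm_def)
  finally show ?thesis .
qed

text \<open>Over a null measure the essential supremum would be \<open>-\<infinity>\<close>;
  positivity of the caps shows that the sphere is not null.\<close>

lemma sphere_Linf_norm_nonneg: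
  fixes f :: "'a::euclidean_space \<Rightarrow> real"
  shows "sphere_Linf_norm f \<ge> 0"
proof (rule ccontr)
  assume n: "\<not> sphere_Linf_norm f \<ge> 0"
  have "AE x in sphere_measure. ereal \<bar>f x\<bar> \<le> sphere_Linf_norm f"
    unfolding sphere_Linf_norm_def by (rule esssup_AE)
  then have "AE x in (sphere_measure :: 'a measure). False"
  proof eventually_elim
    case (elim x)
    have "(0::ereal) \<le> ereal \<bar>f x\<bar>" by simp
    then show False using elim n by (meson order_trans)
  qed
  moreover have "{x. norm x = 1} = sphere (0 :: 'a) 1" by auto
  ultimately have "emeasure sphere_measure (sphere 0 1 :: 'a set) = 0"
    using AE_iff_measurable[of "sphere 0 1" sphere_measure "\<lambda>_::'a. False"] sets.top[of "sphere_measure :: 'a measure"]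
    by simp
  moreover obtain l :: 'a where l: "norm l = 1" using nonempty_Basis norm_Basis by blast
  moreover have "measure sphere_measure {x \<in> sphere 0 1. (x \<bullet> l)\<^sup>2 > 0} \<le> measure sphere_measure (sphere 0 1 :: 'a set)"
    using sphere.bounded_measure[of "{x \<in> sphere 0 1. (x \<bullet> l)\<^sup>2 > 0}"] by simp
  ultimately show False using measure_sphere_cap_pos[OF l, of 0] by (simp add: measure_def)
qed

text \<open>For essentially bounded \<open>g\<close> the kernel integral exists for every
  \<open>\<xi>\<close> of the sphere, and the integral of the kernel does not depend on
  \<open>\<xi>\<close>, so the bound on \<open>b\<close> is pointwise.\<close>

lemma sphere_Linf_norm_kernel_le:
  fixes g b :: "real ^ 'n \<Rightarrow> real"
  assumes p: "p > -1" and g: "integrable sphere_measure g" "g \<in> sphere_Linf"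
    and b: "integrable sphere_measure b" "\<And>\<xi>. b \<xi> = c * (\<integral>\<theta>. \<bar>\<theta> \<bullet> \<xi>\<bar> powr p * g \<theta> \<partial>sphere_measure)"
  shows "b \<in> sphere_Linf \<and> sphere_Linf_norm b \<le> ereal (\<bar>c\<bar> * sphere_moment CARD('n) p) * sphere_Linf_norm g"
proof -
  let ?S = "sphere_measure :: (real ^ 'n) measure"
  have "sphere_Linf_norm g < \<infinity>" using g(2) by (simp add: sphere_Linf_def)
  with sphere_Linf_norm_nonneg[of g] obtain K where K: "sphere_Linf_norm g = ereal K" "K \<ge> 0"
    by (cases "sphere_Linf_norm g") auto
  have gK: "AE \<theta> in ?S. \<bar>g \<theta>\<bar> \<le> K"
    using esssup_AE[of "\<lambda>\<theta>. ereal \<bar>g \<theta>\<bar>" ?S] unfolding sphere_Linf_norm_def[symmetric] K(1) by simp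
  have gm: "g \<in> borel_measurable ?S" using g(1) by auto
  have bm: "b \<in> borel_measurable ?S" using b(1) by auto
  have bK: "\<bar>b \<xi>\<bar> \<le> \<bar>c\<bar> * sphere_moment CARD('n) p * K" if x: "norm \<xi> = 1" for \<xi>
  proof -
    have h: "has_bochner_integral ?S (\<lambda>\<theta>. \<bar>\<theta> \<bullet> \<xi>\<bar> powr p * K) (sphere_moment CARD('n) p * K)"
      by (rule has_bochner_integral_mult_left) (rule has_bochner_integral_sphere_abs_inner_powr[OF p x])
    have le: "AE \<theta> in ?S. \<bar>\<bar>\<theta> \<bullet> \<xi>\<bar> powr p * g \<theta>\<bar> \<le> \<bar>\<theta> \<bullet> \<xi>\<bar> powr p * K"
      using gK by eventually_elim (simp add: abs_mult mult_left_mono)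
    have i: "integrable ?S (\<lambda>\<theta>. \<bar>\<theta> \<bullet> \<xi>\<bar> powr p * g \<theta>)"
    proof (rule Bochner_Integration.integrable_bound)
      show "integrable ?S (\<lambda>\<theta>. \<bar>\<theta> \<bullet> \<xi>\<bar> powr p * K)" using h by (auto simp: has_bochner_integral_iff)
      show "(\<lambda>\<theta>. \<bar>\<theta> \<bullet> \<xi>\<bar> powr p * g \<theta>) \<in> borel_measurable ?S"
        by (intro borel_measurable_times gm borel_measurable_sphere_measureI) measurable
      show "AE \<theta> in ?S. norm (\<bar>\<theta> \<bullet> \<xi>\<bar> powr p * g \<theta>) \<le> norm (\<bar>\<theta> \<bullet> \<xi>\<bar> powr p * K)"
        using le by eventually_elim (use K(2) in \<open>simp add: abs_mult\<close>)
    qed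
    have "\<bar>\<integral>\<theta>. \<bar>\<theta> \<bullet> \<xi>\<bar> powr p * g \<theta> \<partial>?S\<bar> \<le> (\<integral>\<theta>. \<bar>\<bar>\<theta> \<bullet> \<xi>\<bar> powr p * g \<theta>\<bar> \<partial>?S)"
      by (rule integral_abs_bound)
    also have "\<dots> \<le> (\<integral>\<theta>. \<bar>\<theta> \<bullet> \<xi>\<bar> powr p * K \<partial>?S)"
      using i h le by (intro integral_mono_AE) (auto simp: has_bochner_integral_iff)
    also have "\<dots> = sphere_moment CARD('n) p * K" using h by (simp add: has_bochner_integral_iff)
    finally show ?thesis unfolding b(2) abs_mult mult.assoc by (rule mult_left_mono) simp
  qed
  have "sphere_Linf_norm b \<le> ereal (\<bar>c\<bar> * sphere_moment CARD('n) p * K)"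
    unfolding sphere_Linf_norm_def
    by (rule esssup_I) (use bm bK in auto)
  then have le: "sphere_Linf_norm b \<le> ereal (\<bar>c\<bar> * sphere_moment CARD('n) p) * sphere_Linf_norm g"
    by (simp add: K)
  moreover have "sphere_Linf_norm b < \<infinity>" using le K by (auto simp: less_top[symmetric])
  ultimately show ?thesis using bm by (simp add: sphere_Linf_def)
qed

(* The restriction of g to the sphere, a null set, is meaningful because g is the even homogeneous
   representative of the distribution, whose degree q - 2 k is forced by that of H powr q. *)
theorem theorem2:
  fixes H g :: "real ^ 'n \<Rightarrow> real" and q p :: real and n k :: nat
  assumes n: "n = CARD('n)" "n > 1"
    and q: "q > 0" "q \<notin> \<int>"
    and H: "continuous_on UNIV H" "\<And>x. H x \<ge> 0" "even_homogeneous_on UNIV 1 H"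
    and k: "k = (if even (n + nat \<lfloor>q\<rfloor>) then (n + nat \<lfloor>q\<rfloor>) div 2 else (n + nat \<lfloor>q\<rfloor> + 1) div 2)"
    and p: "p = - real n - q + 2 * real k"
    and g: "distr_laplacian_power_on (- {0}) k (\<lambda>x. H x powr q) g"
      "even_homogeneous_on (- {0}) (q - 2 * real k) g"
    and g_L1: "integrable sphere_measure g"
  shows "\<exists>b. blaschke_levy_representation q (\<lambda>x. H x powr q) b \<and>
    (AE \<xi> in sphere_measure.
      integrable sphere_measure (\<lambda>\<theta>. \<bar>\<theta> \<bullet> \<xi>\<bar> powr p * g \<theta>) \<and>
      b \<xi> = (-1) ^ k * (pi / (2 * (2 * pi) ^ (n - 1) * C_const p * C_const q)) *
        (\<integral>\<theta>. \<bar>\<theta> \<bullet> \<xi>\<bar> powr p * g \<theta> \<partial>sphere_measure)) \<and>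
    (\<forall>\<eta>::real ^ 'n. norm \<eta> = 1 \<longrightarrow>
      sphere_L1_norm b
        \<le> pi * W_const \<eta> p / (2 * (2 * pi) ^ (n - 1) * \<bar>C_const p * C_const q\<bar>) * sphere_L1_norm g) \<and>
    (g \<in> sphere_Linf \<longrightarrow> b \<in> sphere_Linf \<and>
      (\<forall>\<eta>::real ^ 'n. norm \<eta> = 1 \<longrightarrow>
        sphere_Linf_norm b
          \<le> ereal (pi * W_const \<eta> p / (2 * (2 * pi) ^ (n - 1) * \<bar>C_const p * C_const q\<bar>)) * sphere_Linf_norm g))"
proof -
  let ?S = "sphere_measure :: (real ^ 'n) measure"
  define c where "c = (-1) ^ k * (pi / (2 * (2 * pi) ^ (n - 1) * C_const p * C_const q))"
  \<comment> \<open>A total function: where the kernel integral does not exist, which by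
    \<open>AEi\<close> happens only on a null set, the Bochner integral is 0. So the formula for
    \<open>b\<close>, and its evenness, hold at every point.\<close>
  define b where "b = (\<lambda>\<xi>. c * (\<integral>\<theta>. \<bar>\<theta> \<bullet> \<xi>\<bar> powr p * g \<theta> \<partial>?S))"
  define u where "u = (\<lambda>x. H x powr q)"
  have p': "p = - real CARD('n) - q + 2 * real k" using p n by simp
  \<comment> \<open>Rounding up in the choice of \<open>k\<close> gives
    \<open>2 * k \<ge> n + \<lfloor>q\<rfloor>\<close>, hence
    \<open>p \<ge> \<lfloor>q\<rfloor> - q > -1\<close>.\<close>
  have p1: "p > -1"
  proof -
    have "2 * k \<ge> n + nat \<lfloor>q\<rfloor>" unfolding k by auto
    then have "2 * real k \<ge> real n + real (nat \<lfloor>q\<rfloor>)" by linarith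
    moreover have "real (nat \<lfloor>q\<rfloor>) > q - 1" using q by linarith
    ultimately show ?thesis unfolding p by linarith
  qed
  have cW: "c * (sphere_moment CARD('n) q * laplacian_factor CARD('n) q k * sphere_moment CARD('n) p) = 1"
    unfolding c_def n(1) by (rule blaschke_levy_constant) (use q p' p1 n in auto)
  have Wp: "sphere_moment CARD('n) p > 0" using p1 n by (intro sphere_moment_pos) auto
  have swap: "integrable (?S \<Otimes>\<^sub>M ?S) (\<lambda>(\<xi>, \<theta>). \<bar>\<theta> \<bullet> \<xi>\<bar> powr p * g \<theta>)"
    using pair_sigma_finite.integrable_product_swap[OF pair_sigma_finite_sphere sphere_kernel_integrable[OF p1 g_L1]]
    by (simp add: case_prod_beta')
  have AEi: "AE \<xi> in ?S. integrable ?S (\<lambda>\<theta>. \<bar>\<theta> \<bullet> \<xi>\<bar> powr p * g \<theta>)"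
    using pair_sigma_finite.AE_integrable_fst'[OF pair_sigma_finite_sphere swap] by simp
  have bi: "integrable ?S b"
    unfolding b_def using pair_sigma_finite.integrable_fst'[OF pair_sigma_finite_sphere swap]
    by (intro integrable_mult_right) simp
  have b: "b \<xi> = c * (\<integral>\<theta>. \<bar>\<theta> \<bullet> \<xi>\<bar> powr p * g \<theta> \<partial>?S)" for \<xi> by (simp add: b_def)
  have hom: "u (a *\<^sub>R x) = \<bar>a\<bar> powr q * u x" if "a \<noteq> 0" for a x
  proof -
    have "H (a *\<^sub>R x) = \<bar>a\<bar> powr 1 * H x" using H(3) that by (auto simp: even_homogeneous_on_def)
    then show ?thesis using that H(2)[of x] by (simp add: u_def powr_mult)
  qed
  \<comment> \<open>The representation is claimed at the origin too, where the right side vanishes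
    because \<open>0 powr q = 0\<close>; homogeneity with the factor 2 forces the same for
    \<open>u\<close>.\<close>
  have u0: "u 0 = 0"
  proof -
    have "u 0 = 2 powr q * u 0" using hom[of 2 0] by simp
    moreover have "(2::real) powr q \<noteq> 1" using q by simp
    ultimately show ?thesis by simp
  qed
  have uc: "continuous_on (sphere 0 1) u"
    unfolding u_def using H q by (intro continuous_on_powr' continuous_intros) (auto intro: continuous_on_subset)
  have unique: "u x = (\<integral>\<xi>. \<bar>x \<bullet> \<xi>\<bar> powr q * b \<xi> \<partial>?S)" if x: "norm x = 1" for x
  proof (rule sphere_potential_unique[OF q p' p1 uc _ _ g_L1 _ _ bi b cW x])
    show "u (r *\<^sub>R y) = r powr q * u y" if "r > 0" for r y using hom[of r y] that by simp
    show "u (- y) = u y" for y using hom[of "-1" y] by simp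
    show "g (r *\<^sub>R y) = r powr (q - 2 * real k) * g y" if "r > 0" "norm y = 1" for r y
    proof -
      have "y \<noteq> 0" using that(2) by auto
      then show ?thesis using g(2) that(1) by (simp add: even_homogeneous_on_def)
    qed
    show "distr_laplacian_power_on (- {0}) k u g" using g(1) by (simp add: u_def)
  qed
  have rep: "u x = (\<integral>\<xi>. \<bar>x \<bullet> \<xi>\<bar> powr q * b \<xi> \<partial>?S)" for x
  proof (cases "x = 0")
    case False
    define y where "y = x /\<^sub>R norm x"
    have y: "norm y = 1" "x = norm x *\<^sub>R y" using False by (auto simp: y_def)
    have "u x = norm x powr q * u y" using hom[of "norm x" y] False y by simp
    also have "\<dots> = (\<integral>\<xi>. norm x powr q * (\<bar>y \<bullet> \<xi>\<bar> powr q * b \<xi>) \<partial>?S)"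
      unfolding unique[OF y(1)] by simp
    also have "\<dots> = (\<integral>\<xi>. \<bar>x \<bullet> \<xi>\<bar> powr q * b \<xi> \<partial>?S)"
    proof (intro Bochner_Integration.integral_cong refl)
      fix \<xi>
      have "x \<bullet> \<xi> = norm x * (y \<bullet> \<xi>)" using False by (simp add: y_def)
      then show "norm x powr q * (\<bar>y \<bullet> \<xi>\<bar> powr q * b \<xi>) = \<bar>x \<bullet> \<xi>\<bar> powr q * b \<xi>"
        by (simp add: abs_mult powr_mult)
    qed
    finally show ?thesis .
  qed (simp add: u0)
  have bl: "blaschke_levy_representation q (\<lambda>x. H x powr q) b"
    unfolding blaschke_levy_representation_def using bi rep by (auto simp: u_def b_def)
  have cabs: "\<bar>c\<bar> = pi / (2 * (2 * pi) ^ (n - 1) * \<bar>C_const p * C_const q\<bar>)"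
    by (simp add: c_def abs_mult power_abs mult.assoc)
  have W: "pi * W_const \<eta> p / (2 * (2 * pi) ^ (n - 1) * \<bar>C_const p * C_const q\<bar>) = \<bar>c\<bar> * sphere_moment CARD('n) p"
    if "norm \<eta> = 1" for \<eta> :: "real ^ 'n"
    unfolding W_const_eq_sphere_moment[OF p1 that] cabs by simp
  show ?thesis
  proof (intro exI[of _ b] conjI bl allI impI)
    show "AE \<xi> in ?S. integrable ?S (\<lambda>\<theta>. \<bar>\<theta> \<bullet> \<xi>\<bar> powr p * g \<theta>) \<and>
      b \<xi> = (-1) ^ k * (pi / (2 * (2 * pi) ^ (n - 1) * C_const p * C_const q)) *
        (\<integral>\<theta>. \<bar>\<theta> \<bullet> \<xi>\<bar> powr p * g \<theta> \<partial>?S)"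
      using AEi by eventually_elim (simp add: b_def c_def)
    show "sphere_L1_norm b \<le> pi * W_const \<eta> p / (2 * (2 * pi) ^ (n - 1) * \<bar>C_const p * C_const q\<bar>) * sphere_L1_norm g"
      if "norm \<eta> = 1" for \<eta> :: "real ^ 'n"
      unfolding W[OF that] by (rule sphere_L1_norm_kernel_le[OF p1 g_L1 bi b])
    show "b \<in> sphere_Linf" if "g \<in> sphere_Linf"
      using sphere_Linf_norm_kernel_le[OF p1 g_L1 that bi b] by blast
    show "sphere_Linf_norm b \<le> ereal (pi * W_const \<eta> p / (2 * (2 * pi) ^ (n - 1) * \<bar>C_const p * C_const q\<bar>)) * sphere_Linf_norm g"
      if "g \<in> sphere_Linf" "norm \<eta> = 1" for \<eta> :: "real ^ 'n"
      unfolding W[OF that(2)] using sphere_Linf_norm_kernel_le[OF p1 g_L1 that(1) bi b] by blast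
  qed
qed


end
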